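(* Let $n\ge 2$. (1) Let $\varrho\colon \mathrm{Isom}(\mathbf{H}^n)\to\mathrm{Isom}(\mathbf{H}^\infty)$ be a continuous non-elementary action. There exists $t\in(0,1]$ such that $\ell_\varrho(g)=t\,\ell_{\mathbf{H}^n}(g)$ for all $g\in\mathrm{Isom}(\mathbf{H}^n)$. Moreover, $t=1$ if and only if $\varrho$ preserves an $n$-dimensional totally geodesic subspace of $\mathbf{H}^\infty$. (2) For each $t\in(0,1)$ there is, up to conjugacy in $\mathrm{Isom}(\mathbf{H}^\infty)$, exactly one irreducible continuous representation $\varrho_t\colon\mathrm{Isom}(\mathbf{H}^n)\to\mathrm{Isom}(\mathbf{H}^\infty)$ such that $\ell_{\varrho_t}=t\,\ell_{\mathbf{H}^n}$.
   Context: $\mathbf{H}^n$ is real hyperbolic $n$-space. The infinite-dimensional hyperbolic space: let $\mathscr{H}$ be an infinite-dimensional real Hilbert space (separable in part (2)), $L\subset\mathscr{H}$ a line, $0\ne e\in L$, and let $B$ be the symmetric bilinear form with $B(v,v)=|v_L|^2-|v_{L^\perp}|^2$, where $v_L,v_{L^\perp}$ are the orthogonal projections of $v$ on $L$ and $L^\perp$. Then $\mathbf{H}^\infty=\{v\in\mathscr{H}: B(v,v)=1,\ B(v,e)>0\}$ with the distance given by $\cosh d(x,y)=B(x,y)$; it is a complete CAT($-1$) space, with boundary $\partial\mathbf{H}^\infty$ (the set of $B$-isotropic lines). Isometries of $\mathbf{H}^\infty$ are induced by linear maps of $\mathscr{H}$ preserving $B$. An action $\varrho\colon G\to\mathrm{Isom}(\mathbf{H}^\infty)$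 is continuous if all orbit maps $G\to\mathbf{H}^\infty$ are continuous. It is elementary if it fixes a point of $\mathbf{H}^\infty\cup\partial\mathbf{H}^\infty$ or preserves a geodesic. It is irreducible if the associated linear action of $G$ on $\mathscr{H}$ is irreducible (no non-trivial closed invariant subspace); equivalently, it is non-elementary and has no proper closed totally geodesic invariant subspace. Translation lengths: $\ell_\varrho(g)=\inf_{x\in\mathbf{H}^\infty}d(\varrho(g)x,x)$, and $\ell_{\mathbf{H}^n}$ is the translation length function of the standard action on $\mathbf{H}^n$. *)

theory Defs
  imports "HOL-Analysis.Analysis" "HOL-Algebra.Bij"
begin

text \<open>
  The hyperboloid model is set up once, over an arbitrary real inner product space with a
  distinguished vector \<open>e \<noteq> 0\<close>. Over a complete, infinite-dimensional space it is the
  infinite-dimensional hyperbolic space; over a Euclidean space of dimension \<open>n + 1\<close> it is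
  hyperbolic \<open>n\<close>-space.
\<close>

definition axis_part :: "'a::real_inner \<Rightarrow> 'a \<Rightarrow> 'a" where
  "axis_part e v = (inner v e / inner e e) *\<^sub>R e"

definition lorentz :: "'a::real_inner \<Rightarrow> 'a \<Rightarrow> 'a \<Rightarrow> real" where
  "lorentz e v w =
     inner (axis_part e v) (axis_part e w) - inner (v - axis_part e v) (w - axis_part e w)"

definition hyp_space :: "'a::real_inner \<Rightarrow> 'a set" where
  "hyp_space e = {v. lorentz e v v = 1 \<and> lorentz e v e > 0}"

text \<open>
  The value \<open>0\<close> off the hyperboloid is a totalisation, needed because \<open>Metric_space\<close>
  demands symmetry and non-negativity on the whole type.
\<close>

definition hyp_dist :: "'a::real_inner \<Rightarrow> 'a \<Rightarrow> 'a \<Rightarrow> real" where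
  "hyp_dist e x y =
     (if x \<in> hyp_space e \<and> y \<in> hyp_space e then arcosh (lorentz e x y) else 0)"

definition hyp_topology :: "'a::real_inner \<Rightarrow> 'a topology" where
  "hyp_topology e = Metric_space.mtopology (hyp_space e) (hyp_dist e)"

definition hyp_boundary :: "'a::real_inner \<Rightarrow> 'a set set" where
  "hyp_boundary e = {span {v} | v. v \<noteq> 0 \<and> lorentz e v v = 0}"

text \<open>
  As in \<open>BijGroup\<close>, elements are extensional functions, so that an isometry of the
  hyperboloid is represented by exactly one function on the ambient space.
\<close>

definition Isom :: "'a::real_inner \<Rightarrow> ('a \<Rightarrow> 'a) monoid" where
  "Isom e = BijGroup (hyp_space e)
     \<lparr>carrier := {f \<in> Bij (hyp_space e).
        \<forall>x\<in>hyp_space e. \<forall>y\<in>hyp_space e. hyp_dist e (f x) (f y) = hyp_dist e x y}\<rparr>"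

text \<open>
  The topology of pointwise convergence; on an isometry group it coincides with the
  compact-open topology, and for a finite-dimensional hyperbolic space it is the usual Lie
  group topology.
\<close>

definition Isom_topology :: "'a::real_inner \<Rightarrow> ('a \<Rightarrow> 'a) topology" where
  "Isom_topology e =
     subtopology (product_topology (\<lambda>_. hyp_topology e) (hyp_space e)) (carrier (Isom e))"

text \<open>
  The linear map of the ambient space that preserves the form and induces a given isometry;
  it exists and is unique, see \<open>lin_ext_ex1\<close> below.
\<close>

definition lin_ext :: "'a::real_inner \<Rightarrow> ('a \<Rightarrow> 'a) \<Rightarrow> ('a \<Rightarrow> 'a)" where
  "lin_ext e f = (THE A. linear A \<and> (\<forall>v w. lorentz e (A v) (A w) = lorentz e v w) \<and>
                         (\<forall>x\<in>hyp_space e. A x = f x))"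

definition geodesic_line :: "'a::real_inner \<Rightarrow> 'a set \<Rightarrow> bool" where
  "geodesic_line e L \<longleftrightarrow>
     (\<exists>\<gamma>::real \<Rightarrow> 'a. \<gamma> ` UNIV = L \<and> L \<subseteq> hyp_space e \<and>
        (\<forall>s t. hyp_dist e (\<gamma> s) (\<gamma> t) = \<bar>s - t\<bar>))"

definition totally_geodesic :: "'a::real_inner \<Rightarrow> 'a set \<Rightarrow> bool" where
  "totally_geodesic e X \<longleftrightarrow> X \<subseteq> hyp_space e \<and>
     (\<forall>x\<in>X. \<forall>y\<in>X. x \<noteq> y \<longrightarrow>
        (\<forall>L. geodesic_line e L \<and> x \<in> L \<and> y \<in> L \<longrightarrow> L \<subseteq> X))"

text \<open>
  A totally geodesic subspace is the intersection of the hyperboloid with its linear span, and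
  its dimension is one less than that of the span. Since \<open>dim\<close> is \<open>0\<close> on subspaces of infinite
  dimension, the condition below includes that the span has finite dimension.
\<close>

definition totally_geodesic_dim :: "'a::real_inner \<Rightarrow> nat \<Rightarrow> 'a set \<Rightarrow> bool" where
  "totally_geodesic_dim e n X \<longleftrightarrow> totally_geodesic e X \<and> dim (span X) = n + 1"

definition transl_length :: "'a::real_inner \<Rightarrow> ('a \<Rightarrow> 'a) \<Rightarrow> real" where
  "transl_length e f = (INF x\<in>hyp_space e. hyp_dist e (f x) x)"

text \<open>
  Actions of a group \<open>G\<close> on the hyperboloid are homomorphisms \<open>\<rho> \<in> hom G (Isom e)\<close>.
\<close>

definition continuous_action ::
    "'g topology \<Rightarrow> 'a::real_inner \<Rightarrow> ('g \<Rightarrow> 'a \<Rightarrow> 'a) \<Rightarrow> bool" where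
  "continuous_action T e \<rho> \<longleftrightarrow>
     (\<forall>x\<in>hyp_space e. continuous_map T (hyp_topology e) (\<lambda>g. \<rho> g x))"

definition elementary_action ::
    "('g, 'b) monoid_scheme \<Rightarrow> 'a::real_inner \<Rightarrow> ('g \<Rightarrow> 'a \<Rightarrow> 'a) \<Rightarrow> bool" where
  "elementary_action G e \<rho> \<longleftrightarrow>
     (\<exists>x\<in>hyp_space e. \<forall>g\<in>carrier G. \<rho> g x = x) \<or>
     (\<exists>\<xi>\<in>hyp_boundary e. \<forall>g\<in>carrier G. lin_ext e (\<rho> g) ` \<xi> = \<xi>) \<or>
     (\<exists>L. geodesic_line e L \<and> (\<forall>g\<in>carrier G. \<rho> g ` L = L))"

definition irreducible_action ::
    "('g, 'b) monoid_scheme \<Rightarrow> 'a::real_inner \<Rightarrow> ('g \<Rightarrow> 'a \<Rightarrow> 'a) \<Rightarrow> bool" where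
  "irreducible_action G e \<rho> \<longleftrightarrow>
     (\<forall>V. subspace V \<and> closed V \<and> (\<forall>g\<in>carrier G. lin_ext e (\<rho> g) ` V \<subseteq> V) \<longrightarrow>
        V = {0} \<or> V = UNIV)"

definition conjugate_actions ::
    "('g, 'b) monoid_scheme \<Rightarrow> 'a::real_inner \<Rightarrow> ('g \<Rightarrow> 'a \<Rightarrow> 'a) \<Rightarrow> ('g \<Rightarrow> 'a \<Rightarrow> 'a) \<Rightarrow> bool" where
  "conjugate_actions G e \<rho> \<sigma> \<longleftrightarrow>
     (\<exists>h\<in>carrier (Isom e). \<forall>g\<in>carrier G.
        \<sigma> g = h \<otimes>\<^bsub>Isom e\<^esub> \<rho> g \<otimes>\<^bsub>Isom e\<^esub> inv\<^bsub>Isom e\<^esub> h)"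


section \<open>Metric, isometry group and linear extension are well defined\<close>

lemma axis_part_linear: "linear (axis_part e)"
  by (rule linearI) (simp_all add: axis_part_def inner_add_left add_divide_distrib scaleR_add_left)

lemma lorentz_commute: "lorentz e v w = lorentz e w v"
  by (simp add: lorentz_def inner_commute)

lemma lorentz_add_left: "lorentz e (u + v) w = lorentz e u w + lorentz e v w"
  by (simp add: lorentz_def linear_add[OF axis_part_linear] algebra_simps inner_simps)

lemma lorentz_scale_left: "lorentz e (c *\<^sub>R v) w = c * lorentz e v w"
  by (simp add: lorentz_def linear_scale[OF axis_part_linear] algebra_simps inner_simps)

lemma lorentz_add_right: "lorentz e w (u + v) = lorentz e w u + lorentz e w v"
  by (metis lorentz_add_left lorentz_commute)

lemma lorentz_scale_right: "lorentz e w (c *\<^sub>R v) = c * lorentz e w v"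
  by (metis lorentz_scale_left lorentz_commute)

lemma lorentz_zero [simp]: "lorentz e 0 w = 0" "lorentz e w 0 = 0"
  using lorentz_scale_left[of e 0 0 w] lorentz_scale_right[of e w 0 0] by simp_all

lemma lorentz_diff_left: "lorentz e (u - v) w = lorentz e u w - lorentz e v w"
  using lorentz_add_left[of e u "-1 *\<^sub>R v" w] lorentz_scale_left[of e "-1" v w] by simp

lemma lorentz_diff_right: "lorentz e w (u - v) = lorentz e w u - lorentz e w v"
  by (metis lorentz_diff_left lorentz_commute)

lemmas lorentz_simps = lorentz_add_left lorentz_add_right lorentz_scale_left lorentz_scale_right
  lorentz_diff_left lorentz_diff_right

lemma axis_part_decomp:
  assumes "e \<noteq> 0"
  shows "inner e (v - axis_part e v) = 0"
  using assms by (simp add: axis_part_def inner_diff_right inner_commute)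

lemma lorentz_nondegenerate:
  assumes "e \<noteq> 0" "\<And>w. lorentz e u w = 0"
  shows "u = 0"
proof -
  let ?p = "axis_part e u"
  have 1: "axis_part e ?p = ?p"
    using assms(1) by (simp add: axis_part_def)
  have 2: "axis_part e (2 *\<^sub>R ?p - u) = ?p"
    by (simp only: linear_diff[OF axis_part_linear] linear_scale[OF axis_part_linear] 1)
      (simp add: scaleR_2)
  have "lorentz e u (2 *\<^sub>R ?p - u) = inner ?p ?p + inner (u - ?p) (u - ?p)"
    unfolding lorentz_def 2 by (simp add: scaleR_2 algebra_simps inner_simps)
  then have "inner ?p ?p + inner (u - ?p) (u - ?p) = 0"
    using assms(2) by simp
  then have "?p = 0" "u - ?p = 0"
    by (metis add_nonneg_eq_0_iff inner_ge_zero inner_eq_zero_iff)+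
  then show ?thesis by simp
qed

lemma lorentz_coord:
  assumes "e \<noteq> 0"
  shows "lorentz e v w = (inner v e / norm e) * (inner w e / norm e)
           - inner (v - axis_part e v) (w - axis_part e w)"
  using assms by (simp add: lorentz_def axis_part_def power2_norm_eq_inner[symmetric] power2_eq_square)

lemma lorentz_axis:
  assumes "e \<noteq> 0"
  shows "lorentz e v e = inner v e"
  using assms by (simp add: lorentz_def axis_part_def)

lemma hyp_space_coord:
  assumes "e \<noteq> 0" "x \<in> hyp_space e"
  shows "inner x e / norm e > 0" "(inner x e / norm e)\<^sup>2 = 1 + (norm (x - axis_part e x))\<^sup>2"
proof -
  have x: "lorentz e x x = 1" "lorentz e x e > 0"
    using assms(2) by (simp_all add: hyp_space_def)
  show "inner x e / norm e > 0"
    using x(2) assms(1) by (simp add: lorentz_axis)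
  show "(inner x e / norm e)\<^sup>2 = 1 + (norm (x - axis_part e x))\<^sup>2"
    using x(1) unfolding lorentz_coord[OF assms(1)] power2_norm_eq_inner
    by (simp only: power2_eq_square)
qed

lemma lorentz_orthogonal_neg:
  assumes e: "e \<noteq> 0" and y: "y \<in> hyp_space e" and u: "lorentz e u y = 0" "u \<noteq> 0"
  shows "lorentz e u u < 0"
proof -
  define u0 y0 where "u0 = inner u e / norm e" and "y0 = inner y e / norm e"
  define u1 y1 where "u1 = u - axis_part e u" and "y1 = y - axis_part e y"
  have y0: "y0 > 0" "y0\<^sup>2 = 1 + (norm y1)\<^sup>2"
    unfolding y0_def y1_def by (rule hyp_space_coord[OF e y])+
  have lt: "norm y1 < y0"
  proof (rule power2_less_imp_less)
    show "(norm y1)\<^sup>2 < y0\<^sup>2" unfolding y0(2) by simp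
    show "0 \<le> y0" using y0(1) by simp
  qed
  have eq: "u0 * y0 = inner u1 y1"
    using u(1) unfolding lorentz_coord[OF e] u0_def y0_def u1_def y1_def by linarith
  have le: "\<bar>u0\<bar> * y0 \<le> norm u1 * norm y1"
  proof -
    have "\<bar>u0\<bar> * y0 = \<bar>u0 * y0\<bar>"
      using y0(1) by (simp add: abs_mult)
    then show ?thesis
      using Cauchy_Schwarz_ineq2[of u1 y1] unfolding eq by simp
  qed
  have nz: "norm u1 > 0"
  proof (rule ccontr)
    assume "\<not> norm u1 > 0"
    then have "u1 = 0" by (simp only: zero_less_norm_iff not_not)
    then have "u0 * y0 = 0" unfolding eq by simp
    then have "u0 = 0" using y0(1) by simp
    then have "inner u e = 0" using e by (simp add: u0_def)
    with \<open>u1 = 0\<close> have "u = 0" by (simp add: u1_def axis_part_def)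
    with u show False by simp
  qed
  have "\<bar>u0\<bar> * y0 < norm u1 * y0"
    using le mult_strict_left_mono[OF lt nz] by linarith
  then have "\<bar>u0\<bar> < norm u1"
    using y0(1) by (simp only: mult_less_cancel_right_pos)
  then have "u0\<^sup>2 < (norm u1)\<^sup>2"
    using power_strict_mono[of "\<bar>u0\<bar>" "norm u1" 2] by simp
  moreover have "lorentz e u u = u0\<^sup>2 - (norm u1)\<^sup>2"
    unfolding lorentz_coord[OF e] u0_def u1_def power2_norm_eq_inner by (simp only: power2_eq_square)
  ultimately show ?thesis by simp
qed

lemma lorentz_orthogonal_nonpos:
  assumes "e \<noteq> 0" "y \<in> hyp_space e" "lorentz e u y = 0"
  shows "lorentz e u u \<le> 0"
  using lorentz_orthogonal_neg[OF assms] by (cases "u = 0") auto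

lemma lorentz_orthogonal_CS:
  assumes e: "e \<noteq> 0" and y: "y \<in> hyp_space e"
    and u: "lorentz e u y = 0" and w: "lorentz e w y = 0"
  shows "(lorentz e u w)\<^sup>2 \<le> lorentz e u u * lorentz e w w"
proof (cases "w = 0")
  case True
  then show ?thesis by simp
next
  case False
  have neg: "lorentz e w w < 0"
    using lorentz_orthogonal_neg[OF e y w False] .
  define c where "c = lorentz e u w / lorentz e w w"
  have "lorentz e (u - c *\<^sub>R w) y = 0"
    by (simp add: lorentz_simps u w)
  then have "lorentz e (u - c *\<^sub>R w) (u - c *\<^sub>R w) \<le> 0"
    by (rule lorentz_orthogonal_nonpos[OF e y])
  then have "lorentz e u u - 2 * c * lorentz e u w + c * c * lorentz e w w \<le> 0"
    by (simp add: lorentz_simps lorentz_commute[of e w u] algebra_simps)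
  moreover have "c * lorentz e w w = lorentz e u w"
    using neg by (simp add: c_def)
  ultimately have "lorentz e u u \<le> c * lorentz e u w"
    by (simp add: algebra_simps)
  then have "lorentz e u u * lorentz e w w \<ge> (c * lorentz e u w) * lorentz e w w"
    using neg by (intro mult_right_mono_neg) auto
  moreover have "(c * lorentz e u w) * lorentz e w w = (c * lorentz e w w) * lorentz e u w"
    by simp
  ultimately show ?thesis
    using \<open>c * lorentz e w w = lorentz e u w\<close> by (simp only: power2_eq_square)
qed

lemma lorentz_ge_1:
  assumes e: "e \<noteq> 0" and x: "x \<in> hyp_space e" and y: "y \<in> hyp_space e"
  shows "lorentz e x y \<ge> 1"
proof -
  define x0 y0 where "x0 = inner x e / norm e" and "y0 = inner y e / norm e"
  define x1 y1 where "x1 = norm (x - axis_part e x)" and "y1 = norm (y - axis_part e y)"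
  have x0: "x0 > 0" "x0\<^sup>2 = 1 + x1\<^sup>2"
    unfolding x0_def x1_def by (rule hyp_space_coord[OF e x])+
  have y0: "y0 > 0" "y0\<^sup>2 = 1 + y1\<^sup>2"
    unfolding y0_def y1_def by (rule hyp_space_coord[OF e y])+
  have nn: "x1 \<ge> 0" "y1 \<ge> 0" by (simp_all add: x1_def y1_def)
  have "(x0 * y0)\<^sup>2 = (1 + x1 * y1)\<^sup>2 + (x1 - y1)\<^sup>2"
    unfolding power_mult_distrib x0(2) y0(2) by (simp add: power2_eq_square algebra_simps)
  then have "(1 + x1 * y1)\<^sup>2 \<le> (x0 * y0)\<^sup>2" by simp
  then have "1 + x1 * y1 \<le> x0 * y0"
    by (rule power2_le_imp_le) (use x0(1) y0(1) in simp)
  moreover have "inner (x - axis_part e x) (y - axis_part e y) \<le> x1 * y1"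
    unfolding x1_def y1_def by (rule norm_cauchy_schwarz)
  ultimately show ?thesis
    unfolding lorentz_coord[OF e] x0_def y0_def by linarith
qed

lemma hyp_space_eqI:
  assumes e: "e \<noteq> 0" and x: "x \<in> hyp_space e" and y: "y \<in> hyp_space e" and "lorentz e x y = 1"
  shows "x = y"
proof (rule ccontr)
  assume "x \<noteq> y"
  have "lorentz e (x - y) y = 0"
    using assms by (simp add: lorentz_simps hyp_space_def)
  then have "lorentz e (x - y) (x - y) < 0"
    using lorentz_orthogonal_neg[OF e y] \<open>x \<noteq> y\<close> by simp
  then show False
    using assms by (simp add: lorentz_simps hyp_space_def lorentz_commute[of e y x])
qed

lemma cosh_hyp_dist:
  assumes "e \<noteq> 0" "x \<in> hyp_space e" "y \<in> hyp_space e"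
  shows "cosh (hyp_dist e x y) = lorentz e x y"
  using assms lorentz_ge_1[OF assms] by (simp add: hyp_dist_def)

lemma hyp_dist_triangle:
  assumes e: "e \<noteq> 0" and x: "x \<in> hyp_space e" and y: "y \<in> hyp_space e" and z: "z \<in> hyp_space e"
  shows "hyp_dist e x z \<le> hyp_dist e x y + hyp_dist e y z"
proof -
  define a b c where "a = lorentz e x y" and "b = lorentz e y z" and "c = lorentz e x z"
  define u w where "u = x - a *\<^sub>R y" and "w = z - b *\<^sub>R y"
  have ge: "a \<ge> 1" "b \<ge> 1" "c \<ge> 1"
    using lorentz_ge_1[OF e] x y z by (auto simp: a_def b_def c_def)
  have one: "lorentz e x x = 1" "lorentz e y y = 1" "lorentz e z z = 1"
    using x y z by (auto simp: hyp_space_def)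
  have sym: "lorentz e y x = a" "lorentz e z y = b"
    by (simp_all add: a_def b_def lorentz_commute)
  note ab = a_def[symmetric] b_def[symmetric] c_def[symmetric]
  have o: "lorentz e u y = 0" "lorentz e w y = 0"
    by (simp_all add: u_def w_def lorentz_simps one sym ab)
  have uu: "lorentz e u u = 1 - a\<^sup>2" and ww: "lorentz e w w = 1 - b\<^sup>2"
    by (simp_all add: u_def w_def lorentz_simps one sym ab power2_eq_square)
  have uw: "lorentz e u w = c - a * b"
    by (simp add: u_def w_def lorentz_simps one sym ab)
  have "(c - a * b)\<^sup>2 \<le> (a\<^sup>2 - 1) * (b\<^sup>2 - 1)"
    using lorentz_orthogonal_CS[OF e y o] uu ww uw by (simp add: algebra_simps)
  then have "\<bar>c - a * b\<bar> \<le> sqrt (a\<^sup>2 - 1) * sqrt (b\<^sup>2 - 1)"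
    by (metis real_sqrt_abs real_sqrt_le_mono real_sqrt_mult)
  then have "c \<le> a * b + sqrt (a\<^sup>2 - 1) * sqrt (b\<^sup>2 - 1)" by simp
  also have "\<dots> = cosh (arcosh a + arcosh b)"
    using ge by (simp add: cosh_add sinh_arcosh_real)
  finally have le: "cosh (arcosh c) \<le> cosh (arcosh a + arcosh b)"
    using ge by simp
  have "arcosh c \<le> arcosh a + arcosh b"
    using le by (subst (asm) cosh_real_nonneg_le_iff) (use ge in auto)
  then show ?thesis
    using x y z by (simp add: hyp_dist_def ab)
qed

lemma hyp_Metric_space:
  assumes e: "e \<noteq> 0"
  shows "Metric_space (hyp_space e) (hyp_dist e)"
proof
  show "0 \<le> hyp_dist e x y" for x y
    using lorentz_ge_1[OF e] by (simp add: hyp_dist_def)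
  show "hyp_dist e x y = hyp_dist e y x" for x y
    by (simp add: hyp_dist_def lorentz_commute)
  show "hyp_dist e x y = 0 \<longleftrightarrow> x = y" if "x \<in> hyp_space e" "y \<in> hyp_space e" for x y
  proof -
    have "lorentz e x y = 1 \<longleftrightarrow> x = y"
      using hyp_space_eqI[OF e that] that by (auto simp: hyp_space_def)
    then show ?thesis
      using lorentz_ge_1[OF e that] that by (simp add: hyp_dist_def)
  qed
  show "hyp_dist e x z \<le> hyp_dist e x y + hyp_dist e y z"
    if "x \<in> hyp_space e" "y \<in> hyp_space e" "z \<in> hyp_space e" for x y z
    using hyp_dist_triangle[OF e that] .
qed

lemma Isom_apply:
  assumes "f \<in> carrier (Isom e)"
  shows "f ` hyp_space e = hyp_space e"
    and "x \<in> hyp_space e \<Longrightarrow> f x \<in> hyp_space e"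
    and "e \<noteq> 0 \<Longrightarrow> x \<in> hyp_space e \<Longrightarrow> y \<in> hyp_space e \<Longrightarrow> lorentz e (f x) (f y) = lorentz e x y"
proof -
  show im: "f ` hyp_space e = hyp_space e"
    using assms by (auto simp: Isom_def Bij_def bij_betw_def)
  then show *: "f x \<in> hyp_space e" if "x \<in> hyp_space e" for x
    using that by blast
  show "lorentz e (f x) (f y) = lorentz e x y"
    if "e \<noteq> 0" "x \<in> hyp_space e" "y \<in> hyp_space e"
  proof -
    have "hyp_dist e (f x) (f y) = hyp_dist e x y"
      using assms that by (simp add: Isom_def)
    then show ?thesis
      using cosh_hyp_dist[OF that(1) *[OF that(2)] *[OF that(3)]] cosh_hyp_dist[OF that] by simp
  qed
qed

lemma Isom_group: "group (Isom e)"
proof -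
  interpret B: group "BijGroup (hyp_space e)" by (rule group_BijGroup)
  let ?H = "hyp_space e"
  let ?I = "{f \<in> Bij ?H. \<forall>x\<in>?H. \<forall>y\<in>?H. hyp_dist e (f x) (f y) = hyp_dist e x y}"
  have "subgroup ?I (BijGroup ?H)"
  proof (rule B.subgroupI)
    show "?I \<subseteq> carrier (BijGroup ?H)" by (auto simp: BijGroup_def)
    have "(\<lambda>x\<in>?H. x) \<in> ?I" by (simp add: id_Bij)
    then show "?I \<noteq> {}" by blast
    show "inv\<^bsub>BijGroup ?H\<^esub> f \<in> ?I" if "f \<in> ?I" for f
    proof -
      have f: "f \<in> Bij ?H" using that by simp
      then have im: "f ` ?H = ?H" by (simp add: Bij_def bij_betw_def)
      have iso: "hyp_dist e (f x) (f y) = hyp_dist e x y" if "x \<in> ?H" "y \<in> ?H" for x y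
        using \<open>f \<in> ?I\<close> that by simp
      have m: "inv_into ?H f x \<in> ?H" "f (inv_into ?H f x) = x" if "x \<in> ?H" for x
        using im that by (simp_all only: inv_into_into f_inv_into_f)
      have "hyp_dist e (inv_into ?H f x) (inv_into ?H f y) = hyp_dist e x y"
        if "x \<in> ?H" "y \<in> ?H" for x y
        using iso[OF m(1)[OF that(1)] m(1)[OF that(2)]] m(2)[OF that(1)] m(2)[OF that(2)]
        by (simp only:)
      then show ?thesis
        using f by (simp add: inv_BijGroup restrict_inv_into_Bij)
    qed
    show "f \<otimes>\<^bsub>BijGroup ?H\<^esub> g \<in> ?I" if "f \<in> ?I" "g \<in> ?I" for f g
    proof -
      have fg: "f \<in> Bij ?H" "g \<in> Bij ?H" using that by simp_all
      have "g x \<in> ?H" if "x \<in> ?H" for x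
        using Bij_imp_funcset[OF fg(2)] that by (rule funcset_mem)
      then show ?thesis
        using that by (simp add: BijGroup_def fg compose_Bij compose_def[of ?H f g])
          (use compose_Bij[OF fg] in \<open>simp add: compose_def\<close>)
    qed
  qed
  then show ?thesis
    unfolding Isom_def by (rule B.subgroup_imp_group)
qed

lemma span_hyp_space:
  assumes e: "e \<noteq> 0"
  shows "span (hyp_space e) = UNIV"
proof -
  have ne: "norm e > 0" "inner e e \<noteq> 0" using e by auto
  have point: "(sqrt (1 + inner v v) / norm e) *\<^sub>R e + v \<in> hyp_space e" if v: "inner v e = 0" for v
  proof -
    let ?x = "(sqrt (1 + inner v v) / norm e) *\<^sub>R e + v"
    have i: "inner ?x e / norm e = sqrt (1 + inner v v)"
      using v ne by (simp add: inner_simps norm_eq_sqrt_inner)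
    have a: "axis_part e ?x = (sqrt (1 + inner v v) / norm e) *\<^sub>R e"
      using v ne by (simp add: axis_part_def inner_simps)
    have "0 < inner ?x e / norm e"
      unfolding i by (simp add: add_pos_nonneg)
    then have "0 < inner ?x e"
      using ne(1) by (simp only: zero_less_divide_iff) linarith
    moreover have "lorentz e ?x ?x = 1"
      unfolding lorentz_coord[OF e] i a by (simp add: add_nonneg_nonneg)
    ultimately show ?thesis
      unfolding hyp_space_def mem_Collect_eq lorentz_axis[OF e] by blast
  qed
  have "(1 / norm e) *\<^sub>R e \<in> span (hyp_space e)"
    using point[of 0] by (simp add: span_base)
  then have eS: "e \<in> span (hyp_space e)"
    using span_scale[of "(1 / norm e) *\<^sub>R e" "hyp_space e" "norm e"] ne by simp
  have vS: "v \<in> span (hyp_space e)" if v: "inner v e = 0" for v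
    using span_diff[OF span_base[OF point[OF v]] span_scale[OF eS, of "sqrt (1 + inner v v) / norm e"]]
    by simp
  have "v \<in> span (hyp_space e)" for v
  proof -
    have "v - axis_part e v \<in> span (hyp_space e)"
      using axis_part_decomp[OF e, of v] by (intro vS) (simp add: inner_commute)
    moreover have "axis_part e v \<in> span (hyp_space e)"
      unfolding axis_part_def by (rule span_scale[OF eS])
    ultimately show ?thesis
      using span_add by fastforce
  qed
  then show ?thesis by auto
qed

lemma lorentz_linear_left: "linear (\<lambda>v. lorentz e v w)"
  by (rule linearI) (simp_all add: lorentz_simps)

lemma linear_eq_on_hyp_space:
  assumes "e \<noteq> 0" "linear f" "linear g" "\<And>x. x \<in> hyp_space e \<Longrightarrow> f x = g x"
  shows "f v = g v"
  using linear_eq_on[OF assms(2,3), of v "hyp_space e"] assms(4) span_hyp_space[OF assms(1)] by blast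

lemma lorentz_nondegenerate_hyp_space:
  assumes e: "e \<noteq> 0" and z: "\<And>y. y \<in> hyp_space e \<Longrightarrow> lorentz e y u = 0"
  shows "u = 0"
proof (rule lorentz_nondegenerate[OF e])
  fix w
  have "linear (\<lambda>v::'a. 0::real)" by (rule linearI) simp_all
  then have "lorentz e w u = 0"
    using linear_eq_on_hyp_space[OF e lorentz_linear_left[of e u], of "\<lambda>_. 0" w] z by blast
  then show "lorentz e u w = 0" by (simp only: lorentz_commute[of e u w])
qed

lemma lin_ext_ex1:
  assumes e: "e \<noteq> 0" and f: "f \<in> carrier (Isom e)"
  shows "\<exists>!A. linear A \<and> (\<forall>v w. lorentz e (A v) (A w) = lorentz e v w) \<and>
              (\<forall>x\<in>hyp_space e. A x = f x)"
proof (rule ex_ex1I)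
  let ?H = "hyp_space e"
  obtain S where S: "S \<subseteq> ?H" "independent S" "?H \<subseteq> span S"
    by (rule maximal_independent_subset)
  have spS: "span S = UNIV"
    using S(3) span_hyp_space[OF e] by (metis span_minimal subspace_span top.extremum_uniqueI)
  obtain A where A: "linear A" "\<And>s. s \<in> S \<Longrightarrow> A s = f s"
    using linear_independent_extend[OF S(2)] by blast
  have lin: "linear (\<lambda>v. lorentz e (A v) w)" for w
    using linear_compose[OF A(1) lorentz_linear_left[of e w]] by (simp only: o_def)
  have half: "lorentz e (A v) (f z) = lorentz e v z" if z: "z \<in> ?H" for v z
  proof (rule linear_eq_on[OF lin lorentz_linear_left])
    show "v \<in> span S" unfolding spS by (rule UNIV_I)
    show "lorentz e (A s) (f z) = lorentz e s z" if s: "s \<in> S" for s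
      unfolding A(2)[OF s] using Isom_apply(3)[OF f e _ z] S(1) s by blast
  qed
  have Af: "A x = f x" if x: "x \<in> ?H" for x
  proof -
    have "lorentz e y (A x - f x) = 0" if y: "y \<in> ?H" for y
    proof -
      obtain z where z: "z \<in> ?H" "y = f z"
        using Isom_apply(1)[OF f] y by blast
      have "lorentz e (f z) (A x) = lorentz e x z"
        unfolding lorentz_commute[of e "f z"] by (rule half[OF z(1)])
      moreover have "lorentz e (f z) (f x) = lorentz e x z"
        unfolding lorentz_commute[of e "f z"] by (rule Isom_apply(3)[OF f e x z(1)])
      ultimately show ?thesis
        unfolding z(2) lorentz_diff_right by simp
    qed
    then have "A x - f x = 0"
      by (rule lorentz_nondegenerate_hyp_space[OF e])
    then show ?thesis by simp
  qed
  have "lorentz e (A v) (A w) = lorentz e v w" for v w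
  proof -
    have "lorentz e (A w) (A v) = lorentz e w v"
    proof (rule linear_eq_on_hyp_space[OF e lin lorentz_linear_left])
      fix x assume x: "x \<in> ?H"
      show "lorentz e (A x) (A v) = lorentz e x v"
        unfolding Af[OF x] lorentz_commute[of e "f x"] lorentz_commute[of e x] by (rule half[OF x])
    qed
    then show ?thesis by (simp only: lorentz_commute[of e v w] lorentz_commute[of e "A v" "A w"])
  qed
  with A(1) Af show "\<exists>A. linear A \<and> (\<forall>v w. lorentz e (A v) (A w) = lorentz e v w) \<and>
      (\<forall>x\<in>?H. A x = f x)" by blast
next
  fix A B :: "'a \<Rightarrow> 'a"
  assume A: "linear A \<and> (\<forall>v w. lorentz e (A v) (A w) = lorentz e v w) \<and> (\<forall>x\<in>hyp_space e. A x = f x)"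
    and B: "linear B \<and> (\<forall>v w. lorentz e (B v) (B w) = lorentz e v w) \<and> (\<forall>x\<in>hyp_space e. B x = f x)"
  have "A v = B v" for v
    by (rule linear_eq_on_hyp_space[OF e]) (use A B in auto)
  then show "A = B" by blast
qed

end

theory Submission
  imports Defs
begin

text \<open>
  The isometries are replaced by the linear maps that preserve the Lorentz form. Stable lengths and
  the Cartan decomposition give \<open>\<ell>\<^sub>\<rho> = t \<ell>\<close> at once. If \<open>t\<close> were \<open>0\<close>, then no element would be
  hyperbolic, and a group without hyperbolic elements fixes a point or an isotropic ray. For \<open>t > 0\<close>
  the orbit of a one-parameter group of hyperbolic elements converges to an isotropic vector, and two
  orbit points at bounded distance have the same limit direction. This produces an equivariant map
  \<open>F\<close> from the isotropic cone of \<open>\<real>\<^sup>n\<^sup>+\<^sup>1\<close> to that of the Hilbert space with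
  \<open>F (c u) = c\<^sup>t F u\<close>; as the group is transitive on pairs of isotropic vectors with a given
  product, \<open>B (F u) (F v) = \<kappa> B(u, v)\<^sup>t\<close>.

  Everything follows from this kernel. On a horosphere it makes \<open>\<bar>x - y\<bar>\<^sup>t\<close> a Hilbertian metric on the
  line, so \<open>t \<le> 1\<close> by the triangle inequality, and for \<open>t < 1\<close> the span is infinite-dimensional since
  points that tend to \<open>0\<close> geometrically become almost orthogonal; for \<open>t = 1\<close> the map \<open>F\<close> is linear.
  The kernel determines an irreducible representation up to conjugacy, because \<open>F\<close> spans. Conversely,
  \<open>1 - (1 - s)\<^sup>t\<close> has non-negative Taylor coefficients, hence the kernel is realised in a Hilbert space.
\<close>


section \<open>Lorentz geometry of the hyperboloid\<close>

text \<open>Comparison geometry is replaced by two functions on the linear group: the displacement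
  \<open>\<phi> A\<close>, the hyperbolic cosine of the distance from \<open>A e0\<close> to
  \<open>e0\<close>, and the direction \<open>W A\<close>, the point \<open>A e0\<close> rescaled to
  height one. Norm distances between directions act as a visual metric, so convergence at infinity
  becomes convergence of Cauchy sequences. The obstacle is that the infinite-dimensional hyperbolic
  space is not locally compact: no limit can be extracted from an unbounded sequence, and each one
  has to come from an explicit estimate. Continuity of a given action enters as boundedness on
  bounded sets. The character by which the stabiliser of a boundary point acts on the limit vector
  is pinned down by the bound of \<open>\<bar>ln c\<bar>\<close> by the translation length; an
  element that fixes an isotropic vector has translation length zero, which makes the boundary map
  well defined. For existence, the cone with kernel \<open>B u v powr t\<close> is written in
  coordinates, but it may span only a proper closed subspace; separability and infinite dimension
  serve to rotate that subspace onto the whole space.\<close>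

locale lorentz_space =
  fixes e :: "'a::real_inner"
  assumes e_nz: "e \<noteq> 0"
begin

abbreviation B where "B \<equiv> lorentz e"
abbreviation H where "H \<equiv> hyp_space e"
definition e0 where "e0 = sgn e"

lemma norm_e0 [simp]: "norm e0 = 1" and inner_e0 [simp]: "inner e0 e0 = 1"
proof -
  show "norm e0 = 1" using e_nz by (simp add: e0_def norm_sgn)
  then show "inner e0 e0 = 1" by (simp add: norm_eq_1)
qed

lemma inner_e: "inner v e = norm e * inner v e0"
  using e_nz by (simp add: e0_def sgn_div_norm)

lemma axis_part_e0: "axis_part e v = inner v e0 *\<^sub>R e0"
  using e_nz by (simp add: axis_part_def e0_def sgn_div_norm power2_norm_eq_inner[symmetric]
      power2_eq_square divide_inverse)

lemma B_inner: "B v w = 2 * inner v e0 * inner w e0 - inner v w"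
  unfolding lorentz_def axis_part_e0 by (simp add: inner_simps inner_commute)

lemma B_e0: "B v e0 = inner v e0" and B_e0': "B e0 v = inner v e0"
  by (simp_all add: B_inner inner_commute)

lemma B_e0_e0 [simp]: "B e0 e0 = 1"
  by (simp add: B_e0)

lemma B_e_pos: "B v e > 0 \<longleftrightarrow> B v e0 > 0"
  unfolding B_e0 lorentz_axis[OF e_nz] inner_e using e_nz by (simp add: zero_less_mult_iff)

lemma H_iff: "x \<in> H \<longleftrightarrow> B x x = 1 \<and> B x e0 > 0"
  by (simp add: hyp_space_def B_e_pos)

lemma e0_H [simp]: "e0 \<in> H"
  by (simp add: H_iff)

lemma B_HH: "x \<in> H \<Longrightarrow> B x x = 1"
  by (simp add: H_iff)

text \<open>Together with \<open>e0\<close> the form recovers the inner product, so a linear map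
  that preserves \<open>B\<close> and fixes \<open>e0\<close> preserves the inner product as well.
  Gram matrices of the two forms are compared in this way.\<close>

lemma inner_B: "inner v w = 2 * B v e0 * B w e0 - B v w"
  by (simp add: B_inner B_e0 algebra_simps)

lemma norm_sq: "(norm v)\<^sup>2 = 2 * (B v e0)\<^sup>2 - B v v"
  by (subst power2_norm_eq_inner, subst inner_B) (simp only: power2_eq_square mult.assoc)

lemma norm_sq0: "B v e0 = 0 \<Longrightarrow> (norm v)\<^sup>2 = - B v v"
  by (simp add: norm_sq)

lemma bounded_bilinear_B: "bounded_bilinear B"
proof
  show "\<exists>K. \<forall>v w. norm (B v w) \<le> norm v * norm w * K"
  proof (intro exI allI)
    fix v w
    have 1: "\<bar>inner v e0\<bar> \<le> norm v" "\<bar>inner w e0\<bar> \<le> norm w"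
      using Cauchy_Schwarz_ineq2[of v e0] Cauchy_Schwarz_ineq2[of w e0] by simp_all
    have "\<bar>B v w\<bar> \<le> 2 * (\<bar>inner v e0\<bar> * \<bar>inner w e0\<bar>) + \<bar>inner v w\<bar>"
      unfolding B_inner using abs_triangle_ineq4[of "2 * inner v e0 * inner w e0" "inner v w"]
      by (simp add: abs_mult)
    also have "\<dots> \<le> 2 * (norm v * norm w) + norm v * norm w"
      by (intro add_mono mult_left_mono mult_mono 1 Cauchy_Schwarz_ineq2) auto
    finally show "norm (B v w) \<le> norm v * norm w * 3" by simp
  qed
qed (simp_all add: lorentz_simps)

lemmas tendsto_B [tendsto_intros] = bounded_bilinear.tendsto[OF bounded_bilinear_B]
lemmas continuous_on_B [continuous_intros] = bounded_bilinear.continuous_on[OF bounded_bilinear_B]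

lemma B_sum_left: "B (sum f A) w = (\<Sum>i\<in>A. B (f i) w)"
  using bounded_bilinear.sum_left[OF bounded_bilinear_B] .

lemma B_minus [simp]: "B (- v) w = - B v w" "B w (- v) = - B w v"
  using lorentz_diff_left[of e 0 v w] lorentz_diff_right[of e w 0 v] by simp_all

lemma B_eqI: assumes "\<And>w. B u w = B v w" shows "u = v"
  using lorentz_nondegenerate[OF e_nz, of "u - v"] assms by (simp add: lorentz_simps)

lemma abs_inner_le_B: "(B v e0)\<^sup>2 - B v v \<ge> 0"
proof -
  have "(B v e0)\<^sup>2 \<le> (norm v)\<^sup>2"
    using Cauchy_Schwarz_ineq2[of v e0] by (simp add: B_e0 abs_le_square_iff[symmetric])
  then show ?thesis by (simp add: norm_sq)
qed

lemma H_e0_ge1: "x \<in> H \<Longrightarrow> B x e0 \<ge> 1"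
  using lorentz_ge_1[OF e_nz] by simp

lemma B_ge_1: "x \<in> H \<Longrightarrow> y \<in> H \<Longrightarrow> B x y \<ge> 1"
  using lorentz_ge_1[OF e_nz] by simp

text \<open>Cauchy-Schwarz on the negative definite complement of \<open>x\<close>, applied to the
  components of \<open>y\<close> and \<open>z\<close>. It is the hyperbolic law of cosines at
  \<open>x\<close>, with the cosine of the angle bounded by one in absolute value.\<close>

lemma H_gram:
  assumes "x \<in> H" "y \<in> H" "z \<in> H"
  shows "\<bar>B y z - B x y * B x z\<bar> \<le> sqrt ((B x y)\<^sup>2 - 1) * sqrt ((B x z)\<^sup>2 - 1)"
proof -
  let ?u = "y - B x y *\<^sub>R x" and ?w = "z - B x z *\<^sub>R x"
  have "B ?u x = 0" "B ?w x = 0"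
    using assms by (simp_all add: lorentz_simps B_HH lorentz_commute[of e y x] lorentz_commute[of e z x] lorentz_commute[of e z y])
  then have "(B ?u ?w)\<^sup>2 \<le> B ?u ?u * B ?w ?w"
    using lorentz_orthogonal_CS[OF e_nz assms(1)] by blast
  also have "B ?u ?w = B y z - B x y * B x z"
    using assms by (simp add: lorentz_simps B_HH lorentz_commute[of e y x] lorentz_commute[of e z x] lorentz_commute[of e z y])
  also have "B ?u ?u * B ?w ?w = ((B x y)\<^sup>2 - 1) * ((B x z)\<^sup>2 - 1)"
    using assms by (simp add: lorentz_simps B_HH lorentz_commute[of e y x] lorentz_commute[of e z x] lorentz_commute[of e z y] power2_eq_square algebra_simps)
  finally have "sqrt ((B y z - B x y * B x z)\<^sup>2) \<le> sqrt (((B x y)\<^sup>2 - 1) * ((B x z)\<^sup>2 - 1))"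
    by (rule real_sqrt_le_mono)
  then show ?thesis by (simp add: real_sqrt_mult)
qed

text \<open>The factor \<open>2 * (B v x)\<^sup>2 - B v v\<close> is the squared norm that arises
  when \<open>x\<close> takes the place of \<open>e0\<close>. These norms dominate each other with a
  constant depending only on the height \<open>B x e0\<close>; this is how displacements control
  operator norms.\<close>

lemma norm_equiv:
  assumes x: "x \<in> H"
  shows "(norm v)\<^sup>2 \<le> (4 * (B x e0)\<^sup>2 + 1) * (2 * (B v x)\<^sup>2 - B v v)"
proof -
  define a where "a = B v x"
  define v' where "v' = v - a *\<^sub>R x"
  define x0 where "x0 = B x e0"
  define y where "y = e0 - x0 *\<^sub>R x"
  define q where "q = - B v' v'"
  have x1: "x0 \<ge> 1" using H_e0_ge1[OF x] by (simp add: x0_def)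
  have o: "B v' x = 0" "B y x = 0"
    using x by (simp_all add: v'_def y_def a_def x0_def lorentz_simps B_HH B_e0 B_e0')
  have q: "q \<ge> 0" using lorentz_orthogonal_nonpos[OF e_nz x o(1)] by (simp add: q_def)
  have yy: "B y y = 1 - x0\<^sup>2"
    using x by (simp add: y_def x0_def lorentz_simps B_HH B_e0 B_e0' power2_eq_square)
  have "B v' y = B v' e0"
    using o(1) by (simp add: y_def lorentz_simps)
  then have "(B v' e0)\<^sup>2 \<le> q * (x0\<^sup>2 - 1)"
    using lorentz_orthogonal_CS[OF e_nz x o] yy by (simp add: q_def algebra_simps)
  also have "\<dots> \<le> q * x0\<^sup>2" using q by (simp add: mult_left_mono)
  finally have 1: "(B v' e0)\<^sup>2 \<le> q * x0\<^sup>2" .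
  have ve: "B v e0 = a * x0 + B v' e0"
    by (simp add: v'_def x0_def lorentz_simps)
  have vv: "B v v = a\<^sup>2 - q"
    using x by (simp add: q_def v'_def lorentz_simps B_HH a_def lorentz_commute[of e x v] power2_eq_square)
  have "(B v e0)\<^sup>2 \<le> 2 * ((a * x0)\<^sup>2 + (B v' e0)\<^sup>2)"
    unfolding ve using zero_le_power2[of "a * x0 - B v' e0"] by (simp add: power2_diff power2_sum)
  also have "\<dots> \<le> 2 * x0\<^sup>2 * (a\<^sup>2 + q)" using 1 by (simp add: power_mult_distrib algebra_simps)
  finally have 2: "2 * (B v e0)\<^sup>2 \<le> 4 * x0\<^sup>2 * (a\<^sup>2 + q)" by simp
  have "2 * (B v e0)\<^sup>2 - (a\<^sup>2 - q) \<le> 4 * x0\<^sup>2 * (a\<^sup>2 + q) + (a\<^sup>2 + q)"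
    using 2 q zero_le_power2[of a] by linarith
  then show ?thesis unfolding norm_sq vv a_def[symmetric] x0_def[symmetric]
    by (simp add: algebra_simps)
qed

text \<open>The forward isotropic cone. Its rays are the boundary points, but vectors are kept
  instead of rays, because their scale carries the exponent.\<close>

definition C where "C = {u. B u u = 0 \<and> B u e0 > 0}"

lemma C_nz: "u \<in> C \<Longrightarrow> u \<noteq> 0"
  by (auto simp: C_def)

text \<open>Scaled to equal height, the two vectors have a difference orthogonal to
  \<open>e0\<close>; its squared norm is a positive multiple of \<open>B u v\<close>.\<close>

lemma B_null_prod:
  assumes "u \<in> C" "v \<in> C"
  shows "B u v \<ge> 0" and "B u v = 0 \<Longrightarrow> v = (B v e0 / B u e0) *\<^sub>R u"
proof -
  let ?a = "B u e0" and ?b = "B v e0"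
  have ab: "?a > 0" "?b > 0" "B u u = 0" "B v v = 0" using assms by (auto simp: C_def)
  have ie: "inner e0 u = ?a" "inner e0 v = ?b" by (simp_all add: B_e0 inner_commute)
  let ?w = "?b *\<^sub>R u - ?a *\<^sub>R v"
  have w: "B ?w e0 = 0" by (simp add: lorentz_simps)
  have "(norm ?w)\<^sup>2 = 2 * ?a * ?b * B u v"
    unfolding norm_sq0[OF w] using ab(3,4) by (simp add: lorentz_simps lorentz_commute[of e v u])
  then have *: "2 * ?a * ?b * B u v \<ge> 0" "B u v = 0 \<Longrightarrow> ?w = 0"
    by (metis zero_le_power2, simp)
  have "0 < 2 * ?a * ?b" using ab(1,2) by simp
  then show "B u v \<ge> 0" using *(1) by (simp only: zero_le_mult_iff) linarith
  assume "B u v = 0"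
  then have "?a *\<^sub>R v = ?b *\<^sub>R u" using *(2) by simp
  then have "(1 / ?a) *\<^sub>R (?a *\<^sub>R v) = (1 / ?a) *\<^sub>R (?b *\<^sub>R u)" by (rule arg_cong)
  then show "v = (?b / ?a) *\<^sub>R u" using ab(1) by simp
qed

text \<open>Strict Cauchy-Schwarz: orthogonally to \<open>e0\<close>, the isotropic \<open>u\<close>
  has a component as long as its height, whereas that of \<open>x\<close> is strictly shorter than
  the height of \<open>x\<close>.\<close>

lemma B_null_H: assumes u: "u \<in> C" and x: "x \<in> H" shows "B u x > 0"
proof -
  have u0: "B u u = 0" "B u e0 > 0" using u by (auto simp: C_def)
  define y where "y = x - (B x e0) *\<^sub>R e0"
  have y: "B y e0 = 0" by (simp add: y_def lorentz_simps)
  define w where "w = u - (B u e0) *\<^sub>R e0"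
  have w: "B w e0 = 0" by (simp add: w_def lorentz_simps)
  have "(B w y)\<^sup>2 \<le> B w w * B y y" by (rule lorentz_orthogonal_CS[OF e_nz e0_H w y])
  also have "B w w = - (B u e0)\<^sup>2"
    by (simp add: w_def lorentz_simps u0 lorentz_commute[of e e0 u] power2_eq_square)
  also have "B y y = 1 - (B x e0)\<^sup>2"
    using x by (simp add: y_def lorentz_simps B_HH lorentz_commute[of e e0 x] power2_eq_square)
  also have "- (B u e0)\<^sup>2 * (1 - (B x e0)\<^sup>2) < (B u e0 * B x e0)\<^sup>2"
    using u0 by (simp add: algebra_simps power_mult_distrib)
  finally have "(B w y)\<^sup>2 < (B u e0 * B x e0)\<^sup>2" .
  then have "\<bar>B w y\<bar> < \<bar>B u e0 * B x e0\<bar>" by (metis real_sqrt_abs real_sqrt_less_iff)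
  moreover have "B u e0 * B x e0 > 0" using u0 H_e0_ge1[OF x] by auto
  moreover have "B u x = B u e0 * B x e0 + B w y"
    by (simp add: w_def y_def lorentz_simps lorentz_commute[of e e0 x])
  ultimately show ?thesis by linarith
qed

text \<open>Subtracting a multiple of \<open>u\<close> leaves \<open>B v v\<close> unchanged and
  moves \<open>v\<close> into the complement of \<open>e0\<close>, where the form is negative
  definite. The Euclidean geometry of horospheres comes from this.\<close>

lemma null_orth: assumes u: "u \<in> C" and v: "B v u = 0" shows "B v v \<le> 0"
proof -
  have u0: "B u u = 0" "B u e0 > 0" using u by (auto simp: C_def)
  define r where "r = B v e0 / B u e0"
  have "B (v - r *\<^sub>R u) e0 = 0" using u0 by (simp add: r_def lorentz_simps)
  then have "B (v - r *\<^sub>R u) (v - r *\<^sub>R u) \<le> 0"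
    by (rule lorentz_orthogonal_nonpos[OF e_nz e0_H])
  then show ?thesis using u0 v by (simp add: lorentz_simps lorentz_commute[of e u v])
qed

end

section \<open>The linear isometry group, reflections and transitivity\<close>

abbreviation fun_inv :: "('x \<Rightarrow> 'x) \<Rightarrow> 'x \<Rightarrow> 'x" where "fun_inv A \<equiv> inv_into UNIV A"

context lorentz_space begin

text \<open>Bijectivity is demanded because a linear map preserving \<open>B\<close> need not be
  onto in infinite dimension; the last clause excludes maps that exchange the two sheets.\<close>

definition LO where
  "LO = {A. linear A \<and> bij A \<and> (\<forall>v w. B (A v) (A w) = B v w) \<and> (\<forall>x\<in>H. A x \<in> H)}"

lemma LO_linear: "A \<in> LO \<Longrightarrow> linear A"
  and LO_bij: "A \<in> LO \<Longrightarrow> bij A"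
  and LO_B: "A \<in> LO \<Longrightarrow> B (A v) (A w) = B v w"
  and LO_H: "A \<in> LO \<Longrightarrow> x \<in> H \<Longrightarrow> A x \<in> H"
  by (auto simp: LO_def)

lemmas LO_add = linear_add[OF LO_linear]
lemmas LO_scale = linear_scale[OF LO_linear]
lemmas LO_diff = linear_diff[OF LO_linear]

lemma H_sheet:
  assumes "B y y = 1" "z \<in> H" "B y z > 0"
  shows "y \<in> H"
proof (rule ccontr)
  assume "y \<notin> H"
  then have "B y e0 \<le> 0" using assms by (auto simp: H_iff)
  moreover have "(B y e0)\<^sup>2 \<ge> 1" using abs_inner_le_B[of y] assms by simp
  ultimately have "- y \<in> H" using assms(1) by (cases "B y e0 = 0") (auto simp: H_iff)
  then show False using B_ge_1[of "- y" z] assms by simp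
qed

lemma LO_I:
  assumes A: "linear A" "bij A" "\<And>v w. B (A v) (A w) = B v w" and x: "x \<in> H" "A x \<in> H"
  shows "A \<in> LO"
  unfolding LO_def
proof (intro CollectI conjI ballI allI assms)
  fix y assume "y \<in> H"
  then have "B (A y) (A y) = 1" "B (A y) (A x) > 0"
    using B_ge_1[OF _ x(1), of y] by (auto simp: A(3) B_HH)
  then show "A y \<in> H" using H_sheet x(2) by blast
qed

lemma LO_id: "id \<in> LO"
  by (auto simp: LO_def linear_id)

lemma LO_comp: "A \<in> LO \<Longrightarrow> A' \<in> LO \<Longrightarrow> A \<circ> A' \<in> LO"
  by (auto simp: LO_def linear_compose bij_comp)

lemma LO_inv:
  assumes A: "A \<in> LO" shows "fun_inv A \<in> LO" "fun_inv A (A v) = v" "A (fun_inv A v) = v"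
    "fun_inv A \<circ> A = id" "A \<circ> fun_inv A = id"
proof -
  show 1: "fun_inv A (A v) = v" "A (fun_inv A v) = v" for v
    using LO_bij[OF A] by (simp_all add: bij_is_inj bij_is_surj surj_f_inv_f)
  then show "fun_inv A \<circ> A = id" "A \<circ> fun_inv A = id" by auto
  have l: "linear (fun_inv A)"
  proof (rule linearI)
    show "fun_inv A (x + y) = fun_inv A x + fun_inv A y" for x y
      by (metis 1 LO_add[OF A])
    show "fun_inv A (c *\<^sub>R x) = c *\<^sub>R fun_inv A x" for x c
      by (metis 1 LO_scale[OF A])
  qed
  have p: "B (fun_inv A v) (fun_inv A w) = B v w" for v w
    using LO_B[OF A, of "fun_inv A v" "fun_inv A w"] by (simp add: 1)
  show "fun_inv A \<in> LO"
    unfolding LO_def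
  proof (intro CollectI conjI ballI allI l p)
    show "bij (fun_inv A)" using LO_bij[OF A] by (rule bij_imp_bij_inv)
    fix x assume x: "x \<in> H"
    have "B (fun_inv A x) e0 = B x (A e0)" using LO_B[OF A, of "fun_inv A x" e0] by (simp add: 1)
    also have "\<dots> \<ge> 1" using B_ge_1[OF x LO_H[OF A e0_H]] .
    finally have "B (fun_inv A x) e0 > 0" by simp
    then show "fun_inv A x \<in> H" using p[of x x] x by (simp add: H_iff)
  qed
qed

lemma LO_adj: "A \<in> LO \<Longrightarrow> B (A v) w = B v (fun_inv A w)"
  using LO_B[of A v "fun_inv A w"] by (metis LO_inv(3))

lemma LO_eqI: "A \<in> LO \<Longrightarrow> A' \<in> LO \<Longrightarrow> (\<And>x. x \<in> H \<Longrightarrow> A x = A' x) \<Longrightarrow> A = A'"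
  using linear_eq_on_hyp_space[OF e_nz LO_linear LO_linear] by blast

text \<open>Instance of \<open>norm_equiv\<close> at the point \<open>A e0\<close>, whose definite
  form pulls back along \<open>A\<close> to the original norm. The operator norm is thus bounded by
  the displacement of \<open>e0\<close> alone.\<close>

lemma LO_norm:
  assumes A: "A \<in> LO"
  shows "(norm (A v))\<^sup>2 \<le> (4 * (B (A e0) e0)\<^sup>2 + 1) * (norm v)\<^sup>2"
  using norm_equiv[OF LO_H[OF A e0_H], of "A v"] by (simp add: LO_B[OF A] norm_sq)

lemma LO_bounded: assumes A: "A \<in> LO" shows "bounded_linear A"
proof -
  interpret A: linear A by (rule LO_linear[OF A])
  let ?K = "sqrt (4 * (B (A e0) e0)\<^sup>2 + 1)"
  have "norm (A v) \<le> norm v * ?K" for v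
  proof (rule power2_le_imp_le)
    show "(norm (A v))\<^sup>2 \<le> (norm v * ?K)\<^sup>2"
      using LO_norm[OF A, of v] by (simp add: power_mult_distrib mult.commute add_nonneg_pos)
  qed simp
  then show ?thesis by unfold_locales blast
qed

lemmas tendsto_LO = bounded_linear.tendsto[OF LO_bounded]

lemma LO_C: assumes A: "A \<in> LO" and u: "u \<in> C" shows "A u \<in> C"
  using u B_null_H[OF u LO_H[OF LO_inv(1)[OF A] e0_H]]
  by (simp add: C_def LO_B[OF A] LO_adj[OF A, of u e0])

lemma C_scale: "u \<in> C \<Longrightarrow> c > 0 \<Longrightarrow> c *\<^sub>R u \<in> C"
  by (simp add: C_def lorentz_simps)

definition refl where "refl w v = v - (2 * B v w / B w w) *\<^sub>R w"

lemma refl_LO: assumes w: "B w w < 0" shows "refl w \<in> LO"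
proof (rule LO_I[where x = e0])
  show "linear (refl w)"
    by (rule linearI) (simp_all add: refl_def lorentz_simps algebra_simps add_divide_distrib)
  have "refl w (refl w v) = v" for v
    using w by (simp add: refl_def lorentz_simps)
  then show "bij (refl w)" by (intro involuntory_imp_bij)
  show "B (refl w v) (refl w v') = B v v'" for v v'
    using w by (simp add: refl_def lorentz_simps lorentz_commute[of e w v'])
  then have "B (refl w e0) (refl w e0) = 1" by simp
  moreover have "B (refl w e0) e0 > 0"
  proof -
    have "B (refl w e0) e0 = 1 - 2 * (B e0 w)\<^sup>2 / B w w"
      by (simp add: refl_def lorentz_simps lorentz_commute[of e w e0] power2_eq_square)
    also have "\<dots> \<ge> 1" using w by (simp add: divide_nonneg_neg divide_le_0_iff)
    finally show ?thesis by simp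
  qed
  ultimately show "refl w e0 \<in> H" by (simp add: H_iff)
qed simp

text \<open>The reflection in \<open>u - v\<close> exchanges the two vectors and fixes whatever has
  equal products with both. The fixed vectors allow a second reflection to correct a first one
  without losing what was achieved.\<close>

lemma refl_ex:
  assumes "B u u = B v v" "u = v \<or> B (u - v) (u - v) < 0"
  shows "\<exists>A\<in>LO. A u = v \<and> A v = u \<and> (\<forall>z. B z u = B z v \<longrightarrow> A z = z)"
proof (cases "u = v")
  case True then show ?thesis using LO_id by (intro bexI[of _ id]) auto
next
  case False
  let ?w = "u - v"
  have w: "B ?w ?w < 0" using assms(2) False by blast
  have ww: "B ?w ?w = 2 * B u ?w" "B ?w ?w = - 2 * B v ?w"
    using assms(1) by (simp_all add: lorentz_simps lorentz_commute[of e v u])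
  show ?thesis
  proof (intro bexI[of _ "refl ?w"] conjI allI impI refl_LO w)
    have "2 * B u ?w / B ?w ?w = 1" unfolding ww(1)[symmetric] using w by simp
    then show "refl ?w u = v" by (simp add: refl_def)
    have "2 * B v ?w / B ?w ?w = -1" using ww(2) w by (simp add: field_simps)
    then show "refl ?w v = u" by (simp add: refl_def)
    show "refl ?w z = z" if "B z u = B z v" for z
      using that by (simp add: refl_def lorentz_simps)
  qed
qed

lemma refl_ex_H:
  assumes "x \<in> H" "y \<in> H"
  shows "\<exists>A\<in>LO. A x = y \<and> A y = x \<and> (\<forall>z. B z x = B z y \<longrightarrow> A z = z)"
proof (rule refl_ex)
  have "B x y \<ge> 1" "B x y = 1 \<Longrightarrow> x = y" using assms B_ge_1 hyp_space_eqI[OF e_nz] by auto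
  then show "x = y \<or> B (x - y) (x - y) < 0"
    using assms by (auto simp: lorentz_simps B_HH lorentz_commute[of e y x])
qed (use assms in \<open>simp add: B_HH\<close>)

text \<open>For isotropic vectors \<open>B (u - v) (u - v) = - 2 * B u v\<close>, which is negative
  unless they are proportional; equal products with \<open>z\<close> then make them equal.\<close>

lemma refl_ex_C:
  assumes uv: "u \<in> C" "v \<in> C" and z: "z \<in> H" "B u z = B v z"
  shows "\<exists>A\<in>LO. A u = v \<and> A v = u \<and> (\<forall>z. B z u = B z v \<longrightarrow> A z = z)"
proof (rule refl_ex)
  show "u = v \<or> B (u - v) (u - v) < 0"
  proof (cases "B u v = 0")
    case True
    define r where "r = B v e0 / B u e0"
    have v: "v = r *\<^sub>R u" using B_null_prod(2)[OF uv True] by (simp add: r_def)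
    then have "B u z = r * B u z" using z(2) by (simp add: lorentz_simps)
    then have "r = 1" using B_null_H[OF uv(1) z(1)] by simp
    then show ?thesis using v by simp
  next
    case False
    then have "B u v > 0" using B_null_prod(1)[OF uv] by simp
    then show ?thesis using uv by (simp add: lorentz_simps C_def lorentz_commute[of e v u])
  qed
qed (use uv in \<open>simp add: C_def\<close>)

lemma mid_H:
  assumes "u \<in> C" "w \<in> C" "B u w > 0"
  shows "(1 / sqrt (2 * B u w)) *\<^sub>R (u + w) \<in> H"
proof -
  let ?x = "(1 / sqrt (2 * B u w)) *\<^sub>R (u + w)"
  have "B ?x ?x = 1"
    using assms by (simp add: C_def lorentz_simps lorentz_commute[of e w u])
  moreover have "B ?x e0 > 0"
    using assms by (simp add: C_def lorentz_simps add_pos_pos)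
  ultimately show ?thesis by (simp add: H_iff)
qed

text \<open>One reflection moves the midpoint of the geodesic between \<open>u\<close> and
  \<open>w\<close> to that between \<open>u'\<close> and \<open>w'\<close>; a second one fixes this
  midpoint and carries the image of \<open>u\<close> to \<open>u'\<close>. The sums of the two pairs
  now agree, hence so do the second vectors.\<close>

lemma pair_trans:
  assumes C: "u \<in> C" "w \<in> C" "u' \<in> C" "w' \<in> C" and b: "B u w = B u' w'" "B u w > 0"
  shows "\<exists>A\<in>LO. A u = u' \<and> A w = w'"
proof -
  let ?k = "1 / sqrt (2 * B u w)"
  let ?x = "?k *\<^sub>R (u + w)" and ?x' = "?k *\<^sub>R (u' + w')"
  have x: "?x \<in> H" "?x' \<in> H" using mid_H[OF C(1,2)] mid_H[OF C(3,4)] b by auto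
  obtain A1 where A1: "A1 \<in> LO" "A1 ?x = ?x'" using refl_ex_H[OF x] by blast
  have eq1: "B (A1 u) ?x' = B u' ?x'"
  proof -
    have "B (A1 u) ?x' = B (A1 u) (A1 ?x)" by (simp only: A1(2))
    also have "\<dots> = B u ?x" by (rule LO_B[OF A1(1)])
    also have "\<dots> = B u' ?x'" using C b by (simp add: lorentz_simps C_def)
    finally show ?thesis .
  qed
  then obtain A2 where A2: "A2 \<in> LO" "A2 (A1 u) = u'" "\<And>z. B z (A1 u) = B z u' \<Longrightarrow> A2 z = z"
    using refl_ex_C[OF LO_C[OF A1(1) C(1)] C(3) x(2)] by blast
  have "B ?x' (A1 u) = B ?x' u'"
    using eq1 by (simp only: lorentz_commute[of e ?x'])
  then have A2x: "A2 ?x' = ?x'" by (rule A2(3))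
  let ?A = "A2 \<circ> A1"
  have A: "?A \<in> LO" by (rule LO_comp[OF A2(1) A1(1)])
  have "?A ?x = ?x'" by (simp only: o_apply A1(2) A2x)
  then have "?k *\<^sub>R (?A u + ?A w) = ?k *\<^sub>R (u' + w')"
    by (simp only: LO_scale[OF A] LO_add[OF A])
  moreover have "?k \<noteq> 0" using b by simp
  ultimately have "?A u + ?A w = u' + w'" by (metis scaleR_left_imp_eq)
  moreover have u: "?A u = u'" by (simp add: A2(2))
  ultimately have "?A w = w'" by simp
  with A u show ?thesis by blast
qed

text \<open>Hyperbolic translation by \<open>s\<close> along the geodesic whose ends are the
  isotropic vectors \<open>u\<close> and \<open>w\<close>, normalised by
  \<open>B u w = 1\<close>.\<close>

definition boost where
  "boost u w s v = (exp s * B v w) *\<^sub>R u + (exp (- s) * B v u) *\<^sub>R w + (v - B v w *\<^sub>R u - B v u *\<^sub>R w)"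

context
  fixes u w assumes u: "u \<in> C" and w: "w \<in> C" and uw: "B u w = 1"
begin

private lemma facts: "B u u = 0" "B w w = 0" "B w u = 1"
  using u w uw by (auto simp: C_def lorentz_commute[of e w u])

lemma boost_u: "boost u w s u = exp s *\<^sub>R u" and boost_w: "boost u w s w = exp (- s) *\<^sub>R w"
  by (simp_all add: boost_def facts uw)

lemma boost_perp: "B v u = 0 \<Longrightarrow> B v w = 0 \<Longrightarrow> boost u w s v = v"
  by (simp add: boost_def)

lemma boost_linear: "linear (boost u w s)"
  by (rule linearI) (simp_all add: boost_def lorentz_simps algebra_simps)

lemma boost_comp: "boost u w s \<circ> boost u w r = boost u w (s + r)"
proof
  fix v
  let ?p = "v - B v w *\<^sub>R u - B v u *\<^sub>R w"
  have p: "B ?p u = 0" "B ?p w = 0" by (simp_all add: lorentz_simps facts uw)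
  interpret linear "boost u w s" by (rule boost_linear)
  have "boost u w s (boost u w r v) = (exp r * B v w) *\<^sub>R (exp s *\<^sub>R u) + (exp (- r) * B v u) *\<^sub>R (exp (- s) *\<^sub>R w) + ?p"
    unfolding boost_def[of u w r] by (simp only: add scale boost_u boost_w boost_perp[OF p])
  then show "(boost u w s \<circ> boost u w r) v = boost u w (s + r) v"
    by (simp add: boost_def[of u w "s + r"] exp_add exp_diff exp_minus divide_inverse mult_ac)
qed

lemma boost_0: "boost u w 0 = id"
  by (auto simp: boost_def)

lemma boost_B: "B (boost u w s v) (boost u w s v') = B v v'"
proof -
  let ?p = "v - B v w *\<^sub>R u - B v u *\<^sub>R w" and ?p' = "v' - B v' w *\<^sub>R u - B v' u *\<^sub>R w"
  have p: "B ?p u = 0" "B ?p w = 0" "B u ?p' = 0" "B w ?p' = 0"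
    by (simp_all add: lorentz_simps facts uw lorentz_commute[of e u v'] lorentz_commute[of e w v'])
  have ee: "exp s * exp (- s) = 1" for s :: real by (simp add: exp_minus)
  have gen: "B (a *\<^sub>R u + c *\<^sub>R w + ?p) (a' *\<^sub>R u + c' *\<^sub>R w + ?p') = a * c' + c * a' + B ?p ?p'" for a c a' c'
    by (simp only: lorentz_add_left lorentz_add_right lorentz_scale_left lorentz_scale_right p facts uw) simp
  have "B (boost u w s v) (boost u w s v') = (exp s * exp (- s)) * (B v w * B v' u + B v u * B v' w) + B ?p ?p'"
    unfolding boost_def gen by (simp add: algebra_simps)
  also have "\<dots> = B (B v w *\<^sub>R u + B v u *\<^sub>R w + ?p) (B v' w *\<^sub>R u + B v' u *\<^sub>R w + ?p')"
    unfolding gen ee by simp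
  also have "\<dots> = B v v'" by simp
  finally show ?thesis .
qed

definition mid where "mid = (1 / sqrt 2) *\<^sub>R (u + w)"

lemma mid_in_H: "mid \<in> H"
  using mid_H[OF u w] uw by (simp add: mid_def)

lemma boost_mid: "boost u w s mid = (exp s / sqrt 2) *\<^sub>R u + (exp (- s) / sqrt 2) *\<^sub>R w"
  using boost_linear[of s] by (simp add: mid_def linear_scale linear_add boost_u boost_w scaleR_right_distrib)

lemma boost_mid_B: "B (boost u w s mid) mid = cosh s"
  unfolding boost_mid unfolding mid_def
  by (simp add: lorentz_simps facts uw cosh_def exp_minus field_simps)

lemma boost_LO: "boost u w s \<in> LO"
proof (rule LO_I[OF boost_linear _ boost_B mid_in_H])
  show "bij (boost u w s)"
    using boost_comp[of s "- s"] boost_comp[of "- s" s] by (intro o_bij[of "boost u w (- s)"]) (simp_all add: boost_0)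
  show "boost u w s mid \<in> H"
    using mid_in_H by (intro H_sheet[OF _ mid_in_H]) (simp_all add: boost_B boost_mid_B B_HH)
qed

lemma boost_funpow: "boost u w (real k * s) = boost u w s ^^ k"
  by (induction k) (simp_all add: boost_0 boost_comp[symmetric] distrib_right add.commute)

end

end

section \<open>Translation lengths and groups without hyperbolic elements\<close>

context lorentz_space begin

abbreviation D where "D \<equiv> hyp_dist e"

lemma D_arcosh: "x \<in> H \<Longrightarrow> y \<in> H \<Longrightarrow> D x y = arcosh (B x y)"
  by (simp add: hyp_dist_def)

lemma cosh_D: "x \<in> H \<Longrightarrow> y \<in> H \<Longrightarrow> cosh (D x y) = B x y"
  by (rule cosh_hyp_dist[OF e_nz])

lemma D_nonneg [simp]: "D x y \<ge> 0" and D_commute: "D x y = D y x"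
proof -
  interpret Metric_space H D by (rule hyp_Metric_space[OF e_nz])
  show "D x y \<ge> 0" "D x y = D y x" by (rule nonneg, rule commute)
qed

lemma D_triangle: "x \<in> H \<Longrightarrow> y \<in> H \<Longrightarrow> z \<in> H \<Longrightarrow> D x z \<le> D x y + D y z"
  by (rule hyp_dist_triangle[OF e_nz])

lemma D_self [simp]: "D x x = 0"
  by (simp add: hyp_dist_def B_HH)

lemma D_LO: "A \<in> LO \<Longrightarrow> x \<in> H \<Longrightarrow> y \<in> H \<Longrightarrow> D (A x) (A y) = D x y"
  by (simp add: hyp_dist_def LO_H LO_B)

lemma D_le_iff: "x \<in> H \<Longrightarrow> y \<in> H \<Longrightarrow> r \<ge> 0 \<Longrightarrow> D x y \<le> r \<longleftrightarrow> B x y \<le> cosh r"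
  by (metis D_nonneg cosh_D cosh_real_nonneg_le_iff)

lemma B_le_exp_D: assumes "x \<in> H" "y \<in> H" shows "B x y \<le> exp (D x y)" "exp (D x y) \<le> 2 * B x y"
proof -
  have "cosh (D x y) \<le> exp (D x y)" "exp (D x y) \<le> 2 * cosh (D x y)"
    by (simp_all add: cosh_def)
  then show "B x y \<le> exp (D x y)" "exp (D x y) \<le> 2 * B x y"
    by (simp_all add: cosh_D assms)
qed

definition tlen where "tlen A = (INF x\<in>H. D (A x) x)"

lemma tlen_le: "x \<in> H \<Longrightarrow> tlen A \<le> D (A x) x"
  unfolding tlen_def by (rule cINF_lower) (auto intro!: bdd_belowI2[of _ 0])

lemma tlen_ge: "(\<And>x. x \<in> H \<Longrightarrow> r \<le> D (A x) x) \<Longrightarrow> r \<le> tlen A"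
  unfolding tlen_def using e0_H by (intro cINF_greatest) blast+

lemma tlen_nonneg [simp]: "tlen A \<ge> 0"
  by (rule tlen_ge) simp

lemma tlen_approx: assumes "r > tlen A" shows "\<exists>x\<in>H. D (A x) x < r"
  using tlen_ge[of r A] assms by (meson not_le)

lemma LO_funpow: "A \<in> LO \<Longrightarrow> A ^^ k \<in> LO"
  by (induction k) (auto simp: LO_id LO_comp)

lemma midpoint_H: assumes x: "x \<in> H" and y: "y \<in> H"
  shows "(1 / sqrt (2 + 2 * B x y)) *\<^sub>R (x + y) \<in> H" (is "?m \<in> H")
proof -
  define c where "c = B x y"
  have c: "c \<ge> 1" using B_ge_1[OF x y] by (simp add: c_def)
  have "B (r *\<^sub>R (x + y)) (r *\<^sub>R (x + y)) = r\<^sup>2 * (B x x + B y x + B x y + B y y)" for r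
    by (simp add: lorentz_simps power2_eq_square algebra_simps)
  then have "B ?m ?m = (1 / sqrt (2 + 2 * c))\<^sup>2 * (B x x + B y x + B x y + B y y)"
    by (simp only: c_def)
  also have "\<dots> = 1" using c x y
    by (simp add: B_HH lorentz_commute[of e y x] c_def[symmetric] power_divide)
  finally have "B ?m ?m = 1" .
  moreover have "B ?m e0 > 0"
    using c H_e0_ge1[OF x] H_e0_ge1[OF y] by (simp add: lorentz_simps c_def)
  ultimately show ?thesis by (simp add: H_iff)
qed

text \<open>The midpoint of \<open>x\<close> and \<open>A x\<close> is moved by at most half the
  distance from \<open>x\<close> to \<open>A (A x)\<close>. With \<open>c\<close> and
  \<open>k\<close> the hyperbolic cosines of the distance from \<open>x\<close> to
  \<open>A x\<close> and of that half distance, its displacement has cosine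
  \<open>(c + k\<^sup>2) / (1 + c)\<close>, which is at most \<open>k\<close> because
  \<open>1 \<le> k \<le> c\<close>.\<close>

lemma tlen_double: assumes A: "A \<in> LO" shows "2 * tlen A \<le> tlen (A \<circ> A)"
proof (rule tlen_ge)
  fix x assume x: "x \<in> H"
  define y where "y = A x"
  define c where "c = B x y"
  have y: "y \<in> H" "A y \<in> H" using x LO_H[OF A] by (auto simp: y_def)
  have c: "c \<ge> 1" using B_ge_1[OF x y(1)] by (simp add: c_def)
  define m where "m = (1 / sqrt (2 + 2 * c)) *\<^sub>R (x + y)"
  define \<delta> where "\<delta> = D (A y) x / 2"
  define k where "k = cosh \<delta>"
  have m: "m \<in> H" unfolding m_def c_def by (rule midpoint_H[OF x y(1)])
  have d: "\<delta> \<ge> 0" by (simp add: \<delta>_def)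
  have k1: "k \<ge> 1" by (simp add: k_def cosh_real_ge_1)
  have "D (A y) x \<le> D (A y) (A x) + D y x"
    using D_triangle[OF y(2) y(1) x] by (simp add: y_def)
  then have "\<delta> \<le> D x y" using D_LO[OF A y(1) x] by (simp add: \<delta>_def D_commute)
  then have kc: "k \<le> c"
    using cosh_real_nonneg_le_iff[OF d D_nonneg, of x y] cosh_D[OF x y(1)] by (simp add: k_def c_def)
  have "B (A y) x = cosh (2 * \<delta>)" using cosh_D[OF y(2) x] by (simp add: \<delta>_def)
  also have "\<dots> = 2 * k\<^sup>2 - 1"
    by (simp add: k_def cosh_double sinh_square_eq)
  finally have c2: "B (A y) x = 2 * k\<^sup>2 - 1" .
  have Ayy: "B (A y) y = c" using LO_B[OF A, of y x] by (simp add: y_def[symmetric] c_def lorentz_commute)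
  have "A m = (1 / sqrt (2 + 2 * c)) *\<^sub>R (y + A y)"
    by (simp only: m_def LO_scale[OF A] LO_add[OF A] y_def)
  then have "B (A m) m = (B y x + B y y + B (A y) x + B (A y) y) / (2 + 2 * c)"
    unfolding m_def using c by (simp add: lorentz_simps add_divide_distrib)
  also have "\<dots> = (2 * c + 2 * k\<^sup>2) / (2 + 2 * c)"
    using y(1) by (simp add: c2 Ayy B_HH lorentz_commute[of e y x] c_def)
  also have "\<dots> \<le> k"
  proof -
    have "(k - 1) * (k - c) \<le> 0" using k1 kc by (simp add: mult_nonneg_nonpos)
    then have "2 * c + 2 * k\<^sup>2 \<le> k * (2 + 2 * c)" by (simp add: algebra_simps power2_eq_square)
    then show ?thesis using c by (simp add: divide_le_eq)
  qed
  finally have "D (A m) m \<le> \<delta>"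
    using D_le_iff[OF LO_H[OF A m] m d] by (simp add: k_def)
  with tlen_le[OF m, of A] show "2 * tlen A \<le> D ((A \<circ> A) x) x"
    by (simp add: \<delta>_def y_def)
qed

lemma tlen_pow2: assumes A: "A \<in> LO" shows "2 ^ i * tlen A \<le> tlen (A ^^ (2 ^ i))"
proof (induction i)
  case (Suc i)
  have eq: "A ^^ (2 ^ Suc i) = (A ^^ (2 ^ i)) \<circ> (A ^^ (2 ^ i))"
    by (simp only: power_Suc mult_2 funpow_add)
  have "2 ^ Suc i * tlen A = 2 * (2 ^ i * tlen A)" by simp
  also have "\<dots> \<le> 2 * tlen (A ^^ (2 ^ i))" using Suc by simp
  also have "\<dots> \<le> tlen ((A ^^ (2 ^ i)) \<circ> (A ^^ (2 ^ i)))" by (rule tlen_double[OF LO_funpow[OF A]])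
  finally show ?case unfolding eq .
qed simp

lemma D_funpow: assumes A: "A \<in> LO" and x: "x \<in> H" shows "D ((A ^^ k) x) x \<le> k * D (A x) x"
proof (induction k)
  case (Suc k)
  have "D ((A ^^ Suc k) x) x \<le> D (A ((A ^^ k) x)) (A x) + D (A x) x"
    using D_triangle[OF LO_H[OF LO_funpow[OF A, of "Suc k"] x] LO_H[OF A x] x] by simp
  then show ?case using Suc D_LO[OF A LO_H[OF LO_funpow[OF A, of k] x] x] by (simp add: algebra_simps)
qed simp

text \<open>The upper bound uses a point that is moved by less than
  \<open>tlen A + \<epsilon>\<close>. The lower bound holds exactly at powers of two by
  \<open>tlen_double\<close>; for other \<open>m\<close> the upper bound for the missing steps is
  subtracted.\<close>

lemma stable_length:
  assumes A: "A \<in> LO" and \<epsilon>: "\<epsilon> > 0"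
  shows "\<exists>K\<ge>0. \<forall>m. \<bar>D ((A ^^ m) e0) e0 - real m * tlen A\<bar> \<le> real m * \<epsilon> + K"
proof -
  let ?d = "\<lambda>m. D ((A ^^ m) e0) e0"
  obtain x where x: "x \<in> H" "D (A x) x < tlen A + \<epsilon>"
    using tlen_approx[of A "tlen A + \<epsilon>"] \<epsilon> by auto
  define K where "K = 2 * D x e0"
  have pH: "(A ^^ m) y \<in> H" if "y \<in> H" for m y using LO_H[OF LO_funpow[OF A] that] .
  have up: "?d m \<le> real m * (tlen A + \<epsilon>) + K" for m
  proof -
    have "?d m \<le> D ((A ^^ m) e0) ((A ^^ m) x) + D ((A ^^ m) x) x + D x e0"
      using D_triangle[OF pH[OF e0_H] pH[OF x(1)] e0_H, of m m] D_triangle[OF pH[OF x(1)] x(1) e0_H, of m] by linarith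
    also have "D ((A ^^ m) e0) ((A ^^ m) x) = D x e0"
      using D_LO[OF LO_funpow[OF A] e0_H x(1)] by (simp add: D_commute)
    also have "D ((A ^^ m) x) x \<le> real m * (tlen A + \<epsilon>)"
      using D_funpow[OF A x(1), of m] mult_left_mono[of "D (A x) x" "tlen A + \<epsilon>" "real m"] x(2) by simp
    finally show ?thesis by (simp add: K_def)
  qed
  have low: "?d m \<ge> real m * (tlen A - \<epsilon>) - K" for m
  proof (cases "m = 0")
    case True then show ?thesis by (simp add: K_def)
  next
    case False
    then obtain n where n: "2 ^ n \<le> m" "m < 2 ^ (n + 1)" using ex_power_ivl1[of 2 m] by auto
    \<comment> \<open>The next power of two satisfies \<open>m \<le> N \<le> 2 * m\<close>, so the
      \<open>N - m\<close> missing steps cost an error of at most \<open>m * \<epsilon>\<close> up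
      to the constant.\<close>
    define N :: nat where "N = 2 ^ (n + 1)"
    have N: "m \<le> N" "N \<le> 2 * m" using n by (auto simp: N_def)
    have "A ^^ N = (A ^^ m) \<circ> (A ^^ (N - m))" using N(1) by (simp add: funpow_add[symmetric])
    then have "?d N \<le> D ((A ^^ m) ((A ^^ (N - m)) e0)) ((A ^^ m) e0) + ?d m"
      using D_triangle[OF pH[OF pH[OF e0_H]] pH[OF e0_H] e0_H, of m "N - m" m] by simp
    also have "D ((A ^^ m) ((A ^^ (N - m)) e0)) ((A ^^ m) e0) = ?d (N - m)"
      by (rule D_LO[OF LO_funpow[OF A] pH[OF e0_H] e0_H])
    also have "?d (N - m) \<le> real (N - m) * (tlen A + \<epsilon>) + K" by (rule up)
    finally have 1: "?d N \<le> real (N - m) * (tlen A + \<epsilon>) + K + ?d m" by simp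
    have "real N * tlen A \<le> ?d N"
      using tlen_pow2[OF A, of "n + 1"] tlen_le[OF e0_H, of "A ^^ N"] by (simp add: N_def)
    with 1 have "real m * tlen A \<le> (real N - real m) * \<epsilon> + K + ?d m"
      using N by (simp add: of_nat_diff algebra_simps)
    also have "(real N - real m) * \<epsilon> \<le> real m * \<epsilon>"
      using N \<epsilon> by (intro mult_right_mono) linarith+
    finally show ?thesis by (simp add: algebra_simps)
  qed
  show ?thesis
  proof (intro exI[of _ K] conjI allI)
    show "K \<ge> 0" by (simp add: K_def)
    fix m
    show "\<bar>?d m - real m * tlen A\<bar> \<le> real m * \<epsilon> + K"
      using up[of m] low[of m] unfolding abs_le_iff by (simp add: algebra_simps)
  qed
qed

lemma stable_length_lim:
  assumes A: "A \<in> LO"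
  shows "(\<lambda>m. D ((A ^^ m) e0) e0 / real m) \<longlonglongrightarrow> tlen A"
proof (rule LIMSEQ_I)
  fix r :: real assume r: "r > 0"
  obtain K where K: "K \<ge> 0" "\<And>m. \<bar>D ((A ^^ m) e0) e0 - real m * tlen A\<bar> \<le> real m * (r / 2) + K"
    using stable_length[OF A, of "r / 2"] r by auto
  obtain N where N: "2 * K / r < real N" using reals_Archimedean2 by blast
  show "\<exists>N. \<forall>m\<ge>N. norm (D ((A ^^ m) e0) e0 / real m - tlen A) < r"
  proof (intro exI[of _ N] allI impI)
    fix m assume m: "N \<le> m"
    have "0 \<le> 2 * K / r" using K(1) r by simp
    then have m0: "real m > 0" "2 * K / r < real m" using m N by linarith+
    then have "K < real m * (r / 2)" using r by (simp add: field_simps)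
    then have "\<bar>D ((A ^^ m) e0) e0 - real m * tlen A\<bar> < real m * r" using K(2)[of m] by linarith
    then have "\<bar>(D ((A ^^ m) e0) e0 - real m * tlen A) / real m\<bar> < r"
      using m0(1) by (simp add: abs_divide divide_less_eq mult.commute)
    then show "norm (D ((A ^^ m) e0) e0 / real m - tlen A) < r"
      using m0(1) by (simp add: diff_divide_distrib)
  qed
qed

text \<open>The logarithm of \<open>B x u\<close> is a Busemann function, and this is its
  one-Lipschitz property. Cauchy-Schwarz orthogonally to \<open>x\<close> yields the factor
  \<open>B x y + sqrt ((B x y)\<^sup>2 - 1)\<close>, which is cosh plus sinh of the
  distance.\<close>

lemma horo_lipschitz:
  assumes x: "x \<in> H" and y: "y \<in> H" and u: "u \<in> C"
  shows "B y u \<le> exp (D x y) * B x u"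
proof -
  let ?b = "B x y" and ?a = "B x u"
  let ?y = "y - ?b *\<^sub>R x" and ?u = "u - ?a *\<^sub>R x"
  have b: "?b \<ge> 1" using B_ge_1 x y by simp
  have a: "?a \<ge> 0" using B_null_H[OF u x] by (simp add: lorentz_commute)
  have o: "B ?y x = 0" "B ?u x = 0"
    using x by (simp_all add: lorentz_simps B_HH lorentz_commute[of e y x] lorentz_commute[of e u x])
  have "(B ?y ?u)\<^sup>2 \<le> B ?y ?y * B ?u ?u" by (rule lorentz_orthogonal_CS[OF e_nz x o])
  also have "B ?y ?y = 1 - ?b\<^sup>2"
    using x y by (simp add: lorentz_simps B_HH lorentz_commute[of e y x] power2_eq_square)
  also have "B ?u ?u = - ?a\<^sup>2"
    using x u by (simp add: lorentz_simps B_HH C_def lorentz_commute[of e u x] power2_eq_square)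
  also have "(1 - ?b\<^sup>2) * - ?a\<^sup>2 = (sqrt (?b\<^sup>2 - 1) * ?a)\<^sup>2"
  proof -
    have "(sqrt (?b\<^sup>2 - 1))\<^sup>2 = ?b\<^sup>2 - 1" using b by simp
    then show ?thesis unfolding power_mult_distrib by (simp only: left_diff_distrib)
  qed
  finally have "(B ?y ?u)\<^sup>2 \<le> (sqrt (?b\<^sup>2 - 1) * ?a)\<^sup>2" .
  then have "B ?y ?u \<le> sqrt (?b\<^sup>2 - 1) * ?a"
    by (rule power2_le_imp_le) (intro mult_nonneg_nonneg a, use b in simp)
  moreover have "B y u = ?b * ?a + B ?y ?u"
    using x by (simp add: lorentz_simps B_HH lorentz_commute[of e y x] lorentz_commute[of e u x])
  ultimately have "B y u \<le> (?b + sqrt (?b\<^sup>2 - 1)) * ?a" by (simp add: algebra_simps)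
  also have "?b + sqrt (?b\<^sup>2 - 1) = exp (D x y)"
  proof -
    have "sqrt (?b\<^sup>2 - 1) = sinh (D x y)" using b x y by (simp add: D_arcosh sinh_arcosh_real)
    then show ?thesis using cosh_D[OF x y] sinh_plus_cosh[of "D x y"] by linarith
  qed
  finally show ?thesis .
qed

text \<open>An eigenvector on the cone makes \<open>A\<close> shift its Busemann function by a
  constant of size \<open>\<bar>ln c\<bar>\<close>, so no point is moved by less.\<close>

lemma eigen_le_tlen:
  assumes A: "A \<in> LO" and u: "u \<in> C" and c: "A u = c *\<^sub>R u"
  shows "c > 0" "\<bar>ln c\<bar> \<le> tlen A"
proof -
  have "A u \<in> C" by (rule LO_C[OF A u])
  then show c0: "c > 0" using u c by (auto simp: C_def lorentz_simps zero_less_mult_iff)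
  show "\<bar>ln c\<bar> \<le> tlen A"
  proof (rule tlen_ge)
    fix x assume x: "x \<in> H"
    have p: "B x u > 0" using B_null_H[OF u x] by (simp add: lorentz_commute)
    have "B x u = B (A x) (c *\<^sub>R u)" by (simp only: c[symmetric] LO_B[OF A])
    then have e: "B x u = c * B (A x) u" by (simp add: lorentz_simps)
    then have p': "B (A x) u > 0" using p c0 by (simp add: zero_less_mult_iff)
    have "c * B (A x) u \<le> exp (D (A x) x) * B (A x) u"
      using horo_lipschitz[OF LO_H[OF A x] x u] e by simp
    then have "c \<le> exp (D (A x) x)" using p' by simp
    then have "ln c \<le> ln (exp (D (A x) x))" using c0 by (subst ln_le_cancel_iff) auto
    then have 1: "ln c \<le> D (A x) x" by simp
    have "B (A x) u \<le> exp (D (A x) x) * (c * B (A x) u)"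
      using horo_lipschitz[OF x LO_H[OF A x] u] e by (simp add: D_commute)
    then have "1 \<le> exp (D (A x) x) * c" using p' by (simp add: mult.assoc[symmetric])
    then have "ln 1 \<le> ln (exp (D (A x) x) * c)" using c0 by (subst ln_le_cancel_iff) auto
    then have 2: "- ln c \<le> D (A x) x" using c0 by (simp add: ln_mult)
    show "\<bar>ln c\<bar> \<le> D (A x) x" using 1 2 by linarith
  qed
qed

section \<open>Displacements and directions of orbit points\<close>

definition \<phi> where "\<phi> A = B (A e0) e0"

text \<open>The orbit point in the Klein model. As \<open>\<phi> A\<close> grows,
  \<open>B (W A) (W A)\<close> tends to zero, so limits of directions are isotropic.\<close>

definition W where "W A = (1 / \<phi> A) *\<^sub>R A e0"

lemma \<phi>_ge1: "A \<in> LO \<Longrightarrow> \<phi> A \<ge> 1"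
  unfolding \<phi>_def by (rule H_e0_ge1, rule LO_H) auto

lemma \<phi>_inv: "A \<in> LO \<Longrightarrow> \<phi> (fun_inv A) = \<phi> A"
  unfolding \<phi>_def by (metis LO_adj lorentz_commute)

lemma B_e0_e0_LO: "A \<in> LO \<Longrightarrow> A' \<in> LO \<Longrightarrow> B (A e0) (A' e0) = \<phi> (fun_inv A \<circ> A')"
  unfolding \<phi>_def by (simp add: LO_adj lorentz_commute)

lemma W_B: "A \<in> LO \<Longrightarrow> B (W A) e0 = 1"
  using \<phi>_ge1[of A] by (simp add: W_def lorentz_simps \<phi>_def)

lemma W_null: "A \<in> LO \<Longrightarrow> B (W A) (W A) = 1 / (\<phi> A)\<^sup>2"
  by (simp add: W_def lorentz_simps LO_B power2_eq_square)

lemma LO_W: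
  assumes "A \<in> LO" "G \<in> LO"
  shows "A (W G) = B (A (W G)) e0 *\<^sub>R W (A \<circ> G)"
  using \<phi>_ge1[OF LO_comp[OF assms]] by (simp add: W_def LO_scale[OF assms(1)] lorentz_simps \<phi>_def)

text \<open>Up to constants the main term is \<open>exp\<close> of minus twice the Gromov product of
  \<open>A e0\<close> and \<open>A' e0\<close> seen from \<open>e0\<close>; this is why norm
  distances of directions act as a visual metric.\<close>

lemma W_diff:
  assumes A: "A \<in> LO" and A': "A' \<in> LO"
  shows "(norm (W A - W A'))\<^sup>2 = 2 * B (A e0) (A' e0) / (\<phi> A * \<phi> A') - 1 / (\<phi> A)\<^sup>2 - 1 / (\<phi> A')\<^sup>2"
proof -
  have "B (W A - W A') e0 = 0" using W_B A A' by (simp add: lorentz_simps)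
  then have "(norm (W A - W A'))\<^sup>2 = - B (W A - W A') (W A - W A')" by (rule norm_sq0)
  also have "\<dots> = 2 * B (W A) (W A') - 1 / (\<phi> A)\<^sup>2 - 1 / (\<phi> A')\<^sup>2"
    using A A' by (simp add: lorentz_simps W_null lorentz_commute[of e "W A'" "W A"])
  also have "B (W A) (W A') = B (A e0) (A' e0) / (\<phi> A * \<phi> A')"
    by (simp add: W_def lorentz_simps)
  finally show ?thesis by simp
qed

lemma W_diff_le:
  assumes A: "A \<in> LO" and A': "A' \<in> LO"
  shows "(norm (W A - W A'))\<^sup>2 \<le> 2 * B (A e0) (A' e0) / (\<phi> A * \<phi> A')"
proof -
  have "1 / (\<phi> A)\<^sup>2 \<ge> 0" "1 / (\<phi> A')\<^sup>2 \<ge> 0" by simp_all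
  then show ?thesis unfolding W_diff[OF assms] by linarith
qed

text \<open>A local-to-global principle. By hypothesis the points \<open>A e0\<close> and
  \<open>fun_inv A e0\<close> are seen from \<open>e0\<close> in clearly different directions.
  Inductively the backward orbit point \<open>P e0\<close> is seen close to
  \<open>fun_inv A e0\<close>, hence away from \<open>A e0\<close>, and this separation forces the
  next displacement to double.\<close>

lemma growth:
  assumes A: "A \<in> LO" and c2: "\<phi> (A \<circ> A) > 5 * \<phi> A + 1"
  shows "\<phi> (A ^^ Suc k) \<ge> 2 * \<phi> (A ^^ k)"
proof (induction k)
  case 0
  let ?c = "\<phi> A"
  have c: "?c \<ge> 1" by (rule \<phi>_ge1[OF A])
  have "B (A e0) (A (A e0)) = ?c"
    by (simp add: \<phi>_def LO_B[OF A] lorentz_commute[of e "A e0" e0])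
  moreover have "\<bar>B e0 (A (A e0)) - B (A e0) e0 * B (A e0) (A (A e0))\<bar>
      \<le> sqrt ((B (A e0) e0)\<^sup>2 - 1) * sqrt ((B (A e0) (A (A e0)))\<^sup>2 - 1)"
    by (rule H_gram) (simp_all add: LO_H[OF A])
  ultimately have "\<bar>\<phi> (A \<circ> A) - ?c * ?c\<bar> \<le> sqrt (?c\<^sup>2 - 1) * sqrt (?c\<^sup>2 - 1)"
    by (simp add: \<phi>_def lorentz_commute[of e e0 "A (A e0)"])
  also have "\<dots> = ?c\<^sup>2 - 1" using c by simp
  finally have "5 * ?c + 1 < 2 * ?c * ?c" using c2 by (simp add: power2_eq_square)
  then have "5 * ?c < (2 * ?c) * ?c" by linarith
  then have "5 < 2 * ?c" using c by (simp add: mult_less_cancel_right)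
  then show ?case using c by (simp add: \<phi>_def)
next
  case (Suc k)
  let ?A' = "fun_inv A"
  define P where "P = fun_inv (A ^^ Suc k)"
  let ?c = "\<phi> A" and ?b0 = "\<phi> (A ^^ k)" and ?b1 = "\<phi> (A ^^ Suc k)" and ?b2 = "\<phi> (A ^^ Suc (Suc k))"
  have L: "A \<in> LO" "?A' \<in> LO" "A ^^ k \<in> LO" "A ^^ Suc k \<in> LO" "P \<in> LO"
    using A LO_inv(1)[OF A] LO_funpow[OF A] LO_inv(1) by (auto simp: P_def simp del: funpow.simps)
  have c: "?c \<ge> 1" and b: "?b0 \<ge> 1" "?b1 \<ge> 1" using \<phi>_ge1 L by auto
  have \<phi>P: "\<phi> P = ?b1" "\<phi> ?A' = ?c" using \<phi>_inv L by (auto simp: P_def)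
  have 1: "B (?A' e0) (A e0) = \<phi> (A \<circ> A)"
    using LO_B[OF A, of "fun_inv A e0" "A e0"] unfolding LO_inv(3)[OF A]
    by (simp add: \<phi>_def lorentz_commute)
  have pow: "(A ^^ Suc k) (A v) = (A ^^ Suc (Suc k)) v" for v
    by (simp only: funpow_Suc_right o_apply)
  have BP: "B (P v) w = B v ((A ^^ Suc k) w)" for v w
    using LO_B[OF L(4), of "P v" w] LO_inv(3)[OF L(4)] by (simp only: P_def)
  have 2: "B (P e0) (?A' e0) = ?b0"
    unfolding BP funpow_Suc_right o_apply LO_inv(3)[OF A] by (simp only: \<phi>_def lorentz_commute)
  have 3: "B (P e0) (A e0) = ?b2"
    unfolding BP pow by (simp only: \<phi>_def lorentz_commute)
  let ?\<alpha> = "norm (W ?A' - W A)" and ?\<beta> = "norm (W P - W ?A')" and ?\<gamma> = "norm (W P - W A)"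
  have "?\<alpha> \<le> ?\<beta> + ?\<gamma>"
    using norm_triangle_ineq4[of "W P - W A" "W P - W ?A'"] by (simp add: algebra_simps)
  have a: "?\<alpha>\<^sup>2 \<ge> 10 / ?c"
  proof -
    have "?\<alpha>\<^sup>2 = 2 * (\<phi> (A \<circ> A) - 1) / (?c * ?c)"
      unfolding W_diff[OF L(2,1)] 1 \<phi>P by (simp add: power2_eq_square diff_divide_distrib)
    also have "\<dots> \<ge> 2 * (5 * ?c) / (?c * ?c)"
      using c2 c by (intro divide_right_mono) auto
    also have "2 * (5 * ?c) / (?c * ?c) = 10 / ?c" using c by simp
    finally show ?thesis .
  qed
  have be: "?\<beta>\<^sup>2 \<le> 1 / ?c"
  proof -
    have "?\<beta>\<^sup>2 \<le> 2 * ?b0 / (?b1 * ?c)"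
      using W_diff_le[OF L(5,2)] unfolding 2 \<phi>P .
    also have "\<dots> \<le> ?b1 / (?b1 * ?c)"
      using Suc b c by (intro divide_right_mono) (simp_all del: funpow.simps)
    finally show ?thesis using b by simp
  qed
  have g: "?\<gamma>\<^sup>2 \<le> 2 * ?b2 / (?b1 * ?c)"
    using W_diff_le[OF L(5,1)] unfolding 3 \<phi>P .
  \<comment> \<open>Otherwise \<open>?\<alpha>\<close> would be at most
    \<open>(1 + 2) * sqrt (1 / ?c)\<close>, and \<open>9 / ?c\<close> contradicts the lower bound
    \<open>10 / ?c\<close>; the constant five in the hypothesis is made for this.\<close>
  have "?\<gamma>\<^sup>2 \<ge> 4 / ?c"
  proof (rule ccontr)
    assume "\<not> ?thesis"
    then have "?\<gamma>\<^sup>2 \<le> 4 / ?c" by simp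
    then have "?\<gamma> \<le> sqrt (4 / ?c)" by (rule real_le_rsqrt)
    moreover have "?\<beta> \<le> sqrt (1 / ?c)" using be by (rule real_le_rsqrt)
    ultimately have "?\<alpha> \<le> 3 * sqrt (1 / ?c)"
      using \<open>?\<alpha> \<le> ?\<beta> + ?\<gamma>\<close> by (simp add: real_sqrt_divide)
    then have "?\<alpha>\<^sup>2 \<le> (3 * sqrt (1 / ?c))\<^sup>2" by (intro power_mono) auto
    also have "\<dots> = 9 / ?c" using c by (simp add: power_mult_distrib power_divide real_sqrt_divide)
    also have "\<dots> < 10 / ?c" using c by (simp add: divide_strict_right_mono)
    finally show False using a by simp
  qed
  with g have "4 / ?c \<le> 2 * ?b2 / (?b1 * ?c)" by linarith
  then have "4 \<le> 2 * ?b2 / ?b1" using c by (simp add: field_simps)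
  then show ?case using b by (simp add: field_simps del: funpow.simps)
qed

text \<open>Otherwise \<open>growth\<close> makes the displacement of the \<open>k\<close>-th power
  at least \<open>2 ^ k\<close>, so the stable length is positive. The factor six absorbs the
  summand one of \<open>growth\<close>.\<close>

lemma tlen_0_\<phi>:
  assumes A: "A \<in> LO" and t: "tlen A = 0"
  shows "\<phi> (A \<circ> A) \<le> 6 * \<phi> A"
proof (rule ccontr)
  assume n: "\<not> ?thesis"
  then have c2: "\<phi> (A \<circ> A) > 5 * \<phi> A + 1" using \<phi>_ge1[OF A] by simp
  have g: "\<phi> (A ^^ k) \<ge> 2 ^ k" for k
  proof (induction k)
    case (Suc k) then show ?case using growth[OF A c2, of k] unfolding power_Suc by linarith
  qed (simp add: \<phi>_def)
  obtain K where K: "\<And>m. \<bar>D ((A ^^ m) e0) e0 - real m * tlen A\<bar> \<le> real m * (ln 2 / 2) + K"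
    using stable_length[OF A, of "ln 2 / 2"] by auto
  have "real m * (ln 2 / 2) \<le> K" for m
  proof -
    have "2 ^ m \<le> exp (D ((A ^^ m) e0) e0)"
      using g[of m] B_le_exp_D(1)[OF LO_H[OF LO_funpow[OF A] e0_H] e0_H, of m] by (simp add: \<phi>_def)
    then have "ln (2 ^ m) \<le> ln (exp (D ((A ^^ m) e0) e0))" by (subst ln_le_cancel_iff) auto
    then show ?thesis using K[of m] t by (simp add: ln_realpow)
  qed
  then have "real m \<le> K / (ln 2 / 2)" for m by (subst pos_le_divide_eq) auto
  then show False using reals_Archimedean2 not_less by blast
qed

text \<open>At translation length zero, \<open>A\<close> and its inverse send \<open>e0\<close> in
  nearby directions. If the product is displaced further than both factors, its direction is close
  to that of \<open>A\<close>, and the direction of its inverse is close to that of the inverse of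
  \<open>A'\<close>. The resulting chain joins \<open>W (fun_inv A)\<close> to \<open>W A'\<close>,
  and closeness of these two bounds the displacement of the product.\<close>

lemma \<phi>_prod:
  assumes A: "A \<in> LO" "A' \<in> LO" and t: "tlen A = 0" "tlen A' = 0" "tlen (A \<circ> A') = 0"
  shows "\<phi> (A \<circ> A') \<le> 151 * max (\<phi> A) (\<phi> A')"
proof (cases "\<phi> (A \<circ> A') \<le> max (\<phi> A) (\<phi> A')")
  case True then show ?thesis using \<phi>_ge1[OF A(1)] by auto
next
  case False
  let ?r = "\<phi> (A \<circ> A')" and ?a = "\<phi> A" and ?a' = "\<phi> A'"
  define m where "m = min ?a ?a'"
  have m: "m \<ge> 1" "m \<le> ?a" "m \<le> ?a'" "m \<le> ?r" using \<phi>_ge1 A False by (auto simp: m_def)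
  have L: "A \<circ> A' \<in> LO" "fun_inv A \<in> LO" "fun_inv A' \<in> LO" "fun_inv (A \<circ> A') \<in> LO"
    using A LO_comp LO_inv(1) by auto
  have inv_comp: "fun_inv (A \<circ> A') = fun_inv A' \<circ> fun_inv A"
    using A LO_bij by (simp add: o_inv_distrib)
  \<comment> \<open>Bound for one link of the chain: \<open>W_diff_le\<close> contributes the factor
    two, \<open>tlen_0_\<phi>\<close> the factor six.\<close>
  define s where "s = sqrt (12 / m)"
  have bnd: "norm (W G - W G') \<le> s" if "G \<in> LO" "G' \<in> LO" "B (G e0) (G' e0) * m \<le> 6 * (\<phi> G * \<phi> G')" for G G'
    unfolding s_def
  proof (rule real_le_rsqrt)
    have "(norm (W G - W G'))\<^sup>2 \<le> 2 * B (G e0) (G' e0) / (\<phi> G * \<phi> G')" using W_diff_le that by blast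
    also have "\<dots> \<le> 12 / m" using that(3) m \<phi>_ge1[OF that(1)] \<phi>_ge1[OF that(2)]
      by (simp add: field_simps)
    finally show "(norm (W G - W G'))\<^sup>2 \<le> 12 / m" .
  qed
  have sq: "norm (W G - W (fun_inv G)) \<le> s" if G: "G \<in> LO" "tlen G = 0" "m \<le> \<phi> G" for G
  proof (rule bnd[OF G(1) LO_inv(1)[OF G(1)]])
    have "B (G e0) (fun_inv G e0) = \<phi> (G \<circ> G)"
      using LO_adj[OF G(1), of "G e0" e0] by (simp add: \<phi>_def)
    also have "\<dots> * m \<le> (6 * \<phi> G) * \<phi> G"
      using tlen_0_\<phi>[OF G(1,2)] G(3) m(1) \<phi>_ge1[OF G(1)] by (intro mult_mono) auto
    finally show "B (G e0) (fun_inv G e0) * m \<le> 6 * (\<phi> G * \<phi> (fun_inv G))"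
      by (simp add: \<phi>_inv[OF G(1)])
  qed
  have 1: "norm (W (A \<circ> A') - W A) \<le> s"
  proof (rule bnd[OF L(1) A(1)])
    have "B ((A \<circ> A') e0) (A e0) = ?a'" by (simp add: LO_B[OF A(1)] \<phi>_def)
    moreover have "?a' * m \<le> ?r * ?a" using False m \<phi>_ge1 A by (intro mult_mono) auto
    moreover have "?r * ?a \<ge> 0" using m by auto
    ultimately show "B ((A \<circ> A') e0) (A e0) * m \<le> 6 * (?r * ?a)" by (simp only:)
  qed
  have 2: "norm (W (fun_inv (A \<circ> A')) - W (fun_inv A')) \<le> s"
  proof (rule bnd[OF L(4,3)])
    have "B (fun_inv (A \<circ> A') e0) (fun_inv A' e0) = ?a"
      unfolding inv_comp using LO_B[OF L(3)] \<phi>_inv[OF A(1)] by (simp add: \<phi>_def)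
    moreover have "?a * m \<le> ?r * ?a'" using False m \<phi>_ge1 A by (intro mult_mono) auto
    moreover have "?r * ?a' \<ge> 0" using m by auto
    ultimately show "B (fun_inv (A \<circ> A') e0) (fun_inv A' e0) * m \<le> 6 * (\<phi> (fun_inv (A \<circ> A')) * \<phi> (fun_inv A'))"
      unfolding \<phi>_inv[OF L(1)] \<phi>_inv[OF A(2)] by (simp only:)
  qed
  have 3: "norm (W (A \<circ> A') - W (fun_inv (A \<circ> A'))) \<le> s" by (rule sq[OF L(1) t(3) m(4)])
  have 4: "norm (W A - W (fun_inv A)) \<le> s" "norm (W A' - W (fun_inv A')) \<le> s"
    using sq A t m by auto
  have tri: "norm (x - z) \<le> norm (x - y) + norm (y - z)" for x y z :: 'a
    using norm_triangle_ineq[of "x - y" "y - z"] by simp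
  have "norm (W (fun_inv A) - W A') \<le> 5 * s"
    using 1 2 3 4 tri[of "W (fun_inv A)" "W A'" "W A"] tri[of "W A" "W A'" "W (A \<circ> A')"]
      tri[of "W (A \<circ> A')" "W A'" "W (fun_inv (A \<circ> A'))"]
      tri[of "W (fun_inv (A \<circ> A'))" "W A'" "W (fun_inv A')"]
    by (simp only: norm_minus_commute[of "W (fun_inv A)" "W A"] norm_minus_commute[of "W A" "W (A \<circ> A')"]
        norm_minus_commute[of "W (fun_inv A')" "W A'"])
  then have "(norm (W (fun_inv A) - W A'))\<^sup>2 \<le> (5 * s)\<^sup>2" by (intro power_mono) auto
  \<comment> \<open>Five links give \<open>25 * 12 = 300\<close>; the two correction terms of
    \<open>W_diff\<close> add one each, and half of 302 is the constant 151.\<close>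
  also have "(5 * s)\<^sup>2 = 300 / m" using m by (simp add: s_def power_mult_distrib)
  finally have "2 * ?r / (?a * ?a') - 1 / ?a\<^sup>2 - 1 / ?a'\<^sup>2 \<le> 300 / m"
    unfolding W_diff[OF L(2) A(2)] \<phi>_inv[OF A(1)]
    using LO_B[OF A(1), of "fun_inv A e0" "A' e0"] unfolding LO_inv(3)[OF A(1)]
    by (simp add: \<phi>_def lorentz_commute[of e e0 "A (A' e0)"])
  moreover have "1 / x\<^sup>2 \<le> 1 / m" if "x \<ge> m" for x
  proof -
    have "1 * m \<le> x * x" using that m by (intro mult_mono) auto
    then show ?thesis using that m by (intro divide_left_mono) (auto simp: power2_eq_square)
  qed
  ultimately have "2 * ?r / (?a * ?a') \<le> 300 / m + 1 / m + 1 / m" using m by (smt (verit, best))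
  then have "2 * ?r / (?a * ?a') \<le> 302 / m" by simp
  moreover have "?a * ?a' = m * max ?a ?a'" by (simp add: m_def min_def max_def)
  ultimately have "2 * ?r / (m * max ?a ?a') \<le> 302 / m" by simp
  then show ?thesis using m by (simp add: field_simps split: if_splits)
qed

end

section \<open>Circumcentres, and fixed rays of groups without hyperbolic elements\<close>

lemma Cauchy_sqI:
  fixes X :: "nat \<Rightarrow> 'a::real_normed_vector"
  assumes "\<And>N m n. m \<ge> N \<Longrightarrow> n \<ge> N \<Longrightarrow> (norm (X m - X n))\<^sup>2 \<le> K / (real N + 1)"
  shows "Cauchy X"
proof (rule CauchyI)
  fix \<epsilon> :: real assume \<epsilon>: "\<epsilon> > 0"
  obtain N where N: "\<bar>K\<bar> / \<epsilon>\<^sup>2 < real N" using reals_Archimedean2 by blast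
  have "norm (X m - X n) < \<epsilon>" if "m \<ge> N" "n \<ge> N" for m n
  proof (rule power2_less_imp_less)
    have "(norm (X m - X n))\<^sup>2 \<le> \<bar>K\<bar> / (real N + 1)"
      using assms[OF that] by (smt (verit) divide_right_mono of_nat_0_le_iff)
    also have "\<dots> < \<epsilon>\<^sup>2"
      using N \<epsilon> by (simp add: divide_less_eq) (smt (verit, best) mult.commute pos_divide_less_eq zero_less_power mult_less_cancel_left_pos)
    finally show "(norm (X m - X n))\<^sup>2 < \<epsilon>\<^sup>2" .
  qed (use \<epsilon> in simp)
  then show "\<exists>M. \<forall>m\<ge>M. \<forall>n\<ge>M. norm (X m - X n) < \<epsilon>" by blast
qed

locale complete_lorentz_space = lorentz_space e for e :: "'a::{real_inner,complete_space}"
begin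

text \<open>The orbit of \<open>e0\<close> has a unique circumcentre, which is therefore fixed.
  \<open>P x r\<close> says that the orbit lies in the ball about \<open>x\<close> whose radius has
  hyperbolic cosine \<open>r\<close>; minimising sequences of centres are Cauchy, which replaces
  compactness.\<close>

lemma bounded_orbit_fixed_point:
  assumes S: "S \<subseteq> LO" "id \<in> S" "\<And>A. A \<in> S \<Longrightarrow> fun_inv A \<in> S"
    "\<And>A A'. A \<in> S \<Longrightarrow> A' \<in> S \<Longrightarrow> A \<circ> A' \<in> S"
    and bd: "\<And>A. A \<in> S \<Longrightarrow> \<phi> A \<le> M"
  shows "\<exists>x\<in>H. \<forall>A\<in>S. A x = x"
proof -
  define P where "P x r \<longleftrightarrow> x \<in> H \<and> (\<forall>A\<in>S. B (A e0) x \<le> r)" for x r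
  define r0 where "r0 = Inf {r. \<exists>x. P x r}"
  have ne: "P e0 M" using bd by (simp add: P_def \<phi>_def)
  have ge1: "r \<ge> 1" if "P x r" for x r
  proof -
    have "B e0 x \<le> r" using that S(2) unfolding P_def by (metis id_apply)
    moreover have "B e0 x \<ge> 1" using that B_ge_1[OF e0_H] by (simp add: P_def)
    ultimately show ?thesis by simp
  qed
  have bb: "bdd_below {r. \<exists>x. P x r}" using ge1 by (intro bdd_belowI) blast
  have r0: "r0 \<ge> 1" unfolding r0_def using ne ge1 by (intro cInf_greatest) auto
  have low: "r0 \<le> r" if "P x r" for x r
    unfolding r0_def using that by (intro cInf_lower bb) blast
  have mono: "P x r \<Longrightarrow> r \<le> r' \<Longrightarrow> P x r'" for x r r' by (force simp: P_def)
  have approx: "\<exists>x. P x (r0 + \<delta>)" if "\<delta> > 0" for \<delta>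
  proof -
    have "\<exists>r\<in>{r. \<exists>x. P x r}. r < r0 + \<delta>"
      unfolding r0_def using that ne by (intro cInf_lessD) (auto simp: r0_def)
    then show ?thesis using mono less_imp_le by blast
  qed
  \<comment> \<open>Let \<open>s\<close> be the hyperbolic cosine of half the distance between two
    almost optimal centres. Their midpoint is a centre for \<open>(r0 + \<delta>) / s\<close>, so
    minimality of \<open>r0 \<ge> 1\<close> forces \<open>s \<le> 1 + \<delta>\<close>.\<close>
  have key: "B x y \<le> 1 + 6 * \<delta>" if x: "P x (r0 + \<delta>)" and y: "P y (r0 + \<delta>)" and \<delta>: "0 < \<delta>" "\<delta> \<le> 1" for x y \<delta>
  proof -
    have xy: "x \<in> H" "y \<in> H" using x y by (auto simp: P_def)
    let ?b = "B x y"
    define s where "s = sqrt ((1 + ?b) / 2)"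
    have b: "?b \<ge> 1" using B_ge_1[OF xy] .
    have s1: "s \<ge> 1" using b by (simp add: s_def)
    have s2: "sqrt (2 + 2 * ?b) = 2 * s"
    proof -
      have "sqrt (2 + 2 * ?b) = sqrt (4 * ((1 + ?b) / 2))" by simp
      then show ?thesis by (simp only: s_def real_sqrt_mult) simp
    qed
    let ?m = "(1 / sqrt (2 + 2 * ?b)) *\<^sub>R (x + y)"
    have "P ?m ((r0 + \<delta>) / s)"
      unfolding P_def
    proof (intro conjI ballI midpoint_H xy)
      fix A assume A: "A \<in> S"
      have "B (A e0) ?m = (B (A e0) x + B (A e0) y) / (2 * s)"
        unfolding s2 by (simp add: lorentz_simps add_divide_distrib)
      also have "\<dots> \<le> (2 * (r0 + \<delta>)) / (2 * s)"
        using x y A s1 by (intro divide_right_mono) (force simp: P_def)+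
      also have "\<dots> = (r0 + \<delta>) / s" using s1 by (simp only: mult_divide_mult_cancel_left_if) simp
      finally show "B (A e0) ?m \<le> (r0 + \<delta>) / s" .
    qed
    then have "r0 \<le> (r0 + \<delta>) / s" by (rule low)
    then have "r0 * s \<le> r0 + \<delta>" using s1 by (simp add: le_divide_eq)
    also have "\<dots> \<le> r0 * (1 + \<delta>)" using r0 \<delta> by (simp add: distrib_left)
    finally have "s \<le> 1 + \<delta>" using r0 by simp
    then have "s\<^sup>2 \<le> (1 + \<delta>)\<^sup>2" using s1 by (intro power_mono) auto
    then have "(1 + ?b) / 2 \<le> (1 + \<delta>)\<^sup>2" using b by (simp add: s_def)
    moreover have "(1 + \<delta>)\<^sup>2 \<le> 1 + 3 * \<delta>" using \<delta> by (simp add: power2_eq_square algebra_simps mult_left_le)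
    ultimately show ?thesis by simp
  qed
  \<comment> \<open>The constant of \<open>norm_equiv\<close> at height at most
    \<open>r0 + 1\<close>, times \<open>84 = 2 * 36 + 2 * 6\<close>, which comes from
    \<open>B x y - 1 \<le> 6 * \<delta>\<close>.\<close>
  define K where "K = (4 * (r0 + 1)\<^sup>2 + 1) * 84"
  have close: "(norm (x - y))\<^sup>2 \<le> K * \<delta>" if x: "P x (r0 + \<delta>)" and y: "P y (r0 + \<delta>)" and \<delta>: "0 < \<delta>" "\<delta> \<le> 1" for x y \<delta>
  proof -
    have xy: "x \<in> H" "y \<in> H" using x y by (auto simp: P_def)
    let ?q = "B x y - 1"
    have q: "?q \<ge> 0" "?q \<le> 6 * \<delta>" using B_ge_1[OF xy] key[OF that] by auto
    have "?q * ?q \<le> (6 * \<delta>) * (6 * \<delta>)" using q by (intro mult_mono) auto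
    also have "\<dots> \<le> 36 * \<delta>" using \<delta> by (simp add: mult_left_le)
    finally have qq: "?q * ?q \<le> 36 * \<delta>" .
    have "(norm (x - y))\<^sup>2 \<le> (4 * (B x e0)\<^sup>2 + 1) * (2 * (B (x - y) x)\<^sup>2 - B (x - y) (x - y))"
      by (rule norm_equiv[OF xy(1)])
    also have "2 * (B (x - y) x)\<^sup>2 - B (x - y) (x - y) = 2 * (?q * ?q) + 2 * ?q"
      using xy by (simp add: lorentz_simps B_HH lorentz_commute[of e y x] power2_eq_square algebra_simps)
    also have "(4 * (B x e0)\<^sup>2 + 1) * (2 * (?q * ?q) + 2 * ?q) \<le> (4 * (r0 + 1)\<^sup>2 + 1) * (84 * \<delta>)"
    proof (rule mult_mono)
      have "B e0 x \<le> r0 + \<delta>" using x S(2) unfolding P_def by (metis id_apply)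
      then have "B x e0 \<le> r0 + 1" using \<delta> by (simp add: lorentz_commute[of e e0 x])
      then show "4 * (B x e0)\<^sup>2 + 1 \<le> 4 * (r0 + 1)\<^sup>2 + 1"
        using H_e0_ge1[OF xy(1)] by (simp add: power_mono)
    qed (use q qq \<delta> in auto)
    finally show ?thesis by (simp only: K_def mult.assoc)
  qed
  obtain X where X: "\<And>k. P (X k) (r0 + 1 / (real k + 1))"
    using approx[of "1 / (real k + 1)" for k] by (metis add_nonneg_pos of_nat_0_le_iff zero_less_divide_1_iff zero_less_one)
  have XN: "P (X k) (r0 + 1 / (real N + 1))" if "k \<ge> N" for k N
    using X[of k] that by (rule_tac mono) (auto intro!: divide_left_mono mult_pos_pos)
  have "Cauchy X"
    using close[OF XN XN] by (intro Cauchy_sqI[of X K]) (simp add: divide_le_eq)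
  then obtain z where z: "X \<longlonglongrightarrow> z" using Cauchy_convergent convergent_def by blast
  have inv0: "(\<lambda>k. r0 + 1 / (real k + 1)) \<longlonglongrightarrow> r0 + 0"
    by (intro tendsto_intros LIMSEQ_Suc[OF lim_1_over_n, simplified] lim_const_over_n) (use LIMSEQ_Suc[OF lim_1_over_n] in \<open>simp add: add.commute\<close>)
  have XH: "X k \<in> H" for k using X by (simp add: P_def)
  have zH: "z \<in> H"
  proof -
    have "(\<lambda>k. B (X k) (X k)) \<longlonglongrightarrow> B z z" by (intro tendsto_intros z)
    then have "B z z = 1" using B_HH[OF XH] by (simp add: LIMSEQ_const_iff)
    moreover have "B z e0 \<ge> 1"
      by (rule LIMSEQ_le_const[OF tendsto_B[OF z tendsto_const]]) (use H_e0_ge1[OF XH] in auto)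
    ultimately show ?thesis by (simp add: H_iff)
  qed
  have zr: "B (A e0) z \<le> r0" if "A \<in> S" for A
  proof (rule LIMSEQ_le)
    show "(\<lambda>k. B (A e0) (X k)) \<longlonglongrightarrow> B (A e0) z" by (intro tendsto_intros z)
    show "(\<lambda>k. r0 + 1 / (real k + 1)) \<longlonglongrightarrow> r0" using inv0 by simp
    show "\<exists>N. \<forall>n\<ge>N. B (A e0) (X n) \<le> r0 + 1 / (real n + 1)"
      using X that unfolding P_def by blast
  qed
  show ?thesis
  proof (intro bexI[of _ z] ballI zH)
    fix A assume A: "A \<in> S"
    then have L: "A \<in> LO" using S by blast
    have Pz: "P z (r0 + \<delta>)" if "\<delta> > 0" for \<delta>
      using zH zr that unfolding P_def by (metis add_increasing2 less_imp_le)
    \<comment> \<open>Since \<open>S\<close> is a group, \<open>A\<close> permutes the orbit of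
      \<open>e0\<close>, and \<open>A z\<close> is as good a centre as \<open>z\<close>;
      \<open>key\<close> then identifies the two.\<close>
    have PA: "P (A z) (r0 + \<delta>)" if "\<delta> > 0" for \<delta>
      unfolding P_def
    proof (intro conjI ballI LO_H[OF L zH])
      fix A' assume A': "A' \<in> S"
      have "B (A' e0) (A z) = B ((fun_inv A \<circ> A') e0) z"
        by (simp add: lorentz_commute[of e "A' e0"] LO_adj[OF L] lorentz_commute[of e z])
      also have "\<dots> \<le> r0" by (rule zr[OF S(4)[OF S(3)[OF A] A']])
      finally show "B (A' e0) (A z) \<le> r0 + \<delta>" using that by simp
    qed
    have "B z (A z) \<le> 1 + \<epsilon>" if "\<epsilon> > 0" for \<epsilon>
    proof -
      define \<delta> where "\<delta> = min 1 (\<epsilon> / 6)"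
      have "\<delta> > 0" "\<delta> \<le> 1" "6 * \<delta> \<le> \<epsilon>" using that by (auto simp: \<delta>_def)
      then show ?thesis using key[OF Pz PA, of \<delta>] by simp
    qed
    then have "B z (A z) \<le> 1" by (rule field_le_epsilon)
    then have "z = A z" using B_ge_1[OF zH LO_H[OF L zH]] by (intro hyp_space_eqI[OF e_nz zH LO_H[OF L zH]]) simp
    then show "A z = z" by simp
  qed
qed

text \<open>Bounded displacements give a circumcentre. Otherwise \<open>\<phi>_prod\<close>, applied
  to \<open>fun_inv A \<circ> A'\<close>, shows that far displaced elements have nearly equal
  directions, so the directions along an unbounded sequence converge. Left multiplication by an
  element gives another such sequence with the same limit, which is thus a fixed ray.\<close>

lemma zero_length_elementary:
  assumes S: "S \<subseteq> LO" "id \<in> S" "\<And>A. A \<in> S \<Longrightarrow> fun_inv A \<in> S"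
    "\<And>A A'. A \<in> S \<Longrightarrow> A' \<in> S \<Longrightarrow> A \<circ> A' \<in> S"
    and t: "\<And>A. A \<in> S \<Longrightarrow> tlen A = 0"
  shows "(\<exists>x\<in>H. \<forall>A\<in>S. A x = x) \<or> (\<exists>u\<in>C. \<forall>A\<in>S. \<exists>c. A u = c *\<^sub>R u)"
proof (cases "\<exists>M. \<forall>A\<in>S. \<phi> A \<le> M")
  case True
  then show ?thesis using bounded_orbit_fixed_point[OF S] by blast
next
  case False
  then have "\<forall>k::nat. \<exists>A. A \<in> S \<and> \<phi> A > real k + 1" by (meson not_le)
  then obtain G where G: "\<And>k::nat. G k \<in> S \<and> \<phi> (G k) > real k + 1" by metis
  have L: "A \<in> S \<Longrightarrow> A \<in> LO" for A using S(1) by blast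
  have prod: "\<phi> (A \<circ> A') \<le> 151 * max (\<phi> A) (\<phi> A')" if "A \<in> S" "A' \<in> S" for A A'
    using \<phi>_prod[OF L L t t t] S(4) that by blast
  have Wd: "(norm (W A - W A'))\<^sup>2 \<le> 302 / min (\<phi> A) (\<phi> A')" if A: "A \<in> S" "A' \<in> S" for A A'
  proof -
    have ge: "\<phi> A \<ge> 1" "\<phi> A' \<ge> 1" using \<phi>_ge1 L A by auto
    have "B (A e0) (A' e0) \<le> 151 * max (\<phi> A) (\<phi> A')"
      using prod[OF S(3)[OF A(1)] A(2)] A L by (simp add: B_e0_e0_LO \<phi>_inv)
    then have "2 * B (A e0) (A' e0) / (\<phi> A * \<phi> A') \<le> 302 * max (\<phi> A) (\<phi> A') / (\<phi> A * \<phi> A')"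
      using ge by (intro divide_right_mono) auto
    also have "\<dots> = 302 / min (\<phi> A) (\<phi> A')" using ge by (simp add: min_def max_def)
    finally show ?thesis using W_diff_le[OF L L, OF A] by linarith
  qed
  have Gk: "1 \<le> real k + 1" for k by simp
  have "Cauchy (\<lambda>k. W (G k))"
  proof (rule Cauchy_sqI[of _ 302])
    fix N m n :: nat assume mn: "N \<le> m" "N \<le> n"
    have "(norm (W (G m) - W (G n)))\<^sup>2 \<le> 302 / min (\<phi> (G m)) (\<phi> (G n))" using Wd G by blast
    also have "\<dots> \<le> 302 / (real N + 1)"
      using mn G[of m] G[of n] by (intro divide_left_mono mult_pos_pos) (auto simp: min_def)
    finally show "(norm (W (G m) - W (G n)))\<^sup>2 \<le> 302 / (real N + 1)" .
  qed
  then obtain u where u: "(\<lambda>k. W (G k)) \<longlonglongrightarrow> u" using Cauchy_convergent convergent_def by blast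
  have inv0: "(\<lambda>k. K / (real k + 1)) \<longlonglongrightarrow> 0" for K :: real
    using LIMSEQ_Suc[OF lim_const_over_n[of K]] by (simp add: add.commute)
  have "u \<in> C"
  proof -
    have "(\<lambda>k. B (W (G k)) (W (G k))) \<longlonglongrightarrow> B u u" by (intro tendsto_intros u)
    moreover have "(\<lambda>k. B (W (G k)) (W (G k))) \<longlonglongrightarrow> 0"
    proof (rule tendsto_sandwich[OF _ _ tendsto_const inv0[of 1]])
      show "\<forall>\<^sub>F k in sequentially. 0 \<le> B (W (G k)) (W (G k))"
        using W_null L G by auto
      have "1 / (\<phi> (G k))\<^sup>2 \<le> 1 / (real k + 1)" for k
      proof (intro divide_left_mono)
        have "1 * (real k + 1) \<le> \<phi> (G k) * \<phi> (G k)"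
          using G[of k] by (intro mult_mono) auto
        then show "real k + 1 \<le> (\<phi> (G k))\<^sup>2" by (simp add: power2_eq_square)
        show "0 < (\<phi> (G k))\<^sup>2 * (real k + 1)" using G[of k] by (intro mult_pos_pos) auto
      qed simp
      then show "\<forall>\<^sub>F k in sequentially. B (W (G k)) (W (G k)) \<le> 1 / (real k + 1)"
        using W_null L G by auto
    qed
    ultimately have "B u u = 0" using LIMSEQ_unique by blast
    moreover have "(\<lambda>k. B (W (G k)) e0) \<longlonglongrightarrow> B u e0" by (intro tendsto_intros u)
    then have "B u e0 = 1" using W_B L G by (simp add: LIMSEQ_const_iff)
    ultimately show ?thesis by (simp add: C_def)
  qed
  moreover have "\<exists>c. A u = c *\<^sub>R u" if A: "A \<in> S" for A
  proof -
    have AG: "A \<circ> G k \<in> S" for k using S(4) A G by blast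
    have sc: "A (W (G k)) = B (A (W (G k))) e0 *\<^sub>R W (A \<circ> G k)" for k
      using LO_W L A G by blast
    \<comment> \<open>Cancelling \<open>A\<close> from \<open>A \<circ> G k\<close> and using the
      product bound shows that the translated sequence is displaced far, too.\<close>
    have ev: "\<phi> (A \<circ> G k) \<ge> (real k + 1) / 151" if "real k \<ge> 151 * \<phi> A" for k
    proof -
      have "fun_inv A \<circ> (A \<circ> G k) = G k" using LO_inv(4)[OF L[OF A]] by (simp add: o_assoc)
      then have "\<phi> (G k) \<le> 151 * max (\<phi> A) (\<phi> (A \<circ> G k))"
        using prod[OF S(3)[OF A] AG, of k] \<phi>_inv[OF L[OF A]] by simp
      then show ?thesis using G[of k] that by (auto simp: max_def split: if_splits)
    qed
    have "(\<lambda>k. W (A \<circ> G k) - W (G k)) \<longlonglongrightarrow> 0"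
    proof (rule tendsto_norm_zero_cancel, rule tendsto_sandwich[OF _ _ tendsto_const])
      show "(\<lambda>k. sqrt (302 * 151 / (real k + 1))) \<longlonglongrightarrow> 0"
        using tendsto_real_sqrt[OF inv0[of "302 * 151"]] by simp
      have nb: "norm (W (A \<circ> G k) - W (G k)) \<le> sqrt (302 * 151 / (real k + 1))" if "real k \<ge> 151 * \<phi> A" for k
      proof (rule real_le_rsqrt)
        have "(norm (W (A \<circ> G k) - W (G k)))\<^sup>2 \<le> 302 / min (\<phi> (A \<circ> G k)) (\<phi> (G k))"
          using Wd AG G by blast
        also have "\<dots> \<le> 302 / ((real k + 1) / 151)"
          using ev[OF that] G[of k] \<phi>_ge1[OF L[OF AG[of k]]]
          by (intro divide_left_mono mult_pos_pos) (auto simp: min_def)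
        finally show "(norm (W (A \<circ> G k) - W (G k)))\<^sup>2 \<le> 302 * 151 / (real k + 1)" by simp
      qed
      have "\<forall>\<^sub>F k in sequentially. 151 * \<phi> A \<le> real k"
        using filterlim_real_sequentially unfolding filterlim_at_top by blast
      then show "\<forall>\<^sub>F k in sequentially. norm (W (A \<circ> G k) - W (G k)) \<le> sqrt (302 * 151 / (real k + 1))"
        by (rule eventually_mono) (rule nb)
    qed simp
    from tendsto_add[OF this u] have WA: "(\<lambda>k. W (A \<circ> G k)) \<longlonglongrightarrow> u" by simp
    have AW: "(\<lambda>k. A (W (G k))) \<longlonglongrightarrow> A u" by (rule tendsto_LO[OF L[OF A] u])
    then have "(\<lambda>k. B (A (W (G k))) e0) \<longlonglongrightarrow> B (A u) e0" by (intro tendsto_intros)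
    from tendsto_scaleR[OF this WA] have "(\<lambda>k. A (W (G k))) \<longlonglongrightarrow> B (A u) e0 *\<^sub>R u"
      using sc by simp
    then show ?thesis using LIMSEQ_unique AW by blast
  qed
  ultimately show ?thesis by blast
qed

end

section \<open>Representations: translation lengths and the boundary map\<close>

text \<open>\<open>f\<close> gives an axis through \<open>e0\<close> and \<open>g\<close> a
  horospherical direction transverse to it. Room for \<open>g\<close> is what hyperbolic dimension
  at least two provides; the exponent is bounded by looking along the horocycle in this
  direction.\<close>

locale lorentz_frame = lorentz_space b for b :: "'m::real_inner" +
  fixes f g :: 'm
  assumes f: "inner f f = 1" "inner f e0 = 0"
    and g: "inner g g = 1" "inner g e0 = 0" "inner g f = 0"
begin

definition up where "up = (1 / sqrt 2) *\<^sub>R (e0 + f)"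
definition um where "um = (1 / sqrt 2) *\<^sub>R (e0 - f)"

lemma Bf: "B f f = -1" "B f e0 = 0" "B e0 f = 0"
  using f by (simp_all add: B_inner inner_commute)

lemma up_C: "up \<in> C" and um_C: "um \<in> C"
  by (simp_all add: up_def um_def C_def lorentz_simps Bf)

lemma up_um: "B up um = 1"
  by (simp add: up_def um_def lorentz_simps Bf)

lemma um_up: "B um up = 1"
  using up_um by (simp add: lorentz_commute)

lemma e0_up_um: "e0 = (1 / sqrt 2) *\<^sub>R (up + um)"
  by (simp add: up_def um_def scaleR_add_right[symmetric] scaleR_2[symmetric])

definition a where "a = boost up um"

lemma a_LO: "a s \<in> LO" and a_comp: "a s \<circ> a r = a (s + r)" and a_0: "a 0 = id"
  and a_up: "a s up = exp s *\<^sub>R up" and a_um: "a s um = exp (- s) *\<^sub>R um"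
  and a_pow: "a (real k * s) = a s ^^ k"
  and a_e0: "a s e0 = (exp s / sqrt 2) *\<^sub>R up + (exp (- s) / sqrt 2) *\<^sub>R um"
  and a_\<phi>: "\<phi> (a s) = cosh s"
proof -
  note h = up_C um_C up_um
  have m: "mid up um = e0" by (simp add: mid_def[OF h] e0_up_um)
  show "a s \<in> LO" unfolding a_def by (rule boost_LO[OF h])
  show "a s \<circ> a r = a (s + r)" unfolding a_def by (rule boost_comp[OF h])
  show "a 0 = id" unfolding a_def by (rule boost_0[OF h])
  show "a s up = exp s *\<^sub>R up" "a s um = exp (- s) *\<^sub>R um" unfolding a_def by (rule boost_u[OF h], rule boost_w[OF h])
  show "a (real k * s) = a s ^^ k" unfolding a_def by (rule boost_funpow[OF h])
  show "a s e0 = (exp s / sqrt 2) *\<^sub>R up + (exp (- s) / sqrt 2) *\<^sub>R um"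
    using boost_mid[OF h, of s] unfolding m a_def .
  show "\<phi> (a s) = cosh s" using boost_mid_B[OF h, of s] unfolding m a_def \<phi>_def .
qed

lemma a_inv: "fun_inv (a s) = a (- s)"
  using a_comp[of s "- s"] a_comp[of "- s" s]
  by (intro inv_unique_comp) (simp_all add: a_0)

lemma up_trans: assumes u: "u \<in> C" shows "\<exists>A\<in>LO. A up = u"
proof -
  have up0: "B up e0 > 0" "B u e0 > 0" using up_C u by (auto simp: C_def)
  define c where "c = B u e0 / B up e0"
  have c: "c > 0" using up0 by (simp add: c_def)
  have "B (c *\<^sub>R up) e0 = B u e0" using up0 by (simp add: c_def lorentz_simps)
  then obtain A where A: "A \<in> LO" "A (c *\<^sub>R up) = u"
    using refl_ex_C[OF C_scale[OF up_C c] u e0_H] by blast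
  have "(A \<circ> a (ln c)) up = u" using A(2) c by (simp add: a_up)
  then show ?thesis using LO_comp[OF A(1) a_LO] by blast
qed

text \<open>Boundary points in upper half-space coordinates with \<open>up\<close> at infinity,
  scaled to have product one with \<open>up\<close>. In this scale the form of two of them is half
  the squared Euclidean distance.\<close>

definition ux where "ux x = um + x *\<^sub>R g + (x\<^sup>2 / 2) *\<^sub>R up"

lemma Bg: "B g g = -1" "B g up = 0" "B g um = 0" "B up g = 0" "B um g = 0" "B g e0 = 0"
  using g by (simp_all add: B_inner up_def um_def inner_simps inner_commute)

lemma nulls: "B up up = 0" "B um um = 0" "B up e0 > 0" "B um e0 > 0"
  using up_C um_C by (auto simp: C_def)

lemma ux_ux: "B (ux x) (ux y) = (x - y)\<^sup>2 / 2"
  by (simp add: ux_def lorentz_simps Bg nulls up_um um_up power2_eq_square field_simps)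

lemma ux_up: "B (ux x) up = 1"
  by (simp add: ux_def lorentz_simps Bg nulls um_up)

lemma ux_C: "ux x \<in> C"
proof -
  have "B (ux x) e0 > 0"
    using nulls by (simp add: ux_def lorentz_simps Bg add_pos_nonneg)
  then show ?thesis using ux_ux[of x x] by (simp add: C_def)
qed

text \<open>For \<open>w\<close> orthogonal to \<open>up\<close> and \<open>um\<close>, the vector
  \<open>um + w + c *\<^sub>R up\<close> is isotropic for a suitable \<open>c\<close>, so
  \<open>w\<close> is a combination of isotropic vectors.\<close>

lemma span_C: "span C = UNIV"
proof -
  have uC: "up \<in> span C" "um \<in> span C" using up_C um_C by (auto intro: span_base)
  have "v \<in> span C" for v
  proof -
    define w where "w = v - B v um *\<^sub>R up - B v up *\<^sub>R um"
    have w: "B w up = 0" "B w um = 0" "B up w = 0" "B um w = 0"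
      by (simp_all add: w_def lorentz_simps nulls up_um um_up lorentz_commute[of b up v] lorentz_commute[of b um v])
    define c where "c = - B w w / 2"
    let ?u = "um + w + c *\<^sub>R up"
    have "B w w \<le> 0" by (rule null_orth[OF up_C w(1)])
    then have c: "c \<ge> 0" by (simp add: c_def)
    have "B w e0 = 0" unfolding e0_up_um by (simp add: lorentz_simps w)
    then have "B ?u e0 > 0" using nulls c by (simp add: lorentz_simps add_pos_nonneg)
    moreover have "B ?u ?u = 0" by (simp add: lorentz_simps w nulls up_um um_up c_def)
    ultimately have "?u \<in> span C" by (auto simp: C_def intro: span_base)
    then have "?u - um - c *\<^sub>R up \<in> span C" using uC by (intro span_diff span_scale)
    then have "w \<in> span C" by simp
    then have "w + B v um *\<^sub>R up + B v up *\<^sub>R um \<in> span C" using uC by (intro span_add span_scale)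
    then show ?thesis by (simp add: w_def)
  qed
  then show ?thesis by blast
qed

lemma C_linear_eq:
  assumes "linear h" "linear k" "\<And>u. u \<in> C \<Longrightarrow> h u = k u" shows "h v = k v"
  using linear_eq_on[OF assms(1,2), of v C] assms(3) span_C by blast

end

text \<open>A given action in linear form. Continuity enters as \<open>R_bdd\<close>, boundedness on
  sets of bounded displacement; non-elementarity enters as the absence of fixed points and of fixed
  isotropic rays.\<close>

locale hyp_rep = M: lorentz_frame b f g + N: complete_lorentz_space e
  for b :: "'m::real_inner" and f g and e :: "'h::{real_inner,complete_space}" +
  fixes R :: "('m \<Rightarrow> 'm) \<Rightarrow> 'h \<Rightarrow> 'h"
  assumes R_LO: "A \<in> M.LO \<Longrightarrow> R A \<in> N.LO"
    and R_comp: "A \<in> M.LO \<Longrightarrow> A' \<in> M.LO \<Longrightarrow> R (A \<circ> A') = R A \<circ> R A'"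
    and R_bdd: "\<exists>K. \<forall>A\<in>M.LO. M.\<phi> A \<le> r \<longrightarrow> N.\<phi> (R A) \<le> K"
    and no_fixed_point: "\<not> (\<exists>x\<in>N.H. \<forall>A\<in>M.LO. R A x = x)"
    and no_fixed_ray: "\<not> (\<exists>u\<in>N.C. \<forall>A\<in>M.LO. \<exists>c. R A u = c *\<^sub>R u)"
begin

abbreviation "up \<equiv> M.up"
abbreviation "um \<equiv> M.um"
abbreviation "a \<equiv> M.a"
abbreviation "ux \<equiv> M.ux"

lemmas up_C = M.up_C and um_C = M.um_C and up_um = M.up_um and um_up = M.um_up and e0_up_um = M.e0_up_um
  and a_LO = M.a_LO and a_comp = M.a_comp and a_up = M.a_up and a_um = M.a_um
  and a_pow = M.a_pow and a_e0 = M.a_e0 and a_\<phi> = M.a_\<phi> and a_inv = M.a_inv and up_trans = M.up_trans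
  and ux_C = M.ux_C and ux_ux = M.ux_ux and ux_up = M.ux_up and span_C = M.span_C
  and C_linear_eq = M.C_linear_eq

lemma R_id: "R id = id"
proof -
  have "R id \<circ> R id = R id" using R_comp[OF M.LO_id M.LO_id] by simp
  then show ?thesis using N.LO_inv(4)[OF R_LO[OF M.LO_id]] by (metis o_assoc id_comp)
qed

lemma R_inv: assumes A: "A \<in> M.LO" shows "R (fun_inv A) = fun_inv (R A)"
proof -
  note i = M.LO_inv(1)[OF A]
  have "R (fun_inv A) \<circ> R A = id" using R_comp[OF i A] M.LO_inv(4)[OF A] R_id by simp
  moreover have "R A \<circ> R (fun_inv A) = id" using R_comp[OF A i] M.LO_inv(5)[OF A] R_id by simp
  ultimately show ?thesis by (metis inv_unique_comp)
qed

lemma R_pow: assumes A: "A \<in> M.LO" shows "R (A ^^ k) = R A ^^ k"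
proof (induction k)
  case 0 then show ?case by (simp only: funpow_0 R_id funpow.simps)
next
  case (Suc k) then show ?case by (simp only: funpow.simps R_comp[OF A M.LO_funpow[OF A]])
qed

definition L where "L A = N.D (R A N.e0) N.e0"

lemma R_H: "A \<in> M.LO \<Longrightarrow> x \<in> N.H \<Longrightarrow> R A x \<in> N.H"
  using N.LO_H[OF R_LO] .

lemma L_comp: assumes A: "A \<in> M.LO" "A' \<in> M.LO" shows "L (A \<circ> A') \<le> L A + L A'"
proof -
  have "N.D (R A (R A' N.e0)) N.e0 \<le> N.D (R A (R A' N.e0)) (R A N.e0) + N.D (R A N.e0) N.e0"
    by (rule N.D_triangle) (simp_all add: R_H A)
  also have "N.D (R A (R A' N.e0)) (R A N.e0) = N.D (R A' N.e0) N.e0"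
    by (rule N.D_LO[OF R_LO[OF A(1)]]) (simp_all add: R_H A)
  finally show ?thesis by (simp add: L_def R_comp A)
qed

lemma cosh_L: "A \<in> M.LO \<Longrightarrow> cosh (L A) = N.\<phi> (R A)"
  by (simp add: L_def N.cosh_D R_H N.\<phi>_def)

lemma L_nonneg: "L A \<ge> 0"
  by (simp add: L_def)

lemma L_inv: assumes A: "A \<in> M.LO" shows "L (fun_inv A) = L A"
proof -
  have "cosh (L (fun_inv A)) = cosh (L A)"
    using A M.LO_inv(1)[OF A] by (simp add: cosh_L R_inv N.\<phi>_inv R_LO)
  then show ?thesis using L_nonneg by (metis arcosh_cosh_real)
qed

lemma L_bdd: "\<exists>K. \<forall>A\<in>M.LO. M.\<phi> A \<le> r \<longrightarrow> L A \<le> K"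
proof -
  obtain K where K: "\<And>A. A \<in> M.LO \<Longrightarrow> M.\<phi> A \<le> r \<Longrightarrow> N.\<phi> (R A) \<le> K" using R_bdd by blast
  have "L A \<le> 2 * K" if "A \<in> M.LO" "M.\<phi> A \<le> r" for A
  proof -
    have "1 + L A \<le> exp (L A)" by (rule exp_ge_add_one_self)
    also have "\<dots> \<le> 2 * N.\<phi> (R A)" using N.B_le_exp_D(2)[OF R_H[OF that(1) N.e0_H] N.e0_H] by (simp add: L_def N.\<phi>_def)
    finally show ?thesis using K[OF that] by simp
  qed
  then show ?thesis by blast
qed

text \<open>Cartan decomposition \<open>A = k \<circ> a j \<circ> h\<close> with \<open>k\<close>
  fixing \<open>e0\<close>. Only the integer part \<open>j\<close> of the displacement is kept,
  because stable lengths speak about powers of \<open>a 1\<close>; boundedness of \<open>L\<close>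
  disposes of \<open>k\<close> and \<open>h\<close>.\<close>

lemma L_coarse:
  obtains K where "K \<ge> 0" "\<And>A. A \<in> M.LO \<Longrightarrow> \<bar>L A - L (a (real (nat \<lfloor>M.D (A M.e0) M.e0\<rfloor>)))\<bar> \<le> K"
proof -
  obtain K where K: "\<And>A. A \<in> M.LO \<Longrightarrow> M.\<phi> A \<le> cosh 1 \<Longrightarrow> L A \<le> K" using L_bdd by blast
  have "\<bar>L A - L (a (real (nat \<lfloor>M.D (A M.e0) M.e0\<rfloor>)))\<bar> \<le> 2 * K" if A: "A \<in> M.LO" for A
  proof -
    define s where "s = M.D (A M.e0) M.e0"
    define j where "j = real (nat \<lfloor>s\<rfloor>)"
    have s: "s \<ge> 0" by (simp add: s_def)
    then have j: "j \<le> s" "s < j + 1" unfolding j_def by linarith+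
    let ?x = "A M.e0" and ?y = "a s M.e0"
    have xy: "?x \<in> M.H" "?y \<in> M.H" using M.LO_H a_LO A by auto
    have eq: "M.B M.e0 ?x = M.B M.e0 ?y"
      using a_\<phi>[of s] M.cosh_D[OF xy(1) M.e0_H] by (simp add: s_def M.\<phi>_def lorentz_commute)
    obtain k where k: "k \<in> M.LO" "k ?y = ?x" "k M.e0 = M.e0"
      using M.refl_ex_H[OF xy] eq by metis
    \<comment> \<open>\<open>h\<close> collects the right-hand compact factor and the fractional
      part of the translation; its displacement is \<open>cosh (s - j) \<le> cosh 1\<close>.\<close>
    define h where "h = fun_inv (k \<circ> a j) \<circ> A"
    have ka: "k \<circ> a j \<in> M.LO" by (rule M.LO_comp[OF k(1) a_LO])
    have h: "h \<in> M.LO" unfolding h_def by (rule M.LO_comp[OF M.LO_inv(1)[OF ka] A])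
    have "M.\<phi> h = M.B (k (a j M.e0)) (A M.e0)"
      using M.B_e0_e0_LO[OF ka A] by (simp add: h_def)
    also have "\<dots> = M.B (a j M.e0) (a s M.e0)" by (simp only: k(2)[symmetric] M.LO_B[OF k(1)])
    also have "\<dots> = cosh (s - j)"
      using M.B_e0_e0_LO[OF a_LO a_LO, of j s] by (simp add: a_inv a_comp a_\<phi>)
    also have "\<dots> \<le> cosh 1" using j by (subst cosh_real_nonneg_le_iff) auto
    finally have Kh: "L h \<le> K" using K h by blast
    have "M.\<phi> k \<le> cosh 1" using k(3) cosh_real_ge_1 by (simp add: M.\<phi>_def)
    then have Kk: "L k \<le> K" using K k by blast
    have Ah: "A = (k \<circ> a j) \<circ> h" unfolding h_def o_assoc using M.LO_inv(5)[OF ka] by simp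
    have "L A \<le> (L k + L (a j)) + L h"
      using L_comp[OF ka h] L_comp[OF k(1) a_LO, of j] unfolding Ah[symmetric] by linarith
    moreover have "a j = fun_inv k \<circ> (A \<circ> fun_inv h)"
    proof -
      have "A \<circ> fun_inv h = k \<circ> a j" using M.LO_inv(5)[OF h] by (subst Ah) (simp add: o_assoc[symmetric])
      then show ?thesis using M.LO_inv(4)[OF k(1)] by (simp add: o_assoc)
    qed
    then have "L (a j) \<le> L k + (L A + L h)"
      using L_comp[OF M.LO_inv(1)[OF k(1)] M.LO_comp[OF A M.LO_inv(1)[OF h]]]
        L_comp[OF A M.LO_inv(1)[OF h]] L_inv[OF k(1)] L_inv[OF h] by simp
    ultimately show ?thesis using Kh Kk unfolding s_def[symmetric] j_def[symmetric] by linarith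
  qed
  moreover have "2 * K \<ge> 0" using K[OF M.LO_id] L_nonneg[of id] by (simp add: M.\<phi>_def cosh_real_ge_1)
  ultimately show ?thesis using that by blast
qed

definition \<tau> where "\<tau> = N.tlen (R (a 1))"

lemma L_a: "L (a (real k)) = N.D ((R (a 1) ^^ k) N.e0) N.e0"
  using a_pow[of k 1] R_pow[OF a_LO[of 1], of k] by (simp add: L_def)

text \<open>\<open>L_coarse\<close> compares \<open>R (A ^^ m)\<close> with the power of
  \<open>R (a 1)\<close> whose exponent is the integer part of the displacement of
  \<open>A ^^ m\<close>; division by \<open>m\<close> turns both sides into stable lengths.\<close>

theorem tlen_R: assumes A: "A \<in> M.LO" shows "N.tlen (R A) = \<tau> * M.tlen A"
proof -
  have *: "\<bar>N.tlen (R A) - \<tau> * M.tlen A\<bar> \<le> \<epsilon> * M.tlen A" if \<epsilon>: "\<epsilon> > 0" for \<epsilon>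
  proof -
    obtain K1 where K1: "K1 \<ge> 0" "\<And>k. \<bar>L (a (real k)) - real k * \<tau>\<bar> \<le> real k * \<epsilon> + K1"
      using N.stable_length[OF R_LO[OF a_LO] \<epsilon>, of 1] unfolding L_a \<tau>_def by blast
    obtain K2 where K2: "\<And>A. A \<in> M.LO \<Longrightarrow> \<bar>L A - L (a (real (nat \<lfloor>M.D (A M.e0) M.e0\<rfloor>)))\<bar> \<le> K2"
      using L_coarse by metis
    define s where "s m = M.D ((A ^^ m) M.e0) M.e0" for m
    define K where "K = K1 + K2 + \<tau>"
    have t0: "\<tau> \<ge> 0" by (simp add: \<tau>_def)
    have bd: "\<bar>L (A ^^ m) - s m * \<tau>\<bar> \<le> s m * \<epsilon> + K" for m
    proof -
      let ?j = "real (nat \<lfloor>s m\<rfloor>)"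
      have "s m \<ge> 0" by (simp add: s_def)
      then have j: "?j \<le> s m" "s m < ?j + 1" by linarith+
      have "?j * \<epsilon> \<le> s m * \<epsilon>" "?j * \<tau> \<le> s m * \<tau>" "s m * \<tau> \<le> (?j + 1) * \<tau>"
        using j \<epsilon> t0 by (auto intro!: mult_right_mono)
      moreover have "(?j + 1) * \<tau> = ?j * \<tau> + \<tau>" by (simp add: distrib_right)
      ultimately show ?thesis
        using K1(2)[of "nat \<lfloor>s m\<rfloor>"] K2[OF M.LO_funpow[OF A], of m] t0 unfolding s_def[symmetric] K_def by linarith
    qed
    have s1: "(\<lambda>m. s m / real m) \<longlonglongrightarrow> M.tlen A" unfolding s_def by (rule M.stable_length_lim[OF A])
    have s2: "(\<lambda>m. L (A ^^ m) / real m) \<longlonglongrightarrow> N.tlen (R A)"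
      using N.stable_length_lim[OF R_LO[OF A]] by (simp add: L_def R_pow[OF A])
    have l1: "(\<lambda>m. \<bar>L (A ^^ m) / real m - (s m / real m) * \<tau>\<bar>) \<longlonglongrightarrow> \<bar>N.tlen (R A) - M.tlen A * \<tau>\<bar>"
      by (intro tendsto_intros s1 s2)
    have l2: "(\<lambda>m. (s m / real m) * \<epsilon> + K / real m) \<longlonglongrightarrow> M.tlen A * \<epsilon> + 0"
      by (intro tendsto_intros s1 lim_const_over_n)
    have "\<bar>L (A ^^ m) / real m - (s m / real m) * \<tau>\<bar> \<le> (s m / real m) * \<epsilon> + K / real m" for m
    proof -
      have "\<bar>L (A ^^ m) / real m - (s m / real m) * \<tau>\<bar> = \<bar>L (A ^^ m) - s m * \<tau>\<bar> / real m"
        by (simp add: diff_divide_distrib[symmetric] abs_divide)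
      also have "\<dots> \<le> (s m * \<epsilon> + K) / real m" using bd by (rule divide_right_mono) simp
      finally show ?thesis by (simp add: add_divide_distrib)
    qed
    then have "\<bar>N.tlen (R A) - M.tlen A * \<tau>\<bar> \<le> M.tlen A * \<epsilon> + 0"
      using LIMSEQ_le[OF l1 l2] by blast
    then show ?thesis by (simp add: mult.commute)
  qed
  have "\<bar>N.tlen (R A) - \<tau> * M.tlen A\<bar> \<le> 0 + \<epsilon>" if "\<epsilon> > 0" for \<epsilon>
  proof -
    have "M.tlen A + 1 > 0" using M.tlen_nonneg[of A] by linarith
    then have "\<epsilon> / (M.tlen A + 1) > 0" using that by simp
    from *[OF this] have "\<bar>N.tlen (R A) - \<tau> * M.tlen A\<bar> \<le> \<epsilon> * (M.tlen A / (M.tlen A + 1))" by simp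
    also have "\<dots> \<le> \<epsilon> * 1" using that \<open>M.tlen A + 1 > 0\<close> by (intro mult_left_mono) (auto simp: divide_le_eq)
    finally show ?thesis by simp
  qed
  then have "\<bar>N.tlen (R A) - \<tau> * M.tlen A\<bar> \<le> 0" by (rule field_le_epsilon)
  then show ?thesis by simp
qed

lemma \<tau>_pos: "\<tau> > 0"
proof (rule ccontr)
  assume "\<not> \<tau> > 0"
  then have t: "\<tau> = 0" using N.tlen_nonneg[of "R (a 1)"] by (simp add: \<tau>_def)
  have "(\<exists>x\<in>N.H. \<forall>A\<in>R ` M.LO. A x = x) \<or> (\<exists>u\<in>N.C. \<forall>A\<in>R ` M.LO. \<exists>c. A u = c *\<^sub>R u)"
  proof (rule N.zero_length_elementary)
    show "R ` M.LO \<subseteq> N.LO" using R_LO by blast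
    show "id \<in> R ` M.LO" by (rule image_eqI[of _ _ id]) (simp_all add: R_id M.LO_id)
    fix A assume "A \<in> R ` M.LO"
    then obtain G where G: "G \<in> M.LO" "A = R G" by blast
    show "fun_inv A \<in> R ` M.LO" unfolding G(2) R_inv[OF G(1), symmetric] by (rule imageI[OF M.LO_inv(1)[OF G(1)]])
    show "N.tlen A = 0" unfolding G(2) tlen_R[OF G(1)] t by simp
    fix A' assume "A' \<in> R ` M.LO"
    then obtain G' where G': "G' \<in> M.LO" "A' = R G'" by blast
    show "A \<circ> A' \<in> R ` M.LO" unfolding G(2) G'(2) R_comp[OF G(1) G'(1), symmetric] by (rule imageI[OF M.LO_comp[OF G(1) G'(1)]])
  qed
  then show False using no_fixed_point no_fixed_ray by auto
qed

end

section \<open>The attracting boundary point of a one-parameter group\<close>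

lemma Cauchy_summable_steps:
  fixes X :: "nat \<Rightarrow> 'a::real_normed_vector"
  assumes le: "\<And>k. norm (X (Suc k) - X k) \<le> g k" and g: "summable g"
  shows "Cauchy X"
proof (rule CauchyI')
  have st: "norm (X n - X m) \<le> sum g {m..<n}" if "m \<le> n" for m n
    using that
  proof (induction n rule: dec_induct)
    case (step n)
    have "norm (X (Suc n) - X m) \<le> norm (X (Suc n) - X n) + norm (X n - X m)"
      using norm_triangle_ineq[of "X (Suc n) - X n" "X n - X m"] by simp
    then show ?case using step le[of n] by simp
  qed simp
  fix \<epsilon> :: real assume "\<epsilon> > 0"
  then obtain N where N: "\<And>m n. m \<ge> N \<Longrightarrow> norm (sum g {m..<n}) < \<epsilon>"
    using g unfolding summable_Cauchy by blast
  have "dist (X m) (X n) < \<epsilon>" if "m \<ge> N" "n > m" for m n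
    using st[of m n] N[OF that(1), of n] that by (simp add: dist_norm norm_minus_commute)
  then show "\<exists>M. \<forall>m\<ge>M. \<forall>n>m. dist (X m) (X n) < \<epsilon>" by blast
qed

context hyp_rep begin

definition Wa where "Wa k = N.W (R (a (real k)))"

abbreviation \<phi>a where "\<phi>a k \<equiv> N.\<phi> (R (a (real k)))"

text \<open>Half of the stable length is given away to obtain a clean exponential lower bound; it
  grows because \<open>\<tau>\<close> is positive.\<close>

lemma \<phi>a_growth: obtains c where "c > 0" "\<And>k. \<phi>a k \<ge> c * exp (\<tau> / 2) ^ k"
proof -
  obtain K where K: "\<And>k. \<bar>L (a (real k)) - real k * \<tau>\<bar> \<le> real k * (\<tau> / 2) + K"
    using N.stable_length[OF R_LO[OF a_LO], of "\<tau> / 2" 1] \<tau>_pos unfolding L_a \<tau>_def by auto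
  have "exp (- K) / 2 * exp (\<tau> / 2) ^ k \<le> \<phi>a k" for k
  proof -
    have "exp (- K) * exp (\<tau> / 2) ^ k = exp (real k * (\<tau> / 2) - K)"
      by (simp add: exp_of_nat_mult[symmetric] exp_add[symmetric])
    also have "\<dots> \<le> exp (L (a (real k)))" using K[of k] by (simp add: abs_le_iff)
    also have "\<dots> \<le> 2 * cosh (L (a (real k)))" by (simp add: cosh_def)
    finally show ?thesis by (simp add: cosh_L a_LO)
  qed
  then show ?thesis using that[of "exp (- K) / 2"] by simp
qed

lemma \<phi>a_at_top: "filterlim \<phi>a at_top sequentially"
proof -
  obtain c where c: "c > 0" "\<And>k. \<phi>a k \<ge> c * exp (\<tau> / 2) ^ k" using \<phi>a_growth by blast
  have "filterlim (\<lambda>k. exp (\<tau> / 2 * real k)) at_top sequentially"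
    by (rule filterlim_compose[OF exp_at_top filterlim_tendsto_pos_mult_at_top[OF tendsto_const _ filterlim_real_sequentially]])
      (use \<tau>_pos in simp)
  then have "filterlim (\<lambda>k. exp (\<tau> / 2) ^ k) at_top sequentially"
    by (simp only: exp_of_nat2_mult)
  then have "filterlim (\<lambda>k. c * exp (\<tau> / 2) ^ k) at_top sequentially"
    by (rule filterlim_tendsto_pos_mult_at_top[OF tendsto_const c(1)])
  then show ?thesis by (rule filterlim_at_top_mono) (simp add: c(2))
qed

lemma \<phi>a_ge1: "\<phi>a k \<ge> 1"
  by (rule N.\<phi>_ge1[OF R_LO[OF a_LO]])

text \<open>Consecutive orbit points are at constant distance while the displacements grow
  exponentially, so \<open>W_diff_le\<close> dominates the steps by a geometric series.\<close>

lemma convergent_Wa: "convergent Wa"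
proof -
  obtain c where c: "c > 0" "\<And>k. \<phi>a k \<ge> c * exp (\<tau> / 2) ^ k" using \<phi>a_growth by blast
  define r where "r = exp (\<tau> / 2)"
  have r: "r > 1" using \<tau>_pos by (simp add: r_def)
  define K where "K = sqrt (2 * N.\<phi> (R (a 1))) / c"
  have "norm (Wa (Suc k) - Wa k) \<le> K * (1 / r) ^ k" for k
  proof (rule power2_le_imp_le)
    have "N.B (R (a (real (Suc k))) N.e0) (R (a (real k)) N.e0) = N.\<phi> (R (a 1))"
      using N.B_e0_e0_LO[OF R_LO[OF a_LO] R_LO[OF a_LO], of "real (Suc k)" "real k"]
      by (simp add: R_inv[OF a_LO, symmetric] R_comp[OF a_LO a_LO, symmetric] a_inv a_comp
          N.\<phi>_inv[OF R_LO[OF a_LO], of 1, symmetric])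
    then have "(norm (Wa (Suc k) - Wa k))\<^sup>2 \<le> 2 * N.\<phi> (R (a 1)) / (\<phi>a (Suc k) * \<phi>a k)"
      using N.W_diff_le[OF R_LO[OF a_LO] R_LO[OF a_LO], of "real (Suc k)" "real k"] by (simp add: Wa_def)
    also have "\<dots> \<le> 2 * N.\<phi> (R (a 1)) / ((c * r ^ k) * (c * r ^ k))"
    proof (intro divide_left_mono mult_mono mult_pos_pos)
      have "c * r ^ k \<le> c * r ^ Suc k" using r c by (simp add: mult_left_mono)
      then show "c * r ^ k \<le> \<phi>a (Suc k)" using c(2)[of "Suc k"] by (simp add: r_def)
    qed (use c r \<phi>a_ge1[of k] \<phi>a_ge1[of "Suc k"] \<phi>a_ge1[of 1] in \<open>auto simp: r_def\<close>)
    also have "\<dots> = (K * (1 / r) ^ k)\<^sup>2"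
      using \<phi>a_ge1[of 1] by (simp add: K_def power2_eq_square power_divide)
    finally show "(norm (Wa (Suc k) - Wa k))\<^sup>2 \<le> (K * (1 / r) ^ k)\<^sup>2" .
    show "0 \<le> K * (1 / r) ^ k" using c r \<phi>a_ge1[of 1] by (simp add: K_def)
  qed
  note le = this
  have "summable (\<lambda>k. K * (1 / r) ^ k)" using r by (intro summable_mult summable_geometric) simp
  from Cauchy_summable_steps[OF le this] show ?thesis by (rule Cauchy_convergent)
qed

definition \<xi> where "\<xi> = lim Wa"

lemma Wa_lim: "Wa \<longlonglongrightarrow> \<xi>"
  using convergent_Wa unfolding \<xi>_def convergent_LIMSEQ_iff .

lemma inverse_\<phi>a: "(\<lambda>k. K / \<phi>a k) \<longlonglongrightarrow> 0"
  using tendsto_mult_right_zero[OF tendsto_inverse_0_at_top[OF \<phi>a_at_top], of K] by (simp add: divide_inverse)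

lemma \<xi>_e0: "N.B \<xi> N.e0 = 1"
proof -
  have "(\<lambda>k. N.B (Wa k) N.e0) \<longlonglongrightarrow> N.B \<xi> N.e0" by (intro N.tendsto_B Wa_lim tendsto_const)
  then show ?thesis using N.W_B[OF R_LO[OF a_LO]] by (simp add: Wa_def LIMSEQ_const_iff)
qed

lemma \<xi>_C: "\<xi> \<in> N.C"
proof -
  have "(\<lambda>k. N.B (Wa k) (Wa k)) \<longlonglongrightarrow> N.B \<xi> \<xi>" by (intro N.tendsto_B Wa_lim)
  moreover have "(\<lambda>k. N.B (Wa k) (Wa k)) \<longlonglongrightarrow> 0"
    using tendsto_mult[OF inverse_\<phi>a[of 1] inverse_\<phi>a[of 1]]
    by (simp add: Wa_def N.W_null[OF R_LO[OF a_LO]] power2_eq_square)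
  ultimately have "N.B \<xi> \<xi> = 0" using LIMSEQ_unique by blast
  then show ?thesis by (simp add: N.C_def \<xi>_e0)
qed

text \<open>
  The directions of two orbit points at bounded distance have the same limit as the points tend
  to infinity; this is why the stabiliser of a boundary point fixes the limit.
\<close>

lemma W_lim_eq:
  assumes G: "\<And>k. G k \<in> M.LO" and bd: "\<And>k. M.\<phi> (fun_inv (a (real k)) \<circ> G k) \<le> r"
  shows "(\<lambda>k. N.W (R (G k))) \<longlonglongrightarrow> \<xi>"
proof -
  obtain K where K: "\<And>A. A \<in> M.LO \<Longrightarrow> M.\<phi> A \<le> r \<Longrightarrow> N.\<phi> (R A) \<le> K" using R_bdd by blast
  have "(\<lambda>k. N.W (R (G k)) - Wa k) \<longlonglongrightarrow> 0"
  proof (rule tendsto_norm_zero_cancel, rule tendsto_sandwich[OF _ _ tendsto_const])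
    show "(\<lambda>k. sqrt (2 * K / \<phi>a k)) \<longlonglongrightarrow> 0" using tendsto_real_sqrt[OF inverse_\<phi>a[of "2 * K"]] by simp
    have "norm (N.W (R (G k)) - Wa k) \<le> sqrt (2 * K / \<phi>a k)" for k
    proof (rule real_le_rsqrt)
      have h: "fun_inv (a (real k)) \<circ> G k \<in> M.LO" by (rule M.LO_comp[OF M.LO_inv(1)[OF a_LO] G])
      have "N.B (R (G k) N.e0) (R (a (real k)) N.e0) = N.\<phi> (R (fun_inv (a (real k)) \<circ> G k))"
        using N.B_e0_e0_LO[OF R_LO[OF a_LO] R_LO[OF G]]
        by (simp add: lorentz_commute[of e "R (G k) N.e0"] R_comp[OF M.LO_inv(1)[OF a_LO] G] R_inv[OF a_LO])
      then have le: "N.B (R (G k) N.e0) (R (a (real k)) N.e0) \<le> K" using K[OF h bd] by simp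
      have g1: "N.\<phi> (R (G k)) \<ge> 1" using N.\<phi>_ge1 R_LO G by blast
      have K0: "K \<ge> 0" using K[OF h bd] N.\<phi>_ge1[OF R_LO[OF h]] by linarith
      have "(norm (N.W (R (G k)) - Wa k))\<^sup>2 \<le> 2 * N.B (R (G k) N.e0) (R (a (real k)) N.e0) / (N.\<phi> (R (G k)) * \<phi>a k)"
        unfolding Wa_def by (rule N.W_diff_le[OF R_LO[OF G] R_LO[OF a_LO]])
      also have "\<dots> \<le> 2 * K / (N.\<phi> (R (G k)) * \<phi>a k)"
        using le g1 \<phi>a_ge1[of k] by (intro divide_right_mono) auto
      also have "\<dots> \<le> 2 * K / (1 * \<phi>a k)"
        using g1 \<phi>a_ge1[of k] K0 by (intro divide_left_mono mult_right_mono mult_pos_pos) auto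
      finally show "(norm (N.W (R (G k)) - Wa k))\<^sup>2 \<le> 2 * K / \<phi>a k" by simp
    qed
    then show "\<forall>\<^sub>F k in sequentially. norm (N.W (R (G k)) - Wa k) \<le> sqrt (2 * K / \<phi>a k)" by simp
  qed simp
  from tendsto_add[OF this Wa_lim] show ?thesis by simp
qed

section \<open>The character of a boundary stabiliser and the equivariant boundary map\<close>

lemma a_e0_B:
  assumes q: "q \<in> M.LO" and u: "q up = l *\<^sub>R up"
  shows "M.B (q (a s M.e0)) (a s M.e0) = (l + M.B (q um) up + exp (- 2 * s) * M.B (q um) um) / 2"
proof -
  have n: "M.B up up = 0" using up_C by (simp add: M.C_def)
  have q': "q (a s M.e0) = (exp s / sqrt 2 * l) *\<^sub>R up + (exp (- s) / sqrt 2) *\<^sub>R q um"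
    by (simp add: a_e0 M.LO_add[OF q] M.LO_scale[OF q] u)
  have "exp s * exp (- s) = 1" "exp (- s) * exp (- s) = exp (- 2 * s)"
    by (simp_all add: exp_add[symmetric])
  note ee = this
  have gen: "M.B ((r / sqrt 2 * l) *\<^sub>R up + (t / sqrt 2) *\<^sub>R w) ((r / sqrt 2) *\<^sub>R up + (t / sqrt 2) *\<^sub>R um)
      = (r * t * l + r * t * M.B w up + t * t * M.B w um) / 2" for r t w
    by (simp add: lorentz_simps n up_um field_simps)
  show ?thesis unfolding q' unfolding a_e0 gen ee by simp
qed

lemma stabilizer_eigen:
  assumes q: "q \<in> M.LO" and u: "q up = l *\<^sub>R up"
  shows "\<exists>c. R q \<xi> = c *\<^sub>R \<xi>"
proof -
  have qa: "q \<circ> a (real k) \<in> M.LO" for k by (rule M.LO_comp[OF q a_LO])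
  have p: "M.B (q um) um \<ge> 0" by (rule M.B_null_prod(1)[OF M.LO_C[OF q um_C] um_C])
  \<comment> \<open>By \<open>a_e0_B\<close> the points \<open>q (a (real k) e0)\<close> and
    \<open>a (real k) e0\<close> stay at bounded distance, the decaying exponential being multiplied
    by a non-negative product; their directions have the same limit.\<close>
  have "M.\<phi> (fun_inv (a (real k)) \<circ> (q \<circ> a (real k))) \<le> (l + M.B (q um) up + M.B (q um) um) / 2" for k
  proof -
    have "M.\<phi> (fun_inv (a (real k)) \<circ> (q \<circ> a (real k))) = M.B (q (a (real k) M.e0)) (a (real k) M.e0)"
      using M.B_e0_e0_LO[OF a_LO qa, of "real k" k] by (simp add: lorentz_commute)
    also have "\<dots> \<le> (l + M.B (q um) up + 1 * M.B (q um) um) / 2"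
      unfolding a_e0_B[OF assms] using p by (intro divide_right_mono add_left_mono mult_right_mono) auto
    finally show ?thesis by simp
  qed
  then have l: "(\<lambda>k. N.W (R q \<circ> R (a (real k)))) \<longlonglongrightarrow> \<xi>"
    using W_lim_eq[of "\<lambda>k. q \<circ> a (real k)", OF qa] unfolding R_comp[OF q a_LO] by blast
  have AW: "(\<lambda>k. R q (Wa k)) \<longlonglongrightarrow> R q \<xi>" by (rule N.tendsto_LO[OF R_LO[OF q] Wa_lim])
  then have "(\<lambda>k. N.B (R q (Wa k)) N.e0) \<longlonglongrightarrow> N.B (R q \<xi>) N.e0" by (intro N.tendsto_B tendsto_const)
  from tendsto_scaleR[OF this l] have "(\<lambda>k. R q (Wa k)) \<longlonglongrightarrow> N.B (R q \<xi>) N.e0 *\<^sub>R \<xi>"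
    unfolding Wa_def by (simp only: N.LO_W[OF R_LO[OF q] R_LO[OF a_LO], symmetric])
  then show ?thesis using LIMSEQ_unique AW by blast
qed

text \<open>The character by which the stabiliser of the ray of \<open>up\<close> acts on
  \<open>\<xi>\<close>. The choice is meaningful on that stabiliser, where the factor exists and is
  unique.\<close>

definition \<eta> where "\<eta> q = (SOME c. R q \<xi> = c *\<^sub>R \<xi>)"

lemma \<eta>: assumes q: "q \<in> M.LO" and u: "q up = l *\<^sub>R up"
  shows "R q \<xi> = \<eta> q *\<^sub>R \<xi>" "\<eta> q > 0" "\<bar>ln (\<eta> q)\<bar> \<le> \<tau> * M.tlen q"
proof -
  show 1: "R q \<xi> = \<eta> q *\<^sub>R \<xi>" unfolding \<eta>_def using stabilizer_eigen[OF assms] by (rule someI_ex)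
  show "\<eta> q > 0" "\<bar>ln (\<eta> q)\<bar> \<le> \<tau> * M.tlen q"
    using N.eigen_le_tlen[OF R_LO[OF q] \<xi>_C 1] tlen_R[OF q] by auto
qed

lemma \<eta>_eqI: "R q \<xi> = c *\<^sub>R \<xi> \<Longrightarrow> \<eta> q = c"
  unfolding \<eta>_def using N.C_nz[OF \<xi>_C] by (intro some_equality) auto

lemma \<eta>_comp:
  assumes "q \<in> M.LO" "q up = l *\<^sub>R up" "q' \<in> M.LO" "q' up = l' *\<^sub>R up"
  shows "\<eta> (q \<circ> q') = \<eta> q * \<eta> q'"
  by (rule \<eta>_eqI) (simp add: R_comp assms \<eta>(1)[OF assms(1,2)] \<eta>(1)[OF assms(3,4)] N.LO_scale[OF R_LO[OF assms(1)]])

text \<open>As \<open>s\<close> grows, \<open>q\<close> moves \<open>a s e0\<close> by a distance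
  tending to zero. Its translation length therefore vanishes, and with it the bound on
  \<open>\<bar>ln (\<eta> q)\<bar>\<close>; elliptic and parabolic elements are treated
  alike.\<close>

lemma \<eta>_fix: assumes q: "q \<in> M.LO" and u: "q up = up" shows "\<eta> q = 1"
proof -
  have u1: "q up = 1 *\<^sub>R up" using u by simp
  have um1: "M.B (q um) up = 1" using M.LO_B[OF q, of um up] by (simp add: u um_up)
  let ?k = "M.B (q um) um"
  have "cosh (M.tlen q) \<le> 1 + ?k / 2 * exp (- 2 * s)" for s
  proof -
    have x: "a s M.e0 \<in> M.H" by (rule M.LO_H[OF a_LO M.e0_H])
    have "cosh (M.tlen q) \<le> cosh (M.D (q (a s M.e0)) (a s M.e0))"
      using M.tlen_le[OF x, of q] by (subst cosh_real_nonneg_le_iff) auto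
    also have "\<dots> = M.B (q (a s M.e0)) (a s M.e0)" by (rule M.cosh_D[OF M.LO_H[OF q x] x])
    also have "\<dots> = 1 + ?k / 2 * exp (- 2 * s)" unfolding a_e0_B[OF q u1] um1 by simp
    finally show ?thesis .
  qed
  note le = this
  have lim: "((\<lambda>s. 1 + ?k / 2 * exp (- 2 * s)) \<longlongrightarrow> 1 + ?k / 2 * 0) at_top"
    by (intro tendsto_intros filterlim_compose[OF exp_at_bot] filterlim_tendsto_neg_mult_at_bot[OF tendsto_const] filterlim_ident) simp
  have "cosh (M.tlen q) \<le> 1 + ?k / 2 * 0"
    by (rule tendsto_lowerbound[OF lim]) (simp_all only: le eventually_True trivial_limit_at_top_linorder, simp)
  then have "cosh (M.tlen q) \<le> 1" by simp
  then have "M.tlen q = 0" using cosh_real_nonneg_le_iff[of "M.tlen q" 0] M.tlen_nonneg[of q] by simp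
  then have "ln (\<eta> q) = 0" using \<eta>(3)[OF q u1] by simp
  then show ?thesis using \<eta>(2)[OF q u1] by simp
qed

text \<open>The quotients \<open>\<phi>a (Suc k) / \<phi>a k\<close> converge to
  \<open>\<eta> (a 1)\<close>. A limit below \<open>exp \<tau>\<close> would make the displacements
  grow at an exponential rate smaller than the stable length.\<close>

lemma \<eta>_a1: "ln (\<eta> (a 1)) \<ge> \<tau>"
proof (rule ccontr)
  assume "\<not> ?thesis"
  then obtain \<rho> where \<rho>: "ln (\<eta> (a 1)) < \<rho>" "\<rho> < \<tau>" using dense not_le by blast
  note X = \<eta>[OF a_LO a_up, of 1]
  have lt: "\<eta> (a 1) < exp \<rho>" using \<rho>(1) X(2) by (metis exp_less_mono exp_ln)
  have "(\<lambda>k. N.B (R (a 1) (Wa k)) N.e0) \<longlonglongrightarrow> N.B (R (a 1) \<xi>) N.e0"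
    by (intro N.tendsto_B N.tendsto_LO[OF R_LO[OF a_LO]] Wa_lim tendsto_const)
  moreover have "N.B (R (a 1) (Wa k)) N.e0 = \<phi>a (Suc k) / \<phi>a k" for k
    by (simp add: Wa_def N.W_def N.LO_scale[OF R_LO[OF a_LO]] lorentz_simps N.\<phi>_def a_comp[symmetric] R_comp a_LO)
  ultimately have "(\<lambda>k. \<phi>a (Suc k) / \<phi>a k) \<longlonglongrightarrow> \<eta> (a 1)" by (simp add: X(1) lorentz_simps \<xi>_e0)
  then have "\<forall>\<^sub>F k in sequentially. \<phi>a (Suc k) / \<phi>a k < exp \<rho>" using lt by (rule order_tendstoD)
  then obtain k0 where k0: "\<And>k. k \<ge> k0 \<Longrightarrow> \<phi>a (Suc k) / \<phi>a k < exp \<rho>" unfolding eventually_sequentially by blast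
  have st: "\<phi>a (Suc k) \<le> exp \<rho> * \<phi>a k" if "k \<ge> k0" for k
    using k0[OF that] \<phi>a_ge1[of k] by (simp add: divide_less_eq)
  have gr: "\<phi>a (k0 + k) \<le> exp (\<rho> * real k) * \<phi>a k0" for k
  proof (induction k)
    case (Suc k)
    have "\<phi>a (k0 + Suc k) \<le> exp \<rho> * \<phi>a (k0 + k)" using st[of "k0 + k"] by simp
    also have "\<dots> \<le> exp \<rho> * (exp (\<rho> * real k) * \<phi>a k0)" using Suc by simp
    finally show ?case by (simp add: exp_add[symmetric] algebra_simps mult.assoc[symmetric])
  qed simp
  define \<epsilon> where "\<epsilon> = (\<tau> - \<rho>) / 2"
  have \<epsilon>: "\<epsilon> > 0" using \<rho> by (simp add: \<epsilon>_def)
  obtain K where K: "\<And>k. \<bar>L (a (real k)) - real k * \<tau>\<bar> \<le> real k * \<epsilon> + K"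
    using N.stable_length[OF R_LO[OF a_LO] \<epsilon>, of 1] unfolding L_a \<tau>_def by auto
  have "real k * \<epsilon> \<le> ln (2 * \<phi>a k0) + K + \<bar>real k0 * (\<tau> - \<epsilon>)\<bar>" for k
  proof -
    have "exp (L (a (real (k0 + k)))) \<le> 2 * cosh (L (a (real (k0 + k))))" by (simp add: cosh_def)
    also have "\<dots> = 2 * \<phi>a (k0 + k)" by (simp only: cosh_L[OF a_LO])
    also have "\<dots> \<le> exp (\<rho> * real k) * (2 * \<phi>a k0)" using gr[of k] by simp
    also have "\<dots> = exp (\<rho> * real k + ln (2 * \<phi>a k0))" using \<phi>a_ge1[of k0] by (simp add: exp_add)
    finally have "L (a (real (k0 + k))) \<le> \<rho> * real k + ln (2 * \<phi>a k0)" by (simp only: exp_le_cancel_iff)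
    moreover have "real (k0 + k) * \<tau> - real (k0 + k) * \<epsilon> - K \<le> L (a (real (k0 + k)))"
      using K[of "k0 + k"] unfolding abs_le_iff by linarith
    ultimately have "real (k0 + k) * \<tau> - real (k0 + k) * \<epsilon> - K \<le> \<rho> * real k + ln (2 * \<phi>a k0)" by linarith
    moreover have "real (k0 + k) * \<tau> - real (k0 + k) * \<epsilon> - \<rho> * real k = real k0 * (\<tau> - \<epsilon>) + real k * \<epsilon>"
      by (simp add: \<epsilon>_def algebra_simps) (simp add: field_simps)
    ultimately show ?thesis by linarith
  qed
  then have "real k \<le> (ln (2 * \<phi>a k0) + K + \<bar>real k0 * (\<tau> - \<epsilon>)\<bar>) / \<epsilon>" for k using \<epsilon> by (simp add: le_divide_eq)
  then show False using reals_Archimedean2 not_less by blast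
qed

lemma tlen_a: "M.tlen (a s) \<le> \<bar>s\<bar>"
proof -
  have "M.tlen (a s) \<le> M.D (a s M.e0) M.e0" by (rule M.tlen_le[OF M.e0_H])
  also have "\<dots> = arcosh (cosh \<bar>s\<bar>)"
    using a_\<phi>[of s] by (simp add: M.D_arcosh[OF M.LO_H[OF a_LO M.e0_H] M.e0_H] M.\<phi>_def)
  also have "\<dots> = \<bar>s\<bar>" by (rule arcosh_cosh_real) simp
  finally show ?thesis .
qed

text \<open>\<open>ln (\<eta> (a s))\<close> is additive, bounded by
  \<open>\<tau> * \<bar>s\<bar>\<close>, and attains the bound at natural numbers. For
  \<open>0 \<le> s \<le> n\<close> the values at \<open>s\<close> and \<open>n - s\<close> add up to
  \<open>n * \<tau>\<close>, so neither can fall short of its bound.\<close>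

lemma \<eta>_a: "\<eta> (a s) = exp (\<tau> * s)"
proof -
  define g where "g s = ln (\<eta> (a s))" for s
  have pos: "\<eta> (a s) > 0" for s using \<eta>(2)[OF a_LO a_up] .
  have add: "g (s + r) = g s + g r" for s r
    unfolding g_def a_comp[symmetric] \<eta>_comp[OF a_LO a_up a_LO a_up] using pos by (simp add: ln_mult less_imp_neq[symmetric])
  have le: "\<bar>g s\<bar> \<le> \<tau> * \<bar>s\<bar>" for s
    using \<eta>(3)[OF a_LO a_up, of s] mult_left_mono[OF tlen_a[of s] less_imp_le[OF \<tau>_pos]] by (simp add: g_def)
  have g1: "g 1 = \<tau>" using \<eta>_a1 le[of 1] by (simp add: g_def)
  have g0: "g 0 = 0" using add[of 0 0] by simp
  have gn: "g (real n) = real n * \<tau>" for n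
    by (induction n) (simp_all add: g0 add g1 distrib_right)
  have nn: "g s = \<tau> * s" if "s \<ge> 0" for s
  proof -
    obtain n where n: "s \<le> real n" using real_arch_simple by blast
    have "g s + g (real n - s) = real n * \<tau>" using add[of s "real n - s"] gn[of n] by simp
    moreover have "g s \<le> \<tau> * s" "g (real n - s) \<le> \<tau> * (real n - s)"
      using le[of s] le[of "real n - s"] n that by auto
    ultimately show ?thesis by (simp add: algebra_simps)
  qed
  have "g s = \<tau> * s"
  proof (cases "s \<ge> 0")
    case False
    then have "g (- s) = \<tau> * - s" by (intro nn) simp
    then show ?thesis using add[of s "- s"] g0 by simp
  qed (rule nn)
  then show ?thesis using pos[of s] by (metis g_def exp_ln)
qed

text \<open>Composition with the translation by \<open>- ln l\<close> makes \<open>q\<close> fix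
  \<open>up\<close>, so that \<open>\<eta>_fix\<close> applies.\<close>

lemma \<eta>_powr: assumes q: "q \<in> M.LO" and u: "q up = l *\<^sub>R up" shows "\<eta> q = l powr \<tau>"
proof -
  have "l > 0" using M.eigen_le_tlen(1)[OF q up_C u] .
  define s where "s = ln l"
  have s: "exp s = l" using \<open>l > 0\<close> by (simp add: s_def)
  let ?q = "q \<circ> a (- s)"
  have "?q up = exp (- s) *\<^sub>R (l *\<^sub>R up)" by (simp add: a_up M.LO_scale[OF q] u)
  then have f: "?q up = up" using s by (simp add: exp_minus) (metis exp_not_eq_zero left_inverse scaleR_one)
  have "1 = \<eta> q * \<eta> (a (- s))"
    by (simp only: \<eta>_comp[OF q u a_LO a_up, symmetric] \<eta>_fix[OF M.LO_comp[OF q a_LO] f])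
  then have "\<eta> q = exp (\<tau> * s)" by (simp add: \<eta>_a exp_minus field_simps)
  then show ?thesis using \<open>l > 0\<close> by (simp add: powr_def s_def)
qed

text \<open>The equivariant extension of \<open>up \<mapsto> \<xi>\<close>. Any element carrying
  \<open>up\<close> to \<open>u\<close> may be chosen, because elements fixing \<open>up\<close> fix
  \<open>\<xi>\<close>.\<close>

definition F where "F u = R (SOME A. A \<in> M.LO \<and> A up = u) \<xi>"

lemma F_eq: assumes A: "A \<in> M.LO" shows "F (A up) = R A \<xi>"
proof -
  define A' where "A' = (SOME A'. A' \<in> M.LO \<and> A' up = A up)"
  have A': "A' \<in> M.LO" "A' up = A up"
    using someI[of "\<lambda>A'. A' \<in> M.LO \<and> A' up = A up" A] A by (simp_all add: A'_def)
  let ?q = "fun_inv A \<circ> A'"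
  have q: "?q \<in> M.LO" by (rule M.LO_comp[OF M.LO_inv(1)[OF A] A'(1)])
  have f: "?q up = up" using A'(2) M.LO_inv(2)[OF A] by simp
  have "R ?q \<xi> = \<xi>" using \<eta>(1)[OF q, of 1] \<eta>_fix[OF q f] f by simp
  then have "R (A \<circ> ?q) \<xi> = R A \<xi>" by (simp only: R_comp[OF A q] o_apply)
  moreover have "A \<circ> ?q = A'" using M.LO_inv(5)[OF A] by (simp add: o_assoc)
  ultimately show ?thesis by (simp add: F_def A'_def)
qed

lemma F_equiv: assumes A: "A \<in> M.LO" and u: "u \<in> M.C" shows "F (A u) = R A (F u)"
proof -
  obtain G where G: "G \<in> M.LO" "G up = u" using up_trans[OF u] by blast
  have "F (A (G up)) = R A (F (G up))"
    using F_eq[OF M.LO_comp[OF A G(1)]] by (simp add: R_comp[OF A G(1)] F_eq[OF G(1)])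
  then show ?thesis by (simp only: G(2))
qed

lemma F_C: assumes u: "u \<in> M.C" shows "F u \<in> N.C"
  using up_trans[OF u] F_eq N.LO_C[OF R_LO \<xi>_C] by metis

lemma F_scale: assumes u: "u \<in> M.C" and c: "c > 0" shows "F (c *\<^sub>R u) = (c powr \<tau>) *\<^sub>R F u"
proof -
  obtain G where G: "G \<in> M.LO" "G up = u" using up_trans[OF u] by blast
  have "(G \<circ> a (ln c)) up = c *\<^sub>R u" using c G by (simp add: a_up M.LO_scale)
  then have "F (c *\<^sub>R u) = R G (R (a (ln c)) \<xi>)"
    using F_eq[OF M.LO_comp[OF G(1) a_LO], of "ln c"] by (simp add: R_comp[OF G(1) a_LO])
  also have "\<dots> = \<eta> (a (ln c)) *\<^sub>R R G \<xi>" by (simp add: \<eta>(1)[OF a_LO a_up] N.LO_scale[OF R_LO[OF G(1)]])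
  also have "R G \<xi> = F u" using F_eq[OF G(1)] G(2) by simp
  finally show ?thesis using c by (simp add: \<eta>_powr[OF a_LO a_up])
qed

definition \<kappa> where "\<kappa> = N.B (F up) (F um)"

text \<open>Product zero would make the images of the two ends proportional, but
  \<open>R (a 1)\<close> multiplies them by the different factors \<open>exp \<tau>\<close> and
  \<open>exp (- \<tau>)\<close>.\<close>

lemma \<kappa>_pos: "\<kappa> > 0"
proof (rule ccontr)
  assume "\<not> \<kappa> > 0"
  then have "\<kappa> = 0" using N.B_null_prod(1)[OF F_C[OF up_C] F_C[OF um_C]] by (simp add: \<kappa>_def)
  then obtain c where c: "F um = c *\<^sub>R F up"
    using N.B_null_prod(2)[OF F_C[OF up_C] F_C[OF um_C]] by (auto simp: \<kappa>_def)
  have 1: "R (a 1) (F up) = exp \<tau> *\<^sub>R F up"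
    using F_equiv[OF a_LO up_C, of 1] F_scale[OF up_C, of "exp 1"] by (simp add: a_up powr_def)
  have 2: "R (a 1) (F um) = exp (- \<tau>) *\<^sub>R F um"
    using F_equiv[OF a_LO um_C, of 1] F_scale[OF um_C, of "exp (- 1)"] by (simp add: a_um powr_def)
  have "R (a 1) (F um) = exp \<tau> *\<^sub>R F um" by (simp add: c N.LO_scale[OF R_LO[OF a_LO]] 1)
  with 2 have "exp (- \<tau>) *\<^sub>R F um = exp \<tau> *\<^sub>R F um" by simp
  then have "exp (- \<tau>) = exp \<tau>" using N.C_nz[OF F_C[OF um_C]] by (simp only: scaleR_cancel_right) blast
  then show False using \<tau>_pos by simp
qed

theorem F_kernel: assumes u: "u \<in> M.C" and v: "v \<in> M.C"
  shows "N.B (F u) (F v) = \<kappa> * M.B u v powr \<tau>"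
proof (cases "M.B u v = 0")
  case True
  then obtain c where c: "v = c *\<^sub>R u" "c > 0"
    using M.B_null_prod(2)[OF u v] u v by (auto simp: M.C_def intro!: that[of "M.B v M.e0 / M.B u M.e0"])
  have "N.B (F u) (F u) = 0" using F_C[OF u] by (simp add: N.C_def)
  then show ?thesis by (simp add: True) (simp add: c F_scale[OF u] lorentz_simps)
next
  case False
  then have p: "M.B u v > 0" using M.B_null_prod(1)[OF u v] by simp
  let ?s = "M.B u v"
  \<comment> \<open>Rescaling \<open>up\<close> gives a pair with product \<open>B u v\<close>,
    which \<open>pair_trans\<close> carries to \<open>u\<close> and \<open>v\<close>; homogeneity of
    \<open>F\<close> turns the scale into the power.\<close>
  have C: "?s *\<^sub>R up \<in> M.C" by (rule M.C_scale[OF up_C p])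
  obtain A where A: "A \<in> M.LO" "A (?s *\<^sub>R up) = u" "A um = v"
    using M.pair_trans[OF C um_C u v] p by (auto simp: lorentz_simps up_um)
  have "N.B (F u) (F v) = N.B (F (A (?s *\<^sub>R up))) (F (A um))" by (simp only: A)
  also have "\<dots> = N.B (F (?s *\<^sub>R up)) (F um)"
    by (simp only: F_equiv[OF A(1) C] F_equiv[OF A(1) um_C] N.LO_B[OF R_LO[OF A(1)]])
  also have "\<dots> = \<kappa> * ?s powr \<tau>" by (simp add: F_scale[OF up_C p] lorentz_simps \<kappa>_def)
  finally show ?thesis .
qed

end

section \<open>The range of the exponent\<close>

lemma finite_orthonormal_span:
  fixes S :: "'a::real_inner set"
  assumes "finite S"
  shows "\<exists>Q. finite Q \<and> (\<forall>q\<in>Q. inner q q = 1) \<and> (\<forall>q\<in>Q. \<forall>r\<in>Q. q \<noteq> r \<longrightarrow> inner q r = 0) \<and> span Q = span S"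
  using assms
proof (induction S rule: finite_induct)
  case empty
  show ?case by (intro exI[of _ "{}"]) simp
next
  case (insert a S)
  from insert.IH obtain Q where Q': "finite Q \<and> (\<forall>q\<in>Q. inner q q = 1) \<and> (\<forall>q\<in>Q. \<forall>r\<in>Q. q \<noteq> r \<longrightarrow> inner q r = 0) \<and> span Q = span S" ..
  have Q: "finite Q" "\<And>q. q \<in> Q \<Longrightarrow> inner q q = 1"
    "\<And>q r. q \<in> Q \<Longrightarrow> r \<in> Q \<Longrightarrow> q \<noteq> r \<Longrightarrow> inner q r = 0" "span Q = span S"
    using Q' by simp_all
  define p where "p = (\<Sum>q\<in>Q. inner a q *\<^sub>R q)"
  define r where "r = a - p"
  have p: "p \<in> span Q" unfolding p_def by (intro span_sum span_scale span_base)
  have orth: "inner r q = 0" if "q \<in> Q" for q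
  proof -
    have "inner p q = (\<Sum>q'\<in>Q. if q' = q then inner a q else 0)"
      unfolding p_def inner_sum_left by (rule sum.cong) (use Q(2,3) that in auto)
    also have "\<dots> = inner a q" using Q(1) that by simp
    finally show ?thesis by (simp add: r_def inner_diff_left)
  qed
  show ?case
  proof (cases "r = 0")
    case True
    then have "a \<in> span S" using p Q(4) by (simp add: r_def)
    then have "span Q = span (insert a S)" using Q(4) by (simp add: span_redundant)
    with Q show ?thesis by blast
  next
    case False
    let ?Q = "insert (sgn r) Q"
    have "span ?Q = span (insert a S)"
    proof (rule span_unique[symmetric])
      have ra: "r = norm r *\<^sub>R sgn r" using False by (simp add: sgn_div_norm)
      have "sgn r \<in> span ?Q" by (simp add: span_base)
      then have "norm r *\<^sub>R sgn r + p \<in> span ?Q"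
        using p span_mono[of Q ?Q] by (intro span_add span_scale) auto
      then have "a \<in> span ?Q" using ra by (simp add: r_def)
      then show "insert a S \<subseteq> span ?Q" using span_mono[of Q ?Q] Q(4) span_superset[of S] by auto
      show "subspace (span ?Q)" by (rule subspace_span)
      fix T' assume T': "insert a S \<subseteq> T'" "subspace T'"
      then have "span S \<subseteq> T'" by (intro span_minimal) auto
      then have "r \<in> T'" "Q \<subseteq> T'" using T' p Q(4) span_superset[of Q]
        by (auto simp: r_def intro: subspace_diff)
      then have "?Q \<subseteq> T'" using T'(2) by (auto simp: sgn_div_norm intro: subspace_scale)
      then show "span ?Q \<subseteq> T'" using T'(2) by (rule span_minimal)
    qed
    moreover have "inner (sgn r) (sgn r) = 1" using False by (simp add: norm_eq_1[symmetric] norm_sgn)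
    moreover have "inner (sgn r) q = 0" "inner q (sgn r) = 0" if "q \<in> Q" for q
      using orth[OF that] by (simp_all add: sgn_div_norm inner_commute)
    ultimately show ?thesis using Q(1-3) by (intro exI[of _ ?Q]) auto
  qed
qed

lemma orthonormal_expansion:
  fixes Q :: "'a::real_inner set"
  assumes Q: "finite Q" "\<And>q. q \<in> Q \<Longrightarrow> inner q q = 1"
    "\<And>q r. q \<in> Q \<Longrightarrow> r \<in> Q \<Longrightarrow> q \<noteq> r \<Longrightarrow> inner q r = 0" and v: "v \<in> span Q"
  shows "v = (\<Sum>q\<in>Q. inner v q *\<^sub>R q)"
proof -
  obtain c where c: "v = (\<Sum>q\<in>Q. c q *\<^sub>R q)" using v Q(1) by (auto simp: span_finite)
  have "inner v q = c q" if "q \<in> Q" for q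
  proof -
    have "inner v q = (\<Sum>q'\<in>Q. if q' = q then c q else 0)"
      unfolding c inner_sum_left by (rule sum.cong) (use Q(2,3) that in auto)
    then show ?thesis using Q(1) that by simp
  qed
  then show ?thesis by (subst c) (simp cong: sum.cong)
qed

text \<open>The span is the set of fixed points of the orthogonal projection written in an
  orthonormal basis, which is a closed condition.\<close>

lemma closed_span_finite:
  fixes S :: "'a::real_inner set"
  assumes "finite S"
  shows "closed (span S)"
proof -
  from finite_orthonormal_span[OF assms] obtain Q where Q': "finite Q \<and> (\<forall>q\<in>Q. inner q q = 1) \<and> (\<forall>q\<in>Q. \<forall>r\<in>Q. q \<noteq> r \<longrightarrow> inner q r = 0) \<and> span Q = span S" ..
  have Q: "finite Q" "\<And>q. q \<in> Q \<Longrightarrow> inner q q = 1"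
    "\<And>q r. q \<in> Q \<Longrightarrow> r \<in> Q \<Longrightarrow> q \<noteq> r \<Longrightarrow> inner q r = 0" "span Q = span S"
    using Q' by simp_all
  have "span Q = {v. v = (\<Sum>q\<in>Q. inner v q *\<^sub>R q)}"
  proof
    show "span Q \<subseteq> {v. v = (\<Sum>q\<in>Q. inner v q *\<^sub>R q)}"
      using orthonormal_expansion[OF Q(1-3)] by blast
    have "(\<Sum>q\<in>Q. inner v q *\<^sub>R q) \<in> span Q" for v by (intro span_sum span_scale span_base)
    then show "{v. v = (\<Sum>q\<in>Q. inner v q *\<^sub>R q)} \<subseteq> span Q" by (metis (mono_tags, lifting) mem_Collect_eq subsetI)
  qed
  moreover have "closed {v. v = (\<Sum>q\<in>Q. inner v q *\<^sub>R q)}"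
    by (intro closed_Collect_eq continuous_intros)
  ultimately show ?thesis using Q(4) by simp
qed

section \<open>Snowflake curves and geodesics\<close>

context lorentz_space begin

text \<open>A vanishing combination is tested against the vector with the largest coefficient: the
  off-diagonal terms amount to at most half of the diagonal one.\<close>

lemma diagonally_dominant_independent:
  assumes A: "finite A" and c: "c > 0" "\<And>x. x \<in> A \<Longrightarrow> B x x = - c"
    and off: "\<And>x y. x \<in> A \<Longrightarrow> y \<in> A \<Longrightarrow> x \<noteq> y \<Longrightarrow> \<bar>B x y\<bar> \<le> c / (2 * real (card A))"
  shows "independent A"
proof (rule independent_if_scalars_zero[OF A])
  fix h x assume s: "(\<Sum>x\<in>A. h x *\<^sub>R x) = 0" and x: "x \<in> A"
  define m where "m = Max ((\<lambda>x. \<bar>h x\<bar>) ` A)"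
  have "m \<in> (\<lambda>x. \<bar>h x\<bar>) ` A" unfolding m_def using A x by (intro Max_in) auto
  then obtain y where y: "y \<in> A" "m = \<bar>h y\<bar>" by blast
  have le: "\<bar>h z\<bar> \<le> m" if "z \<in> A" for z unfolding m_def using A that by (intro Max_ge) auto
  have cA: "card A > 0" using A x card_gt_0_iff by blast
  have m0: "m \<ge> 0" using y by simp
  have "0 = B (\<Sum>x\<in>A. h x *\<^sub>R x) y" by (simp add: s)
  also have "\<dots> = h y * B y y + (\<Sum>x\<in>A - {y}. h x * B x y)"
    unfolding B_sum_left using A y(1) by (simp add: sum.remove lorentz_scale_left)
  finally have "h y * c = (\<Sum>x\<in>A - {y}. h x * B x y)" using c(2)[OF y(1)] by simp
  then have "m * c = \<bar>\<Sum>x\<in>A - {y}. h x * B x y\<bar>" using y c(1) by (metis abs_mult abs_of_pos)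
  also have "\<dots> \<le> (\<Sum>x\<in>A - {y}. \<bar>h x * B x y\<bar>)" by (rule sum_abs)
  also have "\<dots> \<le> (\<Sum>x\<in>A - {y}. m * (c / (2 * real (card A))))"
    unfolding abs_mult using le off y(1) m0 by (intro sum_mono mult_mono) auto
  also have "\<dots> = real (card (A - {y})) * (m * (c / (2 * real (card A))))" by simp
  also have "\<dots> \<le> real (card A) * (m * (c / (2 * real (card A))))"
    using m0 c(1) A by (intro mult_right_mono) (auto intro: card_mono)
  also have "\<dots> = m * c / 2" using cA by (simp add: field_simps)
  finally have "m * c \<le> 0" by linarith
  then have "m = 0" using m0 c(1) by (simp add: mult_le_0_iff)
  then show "h x = 0" using le[OF x] by simp
qed

text \<open>The products of the differences \<open>V x - V 0\<close> are proportional to the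
  combination of \<open>2 * \<tau>\<close>-th powers of the distances among \<open>x\<close>,
  \<open>y\<close> and zero. Along a geometric sequence, and rescaled to equal length, these vectors
  are almost orthogonal, so more than \<open>card S\<close> of them are independent.\<close>

lemma snowflake_infinite_span:
  fixes V :: "real \<Rightarrow> 'a" and \<tau> \<kappa> :: real
  assumes VV: "\<And>x y. B (V x) (V y) = \<kappa> * ((x - y)\<^sup>2 / 2) powr \<tau>"
    and \<kappa>: "\<kappa> > 0" and t0: "0 < \<tau>" and t1: "\<tau> < 1" and S: "finite S" "range V \<subseteq> span S"
  shows False
proof -
  define N where "N = card S + 1"
  define m where "m = min \<tau> (1 - \<tau>)"
  have m: "m > 0" "m \<le> \<tau>" "m \<le> 1 - \<tau>" using t1 t0 by (auto simp: m_def)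
  \<comment> \<open>Chosen so that \<open>3 * r powr m = 1 / N\<close>, which yields the
    off-diagonal bound needed for \<open>N\<close> vectors; \<open>m > 0\<close> uses both
    \<open>0 < \<tau>\<close> and \<open>\<tau> < 1\<close>.\<close>
  define r where "r = (1 / (3 * real N)) powr (1 / m)"
  have N1: "real N \<ge> 1" by (simp add: N_def)
  have rm: "r powr m = 1 / (3 * real N)" using m N1 by (simp add: r_def powr_powr)
  have r: "0 < r" "r < 1"
    using N1 m powr_less_mono2[of "1 / m" "1 / (3 * real N)" 1] by (auto simp: r_def)
  define h where "h = (1 / 2) powr \<tau>"
  have h: "h > 0" by (simp add: h_def)
  define c where "c = 2 * \<kappa> * h"
  have c: "c > 0" using \<kappa> h by (simp add: c_def)
  define v where "v x = V x - V 0" for x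
  have vv: "B (v x) (v y) = c / 2 * ((x - y)\<^sup>2 powr \<tau> - (x\<^sup>2) powr \<tau> - (y\<^sup>2) powr \<tau>)" for x y
  proof -
    have "B (V 0) (V 0) = 0" using VV[of 0 0] by simp
    then have "B (v x) (v y) = \<kappa> * (((x - y)\<^sup>2 / 2) powr \<tau> - (x\<^sup>2 / 2) powr \<tau> - (y\<^sup>2 / 2) powr \<tau>)"
      using VV[of x y] VV[of x 0] VV[of 0 y] by (simp add: v_def lorentz_simps algebra_simps)
    moreover have half: "(z / 2) powr \<tau> = z powr \<tau> * h" if "z \<ge> 0" for z :: real
    proof -
      have "z / 2 = z * (1 / 2)" by simp
      then show ?thesis using powr_mult[of z "1 / 2" \<tau>] that by (simp only: h_def)
    qed
    ultimately have "B (v x) (v y) = \<kappa> * ((x - y)\<^sup>2 powr \<tau> * h - (x\<^sup>2) powr \<tau> * h - (y\<^sup>2) powr \<tau> * h)"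
      by (simp only: half[OF zero_le_power2])
    then show ?thesis unfolding c_def by (simp only: right_diff_distrib) simp
  qed
  \<comment> \<open>The factor normalises \<open>B (w j) (w j)\<close> to \<open>- c\<close>; the
    product of \<open>w i\<close> and \<open>w j\<close> then depends on \<open>r ^ (j - i)\<close>
    only.\<close>
  define w where "w j = (r powr (- \<tau> * real j)) *\<^sub>R v (r ^ j)" for j :: nat
  have sq: "(x\<^sup>2) powr \<tau> = x powr (2 * \<tau>)" if "x > 0" for x
    using that by (simp add: powr_powr[symmetric])
  have rj: "r ^ j = r powr real j" for j using r by (simp add: powr_realpow)
  have diag: "B (w j) (w j) = - c" for j
  proof -
    have "B (w j) (w j) = - c * (r powr (- \<tau> * real j) * r powr (- \<tau> * real j) * r powr (real j * (2 * \<tau>)))"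
      using r by (simp add: w_def lorentz_simps vv sq rj powr_powr)
    also have "r powr (- \<tau> * real j) * r powr (- \<tau> * real j) * r powr (real j * (2 * \<tau>)) = r powr 0"
      by (simp only: powr_add[symmetric]) (simp add: algebra_simps)
    finally show ?thesis using r by simp
  qed
  have off: "\<bar>B (w i) (w j)\<bar> \<le> c / (2 * real N)" if "i < j" for i j
  proof -
    define \<rho> where "\<rho> = r ^ (j - i)"
    have \<rho>: "0 < \<rho>" "\<rho> \<le> r" "\<rho> < 1" using r that power_decreasing[of 1 "j - i" r]
      by (auto simp: \<rho>_def power_less_one_iff)
    have xj: "r ^ j = \<rho> * r ^ i" using that by (simp add: \<rho>_def power_add[symmetric])
    define x where "x = r ^ i"
    have x: "x > 0" using r by (simp add: x_def)
    have "B (w i) (w j) = r powr (- \<tau> * real i) * (r powr (- \<tau> * real j) * (c / 2 * ((x - \<rho> * x)\<^sup>2 powr \<tau> - (x\<^sup>2) powr \<tau> - ((\<rho> * x)\<^sup>2) powr \<tau>)))"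
      by (simp add: w_def lorentz_simps vv xj x_def)
    also have "(x - \<rho> * x)\<^sup>2 powr \<tau> - (x\<^sup>2) powr \<tau> - ((\<rho> * x)\<^sup>2) powr \<tau> = x powr (2 * \<tau>) * ((1 - \<rho>) powr (2 * \<tau>) - 1 - \<rho> powr (2 * \<tau>))"
    proof -
      have e: "x - \<rho> * x = x * (1 - \<rho>)" by (simp add: algebra_simps)
      have "(x - \<rho> * x)\<^sup>2 powr \<tau> = x powr (2 * \<tau>) * (1 - \<rho>) powr (2 * \<tau>)"
        unfolding e using x \<rho> by (subst sq) (auto simp: powr_mult)
      moreover have "((\<rho> * x)\<^sup>2) powr \<tau> = x powr (2 * \<tau>) * \<rho> powr (2 * \<tau>)"
        using x \<rho> by (subst sq) (auto simp: powr_mult)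
      ultimately show ?thesis using sq[OF x] by (simp add: algebra_simps)
    qed
    also have "r powr (- \<tau> * real i) * (r powr (- \<tau> * real j) * (c / 2 * (x powr (2 * \<tau>) * ((1 - \<rho>) powr (2 * \<tau>) - 1 - \<rho> powr (2 * \<tau>)))))
        = c / 2 * (\<rho> powr (- \<tau>) * ((1 - \<rho>) powr (2 * \<tau>) - 1 - \<rho> powr (2 * \<tau>)))"
    proof -
      have "r powr (- \<tau> * real i) * r powr (- \<tau> * real j) * x powr (2 * \<tau>) = r powr (- \<tau> * real i + - \<tau> * real j + real i * (2 * \<tau>))"
        unfolding x_def rj powr_powr by (simp only: powr_add)
      also have "- \<tau> * real i + - \<tau> * real j + real i * (2 * \<tau>) = real (j - i) * - \<tau>"
        using that by (simp add: of_nat_diff algebra_simps)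
      also have "r powr (real (j - i) * - \<tau>) = \<rho> powr (- \<tau>)" unfolding \<rho>_def rj powr_powr ..
      finally show ?thesis by (simp add: mult_ac)
    qed
    also have "\<bar>\<dots>\<bar> \<le> c / 2 * (1 / real N)"
    proof -
      have s2: "(1 - \<rho>) powr (2 * \<tau>) \<le> 1" using \<rho> t0 powr_le_one_le[of "1 - \<rho>"] powr_mono'[of 0 "2 * \<tau>" "1 - \<rho>"] by simp
      \<comment> \<open>The deficit \<open>1 - (1 - \<rho>) powr (2 * \<tau>)\<close> is of first
        order in \<open>\<rho>\<close>; times \<open>\<rho> powr (- \<tau>)\<close> it stays small
        precisely because \<open>\<tau> < 1\<close>.\<close>
      have "(1 - \<rho>) powr (2 * \<tau>) \<ge> (1 - \<rho>) powr 2" using \<rho> t1 by (intro powr_mono') auto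
      also have "(1 - \<rho>) powr 2 = (1 - \<rho>)\<^sup>2" using \<rho> powr_realpow[of "1 - \<rho>" 2] by simp
      also have "(1 - \<rho>)\<^sup>2 \<ge> 1 - 2 * \<rho>" by (simp add: power2_eq_square algebra_simps)
      finally have s1: "1 - (1 - \<rho>) powr (2 * \<tau>) \<le> 2 * \<rho>" by simp
      have ab: "\<bar>(1 - \<rho>) powr (2 * \<tau>) - 1 - \<rho> powr (2 * \<tau>)\<bar> = 1 - (1 - \<rho>) powr (2 * \<tau>) + \<rho> powr (2 * \<tau>)"
        using s2 powr_ge_zero[of \<rho> "2 * \<tau>"] by linarith
      have "\<bar>\<rho> powr (- \<tau>) * ((1 - \<rho>) powr (2 * \<tau>) - 1 - \<rho> powr (2 * \<tau>))\<bar>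
          = \<rho> powr (- \<tau>) * (1 - (1 - \<rho>) powr (2 * \<tau>) + \<rho> powr (2 * \<tau>))"
        by (simp only: abs_mult ab abs_of_nonneg[OF powr_ge_zero])
      also have "\<dots> \<le> \<rho> powr (- \<tau>) * (2 * \<rho> powr 1 + \<rho> powr (2 * \<tau>))"
        using s1 \<rho> by (intro mult_left_mono) auto
      also have "\<dots> = 2 * \<rho> powr (1 - \<tau>) + \<rho> powr \<tau>"
        by (simp only: distrib_left mult.left_commute[of _ 2] powr_add[symmetric]) simp
      also have "\<dots> \<le> 2 * \<rho> powr m + \<rho> powr m"
        using m \<rho> by (intro add_mono mult_left_mono powr_mono') auto
      also have "\<dots> \<le> 3 * r powr m" using \<rho> m by (simp add: powr_mono2)
      also have "\<dots> = 1 / real N" by (simp add: rm)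
      finally have "\<bar>\<rho> powr (- \<tau>) * ((1 - \<rho>) powr (2 * \<tau>) - 1 - \<rho> powr (2 * \<tau>))\<bar> \<le> 1 / real N" .
      from mult_left_mono[OF this, of "c / 2"] show ?thesis using c by (simp only: abs_mult) simp
    qed
    finally show ?thesis by simp
  qed
  then have off': "\<bar>B (w i) (w j)\<bar> \<le> c / (2 * real N)" if "i \<noteq> j" for i j
    using that by (metis lorentz_commute nat_neq_iff)
  have inj: "inj_on w {..<N}"
  proof (rule inj_onI, rule ccontr)
    fix i j assume "w i = w j" "i \<noteq> j"
    then have "c \<le> c / (2 * real N)" using off'[of i j] diag[of i] c by simp
    moreover have "c / (2 * real N) < c" using c N1 by (simp add: divide_less_eq)
    ultimately show False by simp
  qed
  have card: "card (w ` {..<N}) = N" using card_image[OF inj] by simp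
  have "independent (w ` {..<N})"
    by (rule diagonally_dominant_independent[OF _ c])
      (auto simp: diag card intro!: off')
  moreover have "w ` {..<N} \<subseteq> span S"
    using S(2) by (auto simp: w_def v_def intro!: span_scale span_diff)
  ultimately have "card (w ` {..<N}) \<le> card S" using independent_span_bound[OF S(1)] by blast
  then show False unfolding card by (simp add: N_def)
qed

text \<open>With \<open>y'\<close> and \<open>z'\<close> the components orthogonal to
  \<open>?x\<close>, the combination \<open>?w\<close> is isotropic and orthogonal to a point of the
  hyperboloid, hence zero. Its isotropy expresses equality in the triangle inequality.\<close>

lemma geodesic_span:
  assumes g: "\<And>s. \<gamma> s \<in> H" "\<And>s t. D (\<gamma> s) (\<gamma> t) = \<bar>s - t\<bar>" and st: "s \<noteq> t"
  shows "\<gamma> r \<in> span {\<gamma> s, \<gamma> t}"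
proof -
  let ?x = "\<gamma> s" and ?y = "\<gamma> t" and ?z = "\<gamma> r"
  define \<alpha> \<beta> where "\<alpha> = t - s" and "\<beta> = r - s"
  have c: "B (\<gamma> p) (\<gamma> q) = cosh (p - q)" for p q
    using cosh_D[OF g(1) g(1), of p q] g(2)[of p q] by simp
  have xy: "B ?x ?y = cosh \<alpha>" "B ?x ?z = cosh \<beta>" "B ?y ?x = cosh \<alpha>" "B ?z ?x = cosh \<beta>"
    using cosh_minus[of \<alpha>] cosh_minus[of \<beta>] by (simp_all add: c \<alpha>_def \<beta>_def)
  have yz: "B ?y ?z = cosh \<alpha> * cosh \<beta> - sinh \<alpha> * sinh \<beta>" "B ?z ?y = cosh \<alpha> * cosh \<beta> - sinh \<alpha> * sinh \<beta>"
    using cosh_diff[of \<alpha> \<beta>] cosh_minus[of "\<alpha> - \<beta>"] by (simp_all add: c \<alpha>_def \<beta>_def)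
  have one: "B (\<gamma> p) (\<gamma> p) = 1" for p by (rule B_HH[OF g(1)])
  define y' z' where "y' = ?y - cosh \<alpha> *\<^sub>R ?x" and "z' = ?z - cosh \<beta> *\<^sub>R ?x"
  have o: "B y' ?x = 0" "B z' ?x = 0" by (simp_all add: y'_def z'_def lorentz_simps xy one)
  have "B y' y' = 1 - cosh \<alpha> * cosh \<alpha>" "B z' z' = 1 - cosh \<beta> * cosh \<beta>"
    by (simp_all add: y'_def z'_def lorentz_simps xy one)
  then have yz': "B y' y' = - (sinh \<alpha>)\<^sup>2" "B z' z' = - (sinh \<beta>)\<^sup>2"
    using sinh_square_eq[of \<alpha>] sinh_square_eq[of \<beta>] by (simp_all add: power2_eq_square)
  have yz'': "B y' z' = - sinh \<alpha> * sinh \<beta>" "B z' y' = - sinh \<alpha> * sinh \<beta>"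
    by (simp_all add: y'_def z'_def lorentz_simps xy yz one)
  let ?w = "sinh \<alpha> *\<^sub>R z' - sinh \<beta> *\<^sub>R y'"
  have "B ?w ?x = 0" by (simp add: lorentz_simps o)
  moreover have "B ?w ?w = 0" by (simp add: lorentz_simps yz' yz'' power2_eq_square)
  ultimately have "?w = 0" using lorentz_orthogonal_neg[OF e_nz g(1), of ?w s] by force
  then have "sinh \<alpha> *\<^sub>R z' = sinh \<beta> *\<^sub>R y'" by simp
  moreover have sa: "sinh \<alpha> \<noteq> 0" using st by (simp add: \<alpha>_def)
  ultimately have "z' = (sinh \<beta> / sinh \<alpha>) *\<^sub>R y'"
    by (metis (no_types, opaque_lifting) divide_inverse_commute scaleR_scaleR left_inverse scaleR_one)
  then have "?z = (sinh \<beta> / sinh \<alpha>) *\<^sub>R y' + cosh \<beta> *\<^sub>R ?x" by (simp add: z'_def diff_eq_eq)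
  moreover have "(sinh \<beta> / sinh \<alpha>) *\<^sub>R y' + cosh \<beta> *\<^sub>R ?x \<in> span {?x, ?y}"
    unfolding y'_def by (intro span_add span_scale span_diff span_base) auto
  ultimately show ?thesis by simp
qed

lemma geodesic_line_span:
  assumes "geodesic_line e G" "x \<in> G" "y \<in> G" "x \<noteq> y"
  shows "G \<subseteq> span {x, y}"
proof -
  obtain \<gamma> :: "real \<Rightarrow> 'a" where g: "\<gamma> ` UNIV = G" "G \<subseteq> H" "\<And>s t. D (\<gamma> s) (\<gamma> t) = \<bar>s - t\<bar>"
    using assms(1) unfolding geodesic_line_def by auto
  obtain s t where st: "x = \<gamma> s" "y = \<gamma> t" using assms g(1) by auto
  have "\<gamma> s \<in> H" for s using g by auto
  then have "\<gamma> r \<in> span {x, y}" for r using geodesic_span[of \<gamma> s t r] g(3) st assms(4) by auto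
  then show ?thesis using g(1) by auto
qed

lemma geodesic_line_two_points:
  assumes "geodesic_line e G" shows "\<exists>x\<in>G. \<exists>y\<in>G. x \<noteq> y"
proof -
  obtain \<gamma> :: "real \<Rightarrow> 'a" where g: "\<gamma> ` UNIV = G" "\<And>s t. D (\<gamma> s) (\<gamma> t) = \<bar>s - t\<bar>"
    using assms(1) unfolding geodesic_line_def by auto
  have "\<gamma> 0 \<noteq> \<gamma> 1" using g(2)[of 0 1] by (metis D_self abs_minus_commute abs_one diff_zero zero_neq_one)
  then show ?thesis using g(1) by auto
qed

lemma subspace_totally_geodesic:
  assumes V: "subspace V" shows "totally_geodesic e (H \<inter> V)"
  unfolding totally_geodesic_def
proof (intro conjI ballI impI allI)
  fix x y G assume x: "x \<in> H \<inter> V" and y: "y \<in> H \<inter> V" and "x \<noteq> y" and G: "geodesic_line e G \<and> x \<in> G \<and> y \<in> G"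
  have "G \<subseteq> span {x, y}" using geodesic_line_span G \<open>x \<noteq> y\<close> by blast
  also have "span {x, y} \<subseteq> V" using x y V by (intro span_minimal) auto
  finally show "G \<subseteq> H \<inter> V" using G unfolding geodesic_line_def by auto
qed auto

end

context hyp_rep begin

lemma F_ux: "N.B (F (ux x)) (F (ux y)) = \<kappa> * ((x - y)\<^sup>2 / 2) powr \<tau>" "N.B (F (ux x)) (F up) = \<kappa>"
  by (simp_all add: F_kernel ux_C up_C ux_ux ux_up)

text \<open>The parallelogram law for the horocycle points at 0, 1 and 2. The difference of the two
  unit steps is orthogonal to the isotropic vector \<open>F up\<close>, so its square is
  non-positive, which reads \<open>4 powr \<tau> \<le> 4\<close>.\<close>

lemma \<tau>_le1: "\<tau> \<le> 1"
proof -
  let ?F = "\<lambda>x. F (ux x)"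
  let ?p = "?F 1 - ?F 0" and ?r = "?F 2 - ?F 1"
  define h where "h = (1 / 2) powr \<tau>"
  have h: "h > 0" by (simp add: h_def)
  have s: "N.B (?F x - ?F y) (?F x - ?F y) = - 2 * \<kappa> * ((x - y)\<^sup>2 / 2) powr \<tau>" for x y
    by (simp add: lorentz_simps F_ux power2_commute[of y x])
  have "N.B (?p - ?r) (F up) = 0" by (simp add: lorentz_simps F_ux)
  then have "N.B (?p - ?r) (?p - ?r) \<le> 0" by (rule N.null_orth[OF F_C[OF up_C]])
  moreover have "N.B (?p - ?r) (?p - ?r) = 2 * N.B ?p ?p + 2 * N.B ?r ?r - N.B (?p + ?r) (?p + ?r)"
    by (simp add: lorentz_simps)
  moreover have "N.B (?p + ?r) (?p + ?r) = - 2 * \<kappa> * 2 powr \<tau>" using s[of 2 0] by simp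
  moreover have "N.B ?p ?p = - 2 * \<kappa> * h" "N.B ?r ?r = - 2 * \<kappa> * h" using s[of 1 0] s[of 2 1] by (simp_all add: h_def)
  ultimately have "2 * \<kappa> * (2 powr \<tau>) \<le> 2 * \<kappa> * (4 * h)" by linarith
  then have "2 powr \<tau> \<le> 4 * h" using \<kappa>_pos by simp
  then have "2 powr \<tau> * 2 powr \<tau> \<le> 4 * (h * 2 powr \<tau>)" by (simp add: mult.assoc[symmetric] mult_right_mono)
  also have "h * 2 powr \<tau> = 1" by (simp add: h_def powr_mult[symmetric])
  finally have "2 powr (2 * \<tau>) \<le> (2::real) powr 2" by (simp add: powr_add[symmetric])
  then show ?thesis by (subst (asm) powr_le_cancel_iff) auto
qed

lemma infinite_span:
  assumes t1: "\<tau> < 1" and S: "finite S" "F ` M.C \<subseteq> span S"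
  shows False
  by (rule N.snowflake_infinite_span[OF F_ux(1) \<kappa>_pos \<tau>_pos t1 S(1)]) (use S(2) ux_C in blast)

end

section \<open>Exponent one and invariant subspaces of finite dimension\<close>

context hyp_rep begin

text \<open>For exponent one the vectors \<open>F' u\<close> have the Gram matrix of the cone
  itself. \<open>T\<close> is prescribed on a basis of isotropic vectors, and its agreement with
  \<open>F'\<close> on the whole cone is a consequence of the Gram matrix.\<close>

lemma linear_model:
  assumes t1: "\<tau> = 1"
  shows "\<exists>T. linear T \<and> (\<forall>v w. N.B (T v) (T w) = M.B v w) \<and> T M.e0 \<in> N.H \<and>
    (\<forall>A\<in>M.LO. \<forall>v. R A (T v) = T (A v))"
proof -
  define F' where "F' u = (1 / sqrt \<kappa>) *\<^sub>R F u" for u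
  have F'B: "N.B (F' u) (F' v) = M.B u v" if "u \<in> M.C" "v \<in> M.C" for u v
    using F_kernel[OF that] M.B_null_prod(1)[OF that] \<kappa>_pos by (simp add: F'_def lorentz_simps t1)
  have F'A: "R A (F' u) = F' (A u)" if "A \<in> M.LO" "u \<in> M.C" for A u
    using F_equiv[OF that] by (simp add: F'_def N.LO_scale[OF R_LO[OF that(1)]])
  obtain S where S: "S \<subseteq> M.C" "independent S" "M.C \<subseteq> span S"
    by (rule maximal_independent_subset)
  have spS: "span S = UNIV"
    using S(3) span_C by (metis span_minimal subspace_span top.extremum_uniqueI)
  obtain T where T: "linear T" "\<And>s. s \<in> S \<Longrightarrow> T s = F' s"
    using linear_independent_extend[OF S(2)] by blast
  have linT: "linear (\<lambda>v. N.B (T v) w)" for w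
    using linear_compose[OF T(1) lorentz_linear_left[of e w]] by (simp only: o_def)
  have linT': "linear (\<lambda>v. N.B w (T v))" for w
    using linT[of w] by (simp only: lorentz_commute[of e w])
  have linM: "linear (\<lambda>v. M.B w v)" for w
    using lorentz_linear_left[of b w] by (simp only: lorentz_commute[of b w])
  have FT: "N.B (F' u) (T v) = M.B u v" if u: "u \<in> M.C" for u v
    by (rule linear_eq_on[OF linT' linM, of v S]) (use spS T(2) F'B[OF u] S(1) in auto)
  have TT: "N.B (T v) (T w) = M.B v w" for v w
    by (rule linear_eq_on[OF linT lorentz_linear_left, of v S]) (use spS T(2) FT S(1) in auto)
  have Te: "T M.e0 \<in> N.H"
  proof -
    let ?y = "(1 / sqrt 2) *\<^sub>R (F' up + F' um)"
    have Fc: "F' up \<in> N.C" "F' um \<in> N.C" using F_C[OF up_C] F_C[OF um_C] \<kappa>_pos N.C_scale by (auto simp: F'_def)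
    have b: "N.B (F' up) (F' um) = 1" using F'B[OF up_C um_C] up_um by simp
    have y: "?y \<in> N.H" using N.mid_H[OF Fc] b by simp
    have "N.B ?y (T M.e0) = M.B ((1 / sqrt 2) *\<^sub>R (up + um)) M.e0"
      by (simp add: lorentz_simps FT up_C um_C)
    also have "\<dots> = 1" unfolding e0_up_um[symmetric] by simp
    finally have "N.B (T M.e0) ?y = 1" by (simp add: lorentz_commute)
    then show ?thesis using TT[of M.e0 M.e0] by (intro N.H_sheet[OF _ y]) auto
  qed
  \<comment> \<open>The difference is isotropic and orthogonal to \<open>T M.e0\<close>, a point of
    the hyperboloid, on whose complement the form is negative definite.\<close>
  have TF: "T u = F' u" if u: "u \<in> M.C" for u
  proof (rule ccontr)
    assume ne: "T u \<noteq> F' u"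
    let ?d = "T u - F' u"
    have "N.B ?d (T M.e0) = 0" by (simp add: lorentz_simps TT FT[OF u])
    then have "N.B ?d ?d < 0" by (rule lorentz_orthogonal_neg[OF N.e_nz Te]) (use ne in simp)
    moreover have "N.B ?d ?d = 0"
      using F'B[OF u u] u by (simp add: lorentz_simps TT FT[OF u] lorentz_commute[of e "T u" "F' u"] M.C_def)
    ultimately show False by simp
  qed
  have "R A (T v) = T (A v)" if A: "A \<in> M.LO" for A v
  proof -
    have "linear (\<lambda>v. R A (T v))" "linear (\<lambda>v. T (A v))"
      using linear_compose[OF T(1) N.LO_linear[OF R_LO[OF A]]] linear_compose[OF M.LO_linear[OF A] T(1)]
      by (simp_all only: o_def)
    then show ?thesis by (rule C_linear_eq) (simp add: TF F'A[OF A] M.LO_C[OF A])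
  qed
  then show ?thesis using T(1) TT Te by blast
qed

lemma invariant_subspace:
  assumes t1: "\<tau> = 1"
  shows "\<exists>X (T :: 'm \<Rightarrow> 'h). linear T \<and> inj T \<and> totally_geodesic e X \<and> span X = range T \<and> (\<forall>A\<in>M.LO. R A ` X = X)"
proof -
  obtain T where T: "linear T" "\<And>v w. N.B (T v) (T w) = M.B v w" "T M.e0 \<in> N.H"
    "\<And>A v. A \<in> M.LO \<Longrightarrow> R A (T v) = T (A v)" using linear_model[OF t1] by blast
  have inj: "inj T"
  proof (rule injI)
    fix v w assume "T v = T w"
    then show "v = w" using T(2) by (metis M.B_eqI)
  qed
  define X where "X = T ` M.H"
  have X: "X = N.H \<inter> range T"
  proof
    show "X \<subseteq> N.H \<inter> range T"
    proof
      fix y assume "y \<in> X"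
      then obtain x where x: "x \<in> M.H" "y = T x" by (auto simp: X_def)
      have "N.B y (T M.e0) > 0" using M.H_e0_ge1[OF x(1)] by (simp add: x(2) T(2))
      then have "y \<in> N.H" by (intro N.H_sheet[OF _ T(3)]) (simp_all add: x T(2) M.B_HH)
      then show "y \<in> N.H \<inter> range T" using x by simp
    qed
    show "N.H \<inter> range T \<subseteq> X"
    proof
      fix y assume "y \<in> N.H \<inter> range T"
      then obtain v where v: "T v \<in> N.H" "y = T v" by auto
      have "M.B v v = 1" using N.B_HH[OF v(1)] by (simp add: T(2))
      moreover have "M.B v M.e0 > 0" using N.B_ge_1[OF v(1) T(3)] by (simp add: T(2))
      ultimately have "v \<in> M.H" by (simp add: M.H_iff)
      then show "y \<in> X" by (simp add: X_def v)
    qed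
  qed
  have "subspace (range T)" using linear_subspace_image[OF T(1) subspace_UNIV] .
  then have "totally_geodesic e X" unfolding X by (rule N.subspace_totally_geodesic)
  moreover have "span X = range T"
    unfolding X_def by (simp add: linear_span_image[OF T(1)] span_hyp_space[OF M.e_nz])
  moreover have "R A ` X = X" if A: "A \<in> M.LO" for A
  proof -
    have "A ` M.H = M.H"
      using M.LO_H[OF A] M.LO_H[OF M.LO_inv(1)[OF A]] M.LO_inv(3)[OF A] by (metis image_subsetI rev_image_eqI subsetI subset_antisym)
    then have "T ` (A ` M.H) = T ` M.H" by simp
    then show ?thesis unfolding X_def image_image by (simp add: T(4)[OF A])
  qed
  ultimately have "linear T \<and> inj T \<and> totally_geodesic e X \<and> span X = range T \<and> (\<forall>A\<in>M.LO. R A ` X = X)"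
    using T(1) inj by simp
  then show ?thesis by blast
qed

text \<open>The span of \<open>X\<close> is closed and contains the directions of the orbit of one
  of its points, hence their limit \<open>\<xi>\<close> and by invariance the whole image of
  \<open>F\<close>. For \<open>\<tau> < 1\<close> this image does not lie in a finite-dimensional
  space.\<close>

lemma invariant_finite_dim:
  assumes X: "X \<subseteq> N.H" "X \<noteq> {}" "\<And>A. A \<in> M.LO \<Longrightarrow> R A ` X \<subseteq> X"
    and S: "finite S" "span X = span S"
  shows "\<tau> = 1"
proof (rule ccontr)
  assume "\<tau> \<noteq> 1"
  then have t: "\<tau> < 1" using \<tau>_le1 by simp
  obtain x where x: "x \<in> X" using X(2) by blast
  obtain G where G: "G \<in> N.LO" "G N.e0 = x" using N.refl_ex_H[OF N.e0_H, of x] x X(1) by blast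
  have cl: "closed (span X)" unfolding S(2) by (rule closed_span_finite[OF S(1)])
  have RG: "R (a (real k)) \<circ> G \<in> N.LO" for k by (rule N.LO_comp[OF R_LO[OF a_LO] G(1)])
  \<comment> \<open>Starting the orbit at \<open>x = G N.e0\<close> moves each orbit point by a
    fixed distance, which does not affect the limit direction.\<close>
  have "(\<lambda>k. N.W (R (a (real k)) \<circ> G) - Wa k) \<longlonglongrightarrow> 0"
  proof (rule tendsto_norm_zero_cancel, rule tendsto_sandwich[OF _ _ tendsto_const])
    show "(\<lambda>k. sqrt (2 * N.\<phi> G / \<phi>a k)) \<longlonglongrightarrow> 0" using tendsto_real_sqrt[OF inverse_\<phi>a[of "2 * N.\<phi> G"]] by simp
    have "norm (N.W (R (a (real k)) \<circ> G) - Wa k) \<le> sqrt (2 * N.\<phi> G / \<phi>a k)" for k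
    proof (rule real_le_rsqrt)
      have g: "N.\<phi> (R (a (real k)) \<circ> G) \<ge> 1" "N.\<phi> G \<ge> 1" using N.\<phi>_ge1 RG G by auto
      have "(norm (N.W (R (a (real k)) \<circ> G) - Wa k))\<^sup>2 \<le> 2 * N.B ((R (a (real k)) \<circ> G) N.e0) (R (a (real k)) N.e0) / (N.\<phi> (R (a (real k)) \<circ> G) * \<phi>a k)"
        unfolding Wa_def by (rule N.W_diff_le[OF RG R_LO[OF a_LO]])
      also have "N.B ((R (a (real k)) \<circ> G) N.e0) (R (a (real k)) N.e0) = N.\<phi> G"
        by (simp add: N.LO_B[OF R_LO[OF a_LO]] N.\<phi>_def)
      also have "2 * N.\<phi> G / (N.\<phi> (R (a (real k)) \<circ> G) * \<phi>a k) \<le> 2 * N.\<phi> G / (1 * \<phi>a k)"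
        using g \<phi>a_ge1[of k] by (intro divide_left_mono mult_right_mono mult_pos_pos) auto
      finally show "(norm (N.W (R (a (real k)) \<circ> G) - Wa k))\<^sup>2 \<le> 2 * N.\<phi> G / \<phi>a k" by (simp only: mult_1_left)
    qed
    then show "\<forall>\<^sub>F k in sequentially. norm (N.W (R (a (real k)) \<circ> G) - Wa k) \<le> sqrt (2 * N.\<phi> G / \<phi>a k)" by simp
  qed simp
  from tendsto_add[OF this Wa_lim] have lim: "(\<lambda>k. N.W (R (a (real k)) \<circ> G)) \<longlonglongrightarrow> \<xi>" by simp
  have "N.W (R (a (real k)) \<circ> G) \<in> span X" for k
    unfolding N.W_def o_apply G(2) using X(3)[OF a_LO] x by (intro span_scale span_base) auto
  then have xi: "\<xi> \<in> span X" using closed_sequentially[OF cl _ lim] by blast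
  have inv: "R A v \<in> span X" if A: "A \<in> M.LO" and v: "v \<in> span X" for A v
  proof -
    have "R A v \<in> R A ` span X" using v by blast
    also have "R A ` span X = span (R A ` X)" using linear_span_image[OF N.LO_linear[OF R_LO[OF A]]] by simp
    also have "\<dots> \<subseteq> span X" using X(3)[OF A] by (rule span_mono)
    finally show ?thesis .
  qed
  have "F ` M.C \<subseteq> span S"
    using up_trans F_eq inv[OF _ xi] S(2) by (metis image_subsetI)
  then show False using infinite_span[OF t S(1)] by blast
qed

end

section \<open>From isometries to linear maps\<close>

context lorentz_space begin

text \<open>Near \<open>x\<close> the two distances control each other:
  \<open>arcosh (B x y)\<close> is continuous in \<open>y\<close>, and \<open>norm_equiv\<close>
  bounds the norm of \<open>y - x\<close> by a continuous function of the hyperbolic distance that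
  vanishes at zero. Orbit maps can then be treated as maps into the ambient space.\<close>

lemma hyp_topology_eq: "hyp_topology e = top_of_set H"
proof (rule topology_eq[THEN iffD2], intro allI)
  fix U
  interpret MS: Metric_space H D by (rule hyp_Metric_space[OF e_nz])
  have small: "\<exists>\<delta>>0. \<forall>y\<in>H. dist y x < \<delta> \<longrightarrow> D x y < r" if x: "x \<in> H" and r: "r > 0" for x r
  proof -
    have "continuous_on H (\<lambda>y. arcosh (B x y))"
      by (rule continuous_on_compose2[OF continuous_on_arcosh[of "{1..}"]])
        (use continuous_on_B[of H "\<lambda>_. x" "\<lambda>y. y", OF continuous_on_const continuous_on_id] B_ge_1[OF x] in auto)
    then have "continuous_on H (D x)"
      by (rule continuous_on_eq) (simp add: D_arcosh x)
    then obtain \<delta> where "\<delta> > 0" "\<forall>y\<in>H. dist y x < \<delta> \<longrightarrow> dist (D x y) (D x x) < r"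
      using x r unfolding continuous_on_iff by blast
    then show ?thesis using D_self[of x] by (auto simp: dist_real_def)
  qed
  have large: "\<exists>r>0. \<forall>y\<in>H. D x y < r \<longrightarrow> dist y x < \<epsilon>" if x: "x \<in> H" and \<epsilon>: "\<epsilon> > 0" for x \<epsilon>
  proof -
    define K where "K = 4 * (B x e0)\<^sup>2 + 1"
    define h where "h d = K * (2 * (cosh d - 1)\<^sup>2 + 2 * (cosh d - 1))" for d :: real
    have "isCont h 0" unfolding h_def by (intro continuous_intros)
    then obtain r where r: "r > 0" "\<And>d. dist d 0 < r \<Longrightarrow> dist (h d) (h 0) < \<epsilon>\<^sup>2"
      using zero_less_power[OF \<epsilon>, of 2] unfolding continuous_at_eps_delta by blast
    have "dist y x < \<epsilon>" if y: "y \<in> H" and d: "D x y < r" for y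
    proof (rule power2_less_imp_less)
      have "(dist y x)\<^sup>2 \<le> K * (2 * (B (y - x) x)\<^sup>2 - B (y - x) (y - x))"
        using norm_equiv[OF x, of "y - x"] by (simp add: dist_norm K_def)
      also have "\<dots> = h (D x y)"
        using x y by (simp add: h_def cosh_D lorentz_simps B_HH lorentz_commute[of e y x])
      also have "\<dots> < \<epsilon>\<^sup>2" using r(2)[of "D x y"] d by (simp add: dist_real_def h_def)
      finally show "(dist y x)\<^sup>2 < \<epsilon>\<^sup>2" .
    qed (use \<epsilon> in simp)
    then show ?thesis using r(1) by blast
  qed
  show "openin (hyp_topology e) U = openin (top_of_set H) U"
    unfolding hyp_topology_def MS.openin_mtopology openin_euclidean_subtopology_iff
  proof (intro iffI conjI)
    assume U: "U \<subseteq> H \<and> (\<forall>x. x \<in> U \<longrightarrow> (\<exists>r>0. MS.mball x r \<subseteq> U))"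
    show "\<forall>x\<in>U. \<exists>\<epsilon>>0. \<forall>y\<in>H. dist y x < \<epsilon> \<longrightarrow> y \<in> U"
    proof
      fix x assume x: "x \<in> U"
      have xH: "x \<in> H" using U x by blast
      obtain r where r: "r > 0" "MS.mball x r \<subseteq> U" using U x by blast
      obtain \<delta> where d: "\<delta> > 0" "\<And>y. y \<in> H \<Longrightarrow> dist y x < \<delta> \<Longrightarrow> D x y < r" using small[OF xH r(1)] by blast
      have "y \<in> U" if "y \<in> H" "dist y x < \<delta>" for y
        using r(2) d(2)[OF that] xH that(1) by (simp add: subset_iff)
      then show "\<exists>\<epsilon>>0. \<forall>y\<in>H. dist y x < \<epsilon> \<longrightarrow> y \<in> U" using d(1) by blast
    qed
  next
    assume U: "U \<subseteq> H \<and> (\<forall>x\<in>U. \<exists>\<epsilon>>0. \<forall>y\<in>H. dist y x < \<epsilon> \<longrightarrow> y \<in> U)"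
    show "\<forall>x. x \<in> U \<longrightarrow> (\<exists>r>0. MS.mball x r \<subseteq> U)"
    proof (intro allI impI)
      fix x assume x: "x \<in> U"
      have xH: "x \<in> H" using U x by blast
      obtain \<epsilon> where ep: "\<epsilon> > 0" "\<And>y. y \<in> H \<Longrightarrow> dist y x < \<epsilon> \<Longrightarrow> y \<in> U" using U x by blast
      obtain r where r: "r > 0" "\<And>y. y \<in> H \<Longrightarrow> D x y < r \<Longrightarrow> dist y x < \<epsilon>" using large[OF xH ep(1)] by blast
      have "MS.mball x r \<subseteq> U" using ep(2) r(2) by (simp add: subset_iff)
      then show "\<exists>r>0. MS.mball x r \<subseteq> U" using r(1) by blast
    qed
  qed auto
qed

lemma restrict_Isom: assumes A: "A \<in> LO" shows "restrict A H \<in> carrier (Isom e)"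
proof -
  have "A ` H = H"
    using LO_H[OF A] LO_H[OF LO_inv(1)[OF A]] LO_inv(3)[OF A] by (metis image_subsetI rev_image_eqI subsetI subset_antisym)
  then have "bij_betw A H H" using LO_bij[OF A] by (metis bij_betw_subset subset_UNIV bij_betw_def inj_on_subset)
  then have "restrict A H \<in> Bij H" unfolding Bij_def by (auto simp: bij_betw_restrict_eq)
  then show ?thesis by (simp add: Isom_def D_LO[OF A])
qed

lemma lin_ext_props: assumes g: "g \<in> carrier (Isom e)"
  shows "linear (lin_ext e g)" "B (lin_ext e g v) (lin_ext e g w) = B v w" "x \<in> H \<Longrightarrow> lin_ext e g x = g x"
  using theI'[OF lin_ext_ex1[OF e_nz g]] unfolding lin_ext_def[symmetric] by auto

lemma lin_ext_LO: assumes g: "g \<in> carrier (Isom e)" shows "lin_ext e g \<in> LO"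
proof (rule LO_I[where x = e0])
  note p = lin_ext_props[OF g]
  show "linear (lin_ext e g)" by (rule p(1))
  show "B (lin_ext e g v) (lin_ext e g w) = B v w" for v w by (rule p(2))
  show "lin_ext e g e0 \<in> H" using p(3) Isom_apply(2)[OF g] by simp
  have "inj (lin_ext e g)"
    by (rule injI) (metis B_eqI p(2))
  moreover have "range (lin_ext e g) = UNIV"
  proof -
    have "lin_ext e g ` H = H" using Isom_apply(1)[OF g] p(3) by (metis image_cong)
    then have "span H = lin_ext e g ` span H" using linear_span_image[OF p(1), of H] by simp
    then show ?thesis by (simp add: span_hyp_space[OF e_nz])
  qed
  ultimately show "bij (lin_ext e g)" by (simp add: bij_def)
qed simp

lemma lin_ext_restrict: assumes A: "A \<in> LO" shows "lin_ext e (restrict A H) = A"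
  using lin_ext_props[OF restrict_Isom[OF A]] LO_linear[OF A]
  by (intro LO_eqI[OF lin_ext_LO[OF restrict_Isom[OF A]] A]) simp

lemma restrict_lin_ext: assumes g: "g \<in> carrier (Isom e)" shows "restrict (lin_ext e g) H = g"
proof
  fix x
  have "g \<in> extensional H" using g by (simp add: Isom_def Bij_def)
  then show "restrict (lin_ext e g) H x = g x"
    using lin_ext_props(3)[OF g] by (auto simp: restrict_def extensional_def)
qed

lemma Isom_mult:
  assumes "g \<in> carrier (Isom e)" "h \<in> carrier (Isom e)"
  shows "g \<otimes>\<^bsub>Isom e\<^esub> h = compose H g h"
  using assms by (simp add: Isom_def BijGroup_def)

lemma lin_ext_mult:
  assumes g: "g \<in> carrier (Isom e)" and h: "h \<in> carrier (Isom e)"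
  shows "lin_ext e (g \<otimes>\<^bsub>Isom e\<^esub> h) = lin_ext e g \<circ> lin_ext e h"
proof -
  have gh: "g \<otimes>\<^bsub>Isom e\<^esub> h \<in> carrier (Isom e)"
    using group.is_monoid[OF Isom_group] g h by (rule monoid.m_closed)
  show ?thesis
  proof (rule LO_eqI[OF lin_ext_LO[OF gh] LO_comp[OF lin_ext_LO[OF g] lin_ext_LO[OF h]]])
    fix x assume x: "x \<in> H"
    have "lin_ext e (g \<otimes>\<^bsub>Isom e\<^esub> h) x = compose H g h x"
      using lin_ext_props(3)[OF gh x] unfolding Isom_mult[OF g h] .
    then show "lin_ext e (g \<otimes>\<^bsub>Isom e\<^esub> h) x = (lin_ext e g \<circ> lin_ext e h) x"
      using x by (simp add: lin_ext_props(3)[OF g] lin_ext_props(3)[OF h] Isom_apply(2)[OF h] compose_def)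
  qed
qed

lemma restrict_mult:
  assumes A: "A \<in> LO" and A': "A' \<in> LO"
  shows "restrict A H \<otimes>\<^bsub>Isom e\<^esub> restrict A' H = restrict (A \<circ> A') H"
  unfolding Isom_mult[OF restrict_Isom[OF A] restrict_Isom[OF A']]
  using LO_H[OF A'] by (auto simp: compose_def restrict_def)

lemma transl_length_eq: "g \<in> carrier (Isom e) \<Longrightarrow> transl_length e g = tlen (lin_ext e g)"
  unfolding transl_length_def tlen_def by (intro INF_cong refl) (simp add: lin_ext_props(3))

end

section \<open>Compactness in finite dimension\<close>

locale euclidean_lorentz = lorentz_space e for e :: "'a::euclidean_space"
begin

lemma LO_I_finite:
  assumes A: "linear A" "\<And>v w. B (A v) (A w) = B v w" and x: "B (A e0) e0 > 0"
  shows "A \<in> LO"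
proof (rule LO_I[OF A(1) _ A(2) e0_H])
  have inj: "inj A" by (rule injI) (metis B_eqI A(2))
  have "surj A" by (rule linear_injective_imp_surjective[OF A(1) inj]) (rule refl)
  with inj show "bij A" by (simp add: bij_def)
  show "A e0 \<in> H" using A(2)[of e0 e0] x by (simp add: H_iff)
qed

text \<open>Boundedness is \<open>LO_norm\<close>. Closedness holds because
  \<open>LO_I_finite\<close> reduces membership to closed conditions, with
  \<open>1 \<le> \<phi>\<close> in place of the open condition of positivity.\<close>

lemma compact_LO: "compact {T :: 'a \<Rightarrow>\<^sub>L 'a. blinfun_apply T \<in> LO \<and> \<phi> (blinfun_apply T) \<le> r}" (is "compact ?S")
  unfolding compact_eq_bounded_closed
proof
  have "norm T \<le> sqrt (4 * r\<^sup>2 + 1)" if T: "T \<in> ?S" for T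
  proof (rule norm_blinfun_bound)
    fix v :: 'a
    have "\<phi> T \<ge> 1" "\<phi> T \<le> r" using T \<phi>_ge1 by auto
    then have "(\<phi> T)\<^sup>2 \<le> r\<^sup>2" by (intro power_mono) auto
    then have "(4 * (\<phi> T)\<^sup>2 + 1) * (norm v)\<^sup>2 \<le> (4 * r\<^sup>2 + 1) * (norm v)\<^sup>2" by (intro mult_right_mono) auto
    then have "(norm (T v))\<^sup>2 \<le> (4 * r\<^sup>2 + 1) * (norm v)\<^sup>2"
      using LO_norm[of T v] T unfolding \<phi>_def by simp
    also have "\<dots> = (sqrt (4 * r\<^sup>2 + 1) * norm v)\<^sup>2" by (simp add: power_mult_distrib add_nonneg_nonneg)
    finally show "norm (T v) \<le> sqrt (4 * r\<^sup>2 + 1) * norm v" by (rule power2_le_imp_le) simp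
  qed simp
  then show "bounded ?S" unfolding bounded_iff by blast
  have "?S = {T. (\<forall>v w. B (blinfun_apply T v) (blinfun_apply T w) = B v w) \<and> 1 \<le> B (blinfun_apply T e0) e0 \<and> B (blinfun_apply T e0) e0 \<le> r}" (is "_ = ?S'")
  proof
    show "?S \<subseteq> ?S'" using LO_B \<phi>_ge1 unfolding \<phi>_def by blast
    show "?S' \<subseteq> ?S"
      by (auto simp: \<phi>_def intro!: LO_I_finite bounded_linear.linear[OF blinfun.bounded_linear_right])
  qed
  also have "closed ?S'"
    by (intro closed_Collect_conj closed_Collect_all closed_Collect_eq closed_Collect_le continuous_intros)
  finally show "closed ?S" .
qed

text \<open>Links the two topologies in play: compactness is available for the operator norm,
  whereas the isometry group carries pointwise convergence.\<close>

lemma continuous_map_restrict: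
  assumes S: "\<And>T. T \<in> S \<Longrightarrow> blinfun_apply T \<in> LO"
  shows "continuous_map (top_of_set S) (Isom_topology e) (\<lambda>T :: 'a \<Rightarrow>\<^sub>L 'a. restrict (blinfun_apply T) H)"
  unfolding Isom_topology_def continuous_map_in_subtopology
proof
  show "continuous_map (top_of_set S) (product_topology (\<lambda>_. hyp_topology e) H) (\<lambda>T. restrict (blinfun_apply T) H)"
    unfolding continuous_map_componentwise
  proof (intro conjI ballI)
    fix x assume x: "x \<in> H"
    have "continuous_map (top_of_set S) (top_of_set H) (\<lambda>T. blinfun_apply T x)"
      by (intro continuous_map_into_subtopology)
        (use S LO_H x in \<open>auto simp: continuous_map_iff_continuous intro!: continuous_intros\<close>)
    then show "continuous_map (top_of_set S) (hyp_topology e) (\<lambda>T. restrict (blinfun_apply T) H x)"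
      using x by (simp add: hyp_topology_eq)
  qed auto
qed (use S restrict_Isom in auto)

end

lemma ex_orthonormal_triple:
  fixes x :: "'a::euclidean_space"
  assumes "DIM('a) \<ge> 3"
  obtains f g where "inner f f = 1" "inner f x = 0" "inner g g = 1" "inner g x = 0" "inner g f = 0"
proof -
  have "dim {x} < DIM('a)" using dim_le_card'[of "{x}"] assms by simp
  then obtain f where f: "f \<noteq> 0" "\<And>y. y \<in> span {x} \<Longrightarrow> orthogonal f y"
    using orthogonal_to_subspace_exists by blast
  have "card {x, f} \<le> 2" by (simp add: card_insert_if)
  then have "dim {x, f} < DIM('a)" using dim_le_card'[of "{x, f}"] assms by simp
  then obtain g where g: "g \<noteq> 0" "\<And>y. y \<in> span {x, f} \<Longrightarrow> orthogonal g y"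
    using orthogonal_to_subspace_exists by blast
  show ?thesis
  proof (rule that[of "sgn f" "sgn g"])
    show "inner (sgn f) (sgn f) = 1" "inner (sgn g) (sgn g) = 1"
      using f g by (simp_all add: norm_eq_1[symmetric] norm_sgn)
    show "inner (sgn f) x = 0" using f(2)[of x] by (simp add: sgn_div_norm orthogonal_def span_base)
    show "inner (sgn g) x = 0" "inner (sgn g) (sgn f) = 0"
      using g(2)[of x] g(2)[of f] by (simp_all add: sgn_div_norm orthogonal_def span_base)
  qed
qed

locale euclidean_frame = euclidean_lorentz b + lorentz_frame b f g for b f g :: "'m::euclidean_space"

section \<open>Continuous non-elementary actions as linear representations\<close>

locale hyp_action = M: euclidean_frame b f g + N: complete_lorentz_space e
  for b f g :: "'m::euclidean_space" and e :: "'h::{real_inner,complete_space}" +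
  fixes \<rho> :: "('m \<Rightarrow> 'm) \<Rightarrow> 'h \<Rightarrow> 'h"
  assumes hom: "\<rho> \<in> hom (Isom b) (Isom e)"
    and cont: "continuous_action (Isom_topology b) e \<rho>"
    and nonelementary: "\<not> elementary_action (Isom b) e \<rho>"
begin

definition R where "R A = lin_ext e (\<rho> (restrict A M.H))"

lemma \<rho>_carrier: "h \<in> carrier (Isom b) \<Longrightarrow> \<rho> h \<in> carrier (Isom e)"
  using hom by (auto simp: hom_def)

lemma R_lin_ext: "h \<in> carrier (Isom b) \<Longrightarrow> R (lin_ext b h) = lin_ext e (\<rho> h)"
  by (simp add: R_def M.restrict_lin_ext)

lemma R_apply: "h \<in> carrier (Isom b) \<Longrightarrow> x \<in> N.H \<Longrightarrow> R (lin_ext b h) x = \<rho> h x"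
  by (simp add: R_lin_ext N.lin_ext_props(3)[OF \<rho>_carrier])

lemma R_LO: "A \<in> M.LO \<Longrightarrow> R A \<in> N.LO"
  unfolding R_def by (intro N.lin_ext_LO \<rho>_carrier M.restrict_Isom)

lemma R_comp: assumes "A \<in> M.LO" "A' \<in> M.LO" shows "R (A \<circ> A') = R A \<circ> R A'"
proof -
  note c = M.restrict_Isom[OF assms(1)] M.restrict_Isom[OF assms(2)]
  have "\<rho> (restrict (A \<circ> A') M.H) = \<rho> (restrict A M.H) \<otimes>\<^bsub>Isom e\<^esub> \<rho> (restrict A' M.H)"
    using hom_mult[OF hom c] by (simp add: M.restrict_mult assms)
  then show ?thesis unfolding R_def using N.lin_ext_mult \<rho>_carrier c by simp
qed

text \<open>The linear maps of bounded displacement form a compact set of operators, on which the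
  continuous function \<open>?h\<close> is bounded.\<close>

lemma R_bdd: "\<exists>K. \<forall>A\<in>M.LO. M.\<phi> A \<le> r \<longrightarrow> N.\<phi> (R A) \<le> K"
proof -
  let ?S = "{T :: 'm \<Rightarrow>\<^sub>L 'm. blinfun_apply T \<in> M.LO \<and> M.\<phi> (blinfun_apply T) \<le> r}"
  let ?h = "\<lambda>T :: 'm \<Rightarrow>\<^sub>L 'm. N.B (\<rho> (restrict (blinfun_apply T) M.H) N.e0) N.e0"
  have 1: "continuous_map (top_of_set ?S) (Isom_topology b) (\<lambda>T. restrict (blinfun_apply T) M.H)"
    by (rule M.continuous_map_restrict) simp
  have 2: "continuous_map (Isom_topology b) (top_of_set N.H) (\<lambda>h. \<rho> h N.e0)"
    using cont N.e0_H unfolding continuous_action_def N.hyp_topology_eq by blast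
  have 3: "continuous_map (top_of_set N.H) euclideanreal (\<lambda>y. N.B y N.e0)"
    unfolding continuous_map_iff_continuous
    by (rule N.continuous_on_B[OF continuous_on_id continuous_on_const])
  have "continuous_on ?S ?h"
    using continuous_map_compose[OF continuous_map_compose[OF 1 2] 3]
    unfolding continuous_map_iff_continuous by (simp only: o_def)
  then have "compact (?h ` ?S)" using M.compact_LO compact_continuous_image by blast
  then have "bounded (?h ` ?S)" by (rule compact_imp_bounded)
  then obtain K where K: "\<And>T. T \<in> ?S \<Longrightarrow> \<bar>?h T\<bar> \<le> K" unfolding bounded_iff by auto
  have "N.\<phi> (R A) \<le> K" if A: "A \<in> M.LO" "M.\<phi> A \<le> r" for A
  proof -
    define T where "T = Blinfun A"
    have T: "blinfun_apply T = A" unfolding T_def by (rule bounded_linear_Blinfun_apply[OF M.LO_bounded[OF A(1)]])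
    then have "T \<in> ?S" using A by simp
    from K[OF this] have "?h T \<le> K" by simp
    moreover have "R A N.e0 = \<rho> (restrict A M.H) N.e0"
      unfolding R_def using N.lin_ext_props(3)[OF \<rho>_carrier[OF M.restrict_Isom[OF A(1)]] N.e0_H] .
    ultimately show ?thesis by (simp add: N.\<phi>_def T)
  qed
  then show ?thesis by blast
qed

lemma fixed_point_elementary:
  assumes "x \<in> N.H" "\<And>A. A \<in> M.LO \<Longrightarrow> R A x = x" shows False
proof -
  have "\<rho> h x = x" if "h \<in> carrier (Isom b)" for h
    using assms(2)[OF M.lin_ext_LO[OF that]] R_apply[OF that assms(1)] by simp
  then show False using nonelementary assms(1) unfolding elementary_action_def by blast
qed

lemma fixed_ray_elementary:
  assumes u: "u \<in> N.C" and c: "\<And>A. A \<in> M.LO \<Longrightarrow> \<exists>c. R A u = c *\<^sub>R u" shows False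
proof -
  have "lin_ext e (\<rho> h) ` span {u} = span {u}" if h: "h \<in> carrier (Isom b)" for h
  proof -
    let ?A = "lin_ext b h"
    obtain c where c: "R ?A u = c *\<^sub>R u" using c[OF M.lin_ext_LO[OF h]] by blast
    have c0: "c \<noteq> 0" using N.C_nz[OF N.LO_C[OF R_LO[OF M.lin_ext_LO[OF h]] u]] c by auto
    have "lin_ext e (\<rho> h) ` span {u} = span (lin_ext e (\<rho> h) ` {u})"
      by (rule linear_span_image[OF N.lin_ext_props(1)[OF \<rho>_carrier[OF h]], symmetric])
    also have "\<dots> = span {c *\<^sub>R u}" using c by (simp add: R_lin_ext[OF h])
    also have "\<dots> = span {u}"
    proof -
      have "(1 / c) *\<^sub>R (c *\<^sub>R u) \<in> span {c *\<^sub>R u}" by (intro span_scale span_base) simp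
      then show ?thesis using c0 by (simp add: span_eq span_scale span_base)
    qed
    finally show ?thesis .
  qed
  moreover have "span {u} \<in> hyp_boundary e"
    using u N.C_nz[OF u] unfolding hyp_boundary_def N.C_def by blast
  ultimately show False using nonelementary unfolding elementary_action_def by blast
qed

sublocale rep: hyp_rep b f g e R
proof unfold_locales
  show "\<not> (\<exists>x\<in>N.H. \<forall>A\<in>M.LO. R A x = x)" using fixed_point_elementary by blast
  show "\<not> (\<exists>u\<in>N.C. \<forall>A\<in>M.LO. \<exists>c. R A u = c *\<^sub>R u)" using fixed_ray_elementary by blast
qed (use R_LO R_comp R_bdd in auto)

lemma transl_length_\<rho>:
  assumes h: "h \<in> carrier (Isom b)"
  shows "transl_length e (\<rho> h) = rep.\<tau> * transl_length b h"
  using rep.tlen_R[OF M.lin_ext_LO[OF h]]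
  by (simp add: N.transl_length_eq[OF \<rho>_carrier[OF h]] M.transl_length_eq[OF h] R_lin_ext[OF h])

lemma \<rho>_image: assumes "h \<in> carrier (Isom b)" "X \<subseteq> N.H" shows "\<rho> h ` X = R (lin_ext b h) ` X"
  using R_apply[OF assms(1)] assms(2) by (intro image_cong) auto

lemma \<tau>_eq_1_iff:
  assumes dim: "DIM('m) = n + 1"
  shows "rep.\<tau> = 1 \<longleftrightarrow> (\<exists>X. totally_geodesic_dim e n X \<and> (\<forall>h\<in>carrier (Isom b). \<rho> h ` X = X))"
proof
  assume "rep.\<tau> = 1"
  from rep.invariant_subspace[OF this] obtain X and T :: "'m \<Rightarrow> 'h"
    where X: "linear T" "inj T" "totally_geodesic e X" "span X = range T" "\<And>A. A \<in> M.LO \<Longrightarrow> R A ` X = X"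
    by blast
  have "X \<subseteq> N.H" using X(3) by (simp add: totally_geodesic_def)
  then have inv: "\<rho> h ` X = X" if "h \<in> carrier (Isom b)" for h
    using \<rho>_image[OF that] X(5)[OF M.lin_ext_LO[OF that]] by simp
  have "independent (T ` Basis)"
    using linear_independent_injective_image[OF X(1) independent_Basis] X(2) inj_on_subset by blast
  moreover have "span (T ` Basis) = span (span X)"
    unfolding X(4) using linear_span_image[OF X(1), of Basis] by (simp add: linear_subspace_image[OF X(1)] span_eq_iff[THEN iffD2])
  ultimately have "dim (span X) = card (T ` Basis)" by (rule dim_eq_card[rotated])
  also have "\<dots> = n + 1" using card_image[OF inj_on_subset[OF X(2) subset_UNIV], of Basis] dim by simp
  finally show "\<exists>X. totally_geodesic_dim e n X \<and> (\<forall>h\<in>carrier (Isom b). \<rho> h ` X = X)"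
    using X(3) inv unfolding totally_geodesic_dim_def by blast
next
  assume "\<exists>X. totally_geodesic_dim e n X \<and> (\<forall>h\<in>carrier (Isom b). \<rho> h ` X = X)"
  then obtain X where X: "totally_geodesic e X" "dim (span X) = n + 1" "\<And>h. h \<in> carrier (Isom b) \<Longrightarrow> \<rho> h ` X = X"
    unfolding totally_geodesic_dim_def by blast
  have XH: "X \<subseteq> N.H" using X(1) by (simp add: totally_geodesic_def)
  obtain S where S: "S \<subseteq> span X" "independent S" "span X \<subseteq> span S" "card S = dim (span X)"
    by (rule basis_exists)
  \<comment> \<open>\<open>card\<close> is zero on infinite sets, and \<open>n + 1\<close> is
    not.\<close>
  have fin: "finite S" using S(4) X(2) by (metis Suc_eq_plus1 card.infinite nat.simps(3))
  show "rep.\<tau> = 1"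
  proof (rule rep.invariant_finite_dim[OF XH _ _ fin])
    \<comment> \<open>An empty \<open>X\<close> would have a span of dimension zero.\<close>
    show "X \<noteq> {}" using X(2) dim_eq_card_independent[OF independent_empty, where 'a = 'h] by auto
    show "span X = span S" using S(1,3) by (metis span_minimal subset_antisym subspace_span)
    show "R A ` X \<subseteq> X" if A: "A \<in> M.LO" for A
      using X(3)[OF M.restrict_Isom[OF A]] \<rho>_image[OF M.restrict_Isom[OF A] XH] M.lin_ext_restrict[OF A] by simp
  qed
qed

end

section \<open>Uniqueness of irreducible representations\<close>

lemma subspace_closure:
  fixes S :: "'a::real_normed_vector set"
  assumes S: "subspace S"
  shows "subspace (closure S)"
proof (rule subspaceI)
  show "0 \<in> closure S" using subspace_0[OF S] closure_subset by blast
  show "x + y \<in> closure S" if "x \<in> closure S" "y \<in> closure S" for x y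
  proof -
    obtain p q where "\<And>n. p n \<in> S" "p \<longlonglongrightarrow> x" "\<And>n. q n \<in> S" "q \<longlonglongrightarrow> y"
      using \<open>x \<in> closure S\<close> \<open>y \<in> closure S\<close> unfolding closure_sequential by blast
    then have "\<forall>n. p n + q n \<in> S" "(\<lambda>n. p n + q n) \<longlonglongrightarrow> x + y"
      by (auto intro: subspace_add[OF S] tendsto_add)
    then show ?thesis unfolding closure_sequential by (intro exI[of _ "\<lambda>n. p n + q n"]) simp
  qed
  show "c *\<^sub>R x \<in> closure S" if "x \<in> closure S" for c x
  proof -
    obtain p where "\<And>n. p n \<in> S" "p \<longlonglongrightarrow> x"
      using \<open>x \<in> closure S\<close> unfolding closure_sequential by blast
    then have "\<forall>n. c *\<^sub>R p n \<in> S" "(\<lambda>n. c *\<^sub>R p n) \<longlonglongrightarrow> c *\<^sub>R x"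
      by (auto intro: subspace_scale[OF S] tendsto_scaleR)
    then show ?thesis unfolding closure_sequential by (intro exI[of _ "\<lambda>n. c *\<^sub>R p n"]) simp
  qed
qed

text \<open>Equal Gram matrices make \<open>F i \<mapsto> F' i\<close> isometric on the spans; it
  extends to the closures by uniform continuity, and completeness gives surjectivity onto the second
  closure. \<open>U\<close> is specified on the closed span only, so linearity is stated
  there.\<close>

lemma unitary_extension:
  fixes F :: "'i \<Rightarrow> 'a::{real_inner,complete_space}" and F' :: "'i \<Rightarrow> 'b::{real_inner,complete_space}"
  assumes gram: "\<And>i j. i \<in> I \<Longrightarrow> j \<in> I \<Longrightarrow> inner (F i) (F j) = inner (F' i) (F' j)"
  shows "\<exists>U. (\<forall>v\<in>closure (span (F ` I)). \<forall>w\<in>closure (span (F ` I)). U (v + w) = U v + U w \<and> inner (U v) (U w) = inner v w) \<and>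
    (\<forall>c. \<forall>v\<in>closure (span (F ` I)). U (c *\<^sub>R v) = c *\<^sub>R U v) \<and>
    U ` closure (span (F ` I)) = closure (span (F' ` I)) \<and> (\<forall>i\<in>I. U (F i) = F' i)"
proof -
  let ?X = "span (F ` I)" and ?X' = "span (F' ` I)"
  obtain S where S: "S \<subseteq> F ` I" "independent S" "F ` I \<subseteq> span S"
    by (rule maximal_independent_subset)
  have spS: "span S = ?X" using S(1,3) by (metis span_minimal span_mono subset_antisym subspace_span)
  define ix where "ix s = (SOME i. i \<in> I \<and> F i = s)" for s
  have ix: "ix s \<in> I" "F (ix s) = s" if "s \<in> S" for s
    using someI_ex[of "\<lambda>i. i \<in> I \<and> F i = s"] S(1) that by (auto simp: ix_def)
  obtain T where T: "linear T" "\<And>s. s \<in> S \<Longrightarrow> T s = F' (ix s)"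
    using linear_independent_extend[OF S(2), of "\<lambda>s. F' (ix s)"] by blast
  have linT: "linear (\<lambda>v. inner (T v) w)" for w
    using linear_compose[OF T(1) bounded_linear.linear[OF bounded_linear_inner_left]] by (simp only: o_def)
  have linI: "linear (\<lambda>v :: 'a. inner v w)" for w
    by (rule bounded_linear.linear[OF bounded_linear_inner_left])
  have TF: "inner (T v) (F' i) = inner v (F i)" if "v \<in> ?X" "i \<in> I" for v i
    by (rule linear_eq_on[OF linT linI, of v S])
      (use that spS T(2) ix gram in \<open>auto simp: T(2)\<close>, metis gram ix)
  have TT: "inner (T v) (T w) = inner v w" if v: "v \<in> ?X" and w: "w \<in> ?X" for v w
  proof (rule linear_eq_on[OF linT linI, of v S])
    show "v \<in> span S" using v spS by simp
    fix s assume s: "s \<in> S"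
    have "inner (T s) (T w) = inner (T w) (F' (ix s))" using T(2)[OF s] by (simp add: inner_commute)
    also have "\<dots> = inner w (F (ix s))" by (rule TF[OF w ix(1)[OF s]])
    finally show "inner (T s) (T w) = inner s w" using ix(2)[OF s] by (simp add: inner_commute)
  qed
  \<comment> \<open>The index chosen for a basis vector need not be \<open>i\<close>; agreement at
    every index follows from the vanishing norm of the difference.\<close>
  have TFi: "T (F i) = F' i" if i: "i \<in> I" for i
  proof -
    have Fi: "F i \<in> ?X" using i by (intro span_base) simp
    have "inner (T (F i) - F' i) (T (F i) - F' i) = 0"
      using TT[OF Fi Fi] TF[OF Fi i] gram[OF i i] by (simp add: inner_diff inner_commute)
    then show ?thesis by simp
  qed
  have nT: "norm (T v - T w) = norm (v - w)" if "v \<in> ?X" "w \<in> ?X" for v w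
    using TT[of "v - w" "v - w"] that by (simp add: norm_eq_sqrt_inner linear_diff[OF T(1), symmetric] span_diff)
  have TX: "T ` ?X = ?X'"
    using linear_span_image[OF T(1), of "F ` I"] TFi by (simp add: image_image cong: image_cong)
  have "uniformly_continuous_on ?X T"
    unfolding uniformly_continuous_on_def using nT by (auto simp: dist_norm)
  then obtain U where U: "uniformly_continuous_on (closure ?X) U" "\<And>x. x \<in> ?X \<Longrightarrow> T x = U x"
    by (rule uniformly_continuous_on_extension_on_closure) blast
  have Ulim: "(\<lambda>n. T (x n)) \<longlonglongrightarrow> U v" if "\<And>n. x n \<in> ?X" "x \<longlonglongrightarrow> v" for x v
  proof -
    have "v \<in> closure ?X" using that closure_sequential by blast
    then have "(\<lambda>n. U (x n)) \<longlonglongrightarrow> U v"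
      using continuous_on_tendsto_compose[OF uniformly_continuous_imp_continuous[OF U(1)] that(2)] that(1) closure_subset
      by (auto simp: eventually_sequentially)
    then show ?thesis using U(2) that(1) by simp
  qed
  have seq: "\<exists>x. (\<forall>n. x n \<in> ?X) \<and> x \<longlonglongrightarrow> v" if "v \<in> closure ?X" for v
    using that closure_sequential by blast
  show ?thesis
  proof (rule exI[of _ U], intro conjI ballI allI)
    fix v w assume v: "v \<in> closure ?X" and w: "w \<in> closure ?X"
    obtain x where x: "\<And>n. x n \<in> ?X" "x \<longlonglongrightarrow> v" using seq[OF v] by blast
    obtain y where y: "\<And>n. y n \<in> ?X" "y \<longlonglongrightarrow> w" using seq[OF w] by blast
    have "(\<lambda>n. T (x n + y n)) \<longlonglongrightarrow> U (v + w)"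
      by (rule Ulim) (use x y in \<open>auto intro: span_add tendsto_add\<close>)
    then have "(\<lambda>n. T (x n) + T (y n)) \<longlonglongrightarrow> U (v + w)" by (simp add: linear_add[OF T(1)])
    moreover have "(\<lambda>n. T (x n) + T (y n)) \<longlonglongrightarrow> U v + U w" by (intro tendsto_add Ulim x y)
    ultimately show "U (v + w) = U v + U w" using LIMSEQ_unique by blast
    have "(\<lambda>n. inner (T (x n)) (T (y n))) \<longlonglongrightarrow> inner (U v) (U w)" by (intro tendsto_inner Ulim x y)
    then have "(\<lambda>n. inner (x n) (y n)) \<longlonglongrightarrow> inner (U v) (U w)" using TT x(1) y(1) by simp
    moreover have "(\<lambda>n. inner (x n) (y n)) \<longlonglongrightarrow> inner v w" by (intro tendsto_inner x y)
    ultimately show "inner (U v) (U w) = inner v w" using LIMSEQ_unique by blast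
  next
    fix c v assume v: "v \<in> closure ?X"
    obtain x where x: "\<And>n. x n \<in> ?X" "x \<longlonglongrightarrow> v" using seq[OF v] by blast
    have "(\<lambda>n. T (c *\<^sub>R x n)) \<longlonglongrightarrow> U (c *\<^sub>R v)"
      by (rule Ulim) (use x in \<open>auto intro: span_scale tendsto_scaleR\<close>)
    then have "(\<lambda>n. c *\<^sub>R T (x n)) \<longlonglongrightarrow> U (c *\<^sub>R v)" by (simp add: linear_scale[OF T(1)])
    moreover have "(\<lambda>n. c *\<^sub>R T (x n)) \<longlonglongrightarrow> c *\<^sub>R U v" by (intro tendsto_scaleR tendsto_const Ulim x)
    ultimately show "U (c *\<^sub>R v) = c *\<^sub>R U v" using LIMSEQ_unique by blast
  next
    fix i assume "i \<in> I"
    then show "U (F i) = F' i" using U(2)[of "F i"] TFi by (simp add: span_base)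
  next
    show "U ` closure ?X = closure ?X'"
    proof
      show "U ` closure ?X \<subseteq> closure ?X'"
      proof
        fix w assume "w \<in> U ` closure ?X"
        then obtain v where v: "v \<in> closure ?X" "w = U v" by blast
        obtain x where x: "\<And>n. x n \<in> ?X" "x \<longlonglongrightarrow> v" using seq[OF v(1)] by blast
        have "\<forall>n. T (x n) \<in> ?X'" using x(1) TX by blast
        then show "w \<in> closure ?X'" unfolding closure_sequential v(2)
          by (intro exI[of _ "\<lambda>n. T (x n)"] conjI Ulim x)
      qed
      show "closure ?X' \<subseteq> U ` closure ?X"
      proof
        fix w assume "w \<in> closure ?X'"
        then obtain y where y: "\<And>n. y n \<in> ?X'" "y \<longlonglongrightarrow> w" unfolding closure_sequential by blast
        have "\<forall>n. \<exists>x. x \<in> ?X \<and> T x = y n" using y(1) TX by (metis imageE)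
        then obtain x where x: "\<And>n. x n \<in> ?X" "\<And>n. T (x n) = y n" by metis
        have "Cauchy y" using y(2) by (rule LIMSEQ_imp_Cauchy)
        then have "Cauchy x" unfolding Cauchy_def using nT[OF x(1) x(1)] by (simp add: x(2) dist_norm)
        then obtain v where v: "x \<longlonglongrightarrow> v" using Cauchy_convergent convergent_def by blast
        have "y \<longlonglongrightarrow> U v" using Ulim[OF x(1) v] x(2) by simp
        then have "w = U v" using y(2) LIMSEQ_unique by blast
        moreover have "v \<in> closure ?X" using x(1) v unfolding closure_sequential by blast
        ultimately show "w \<in> U ` closure ?X" by blast
      qed
    qed
  qed
qed

section \<open>Lorentz isometries determined by Gram matrices\<close>

context complete_lorentz_space begin

lemma LO_dense:
  assumes A: "A \<in> LO" and d: "closure (span S) = UNIV"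
  shows "closure (span (A ` S)) = UNIV"
proof -
  have "A ` closure (span S) \<subseteq> closure (A ` span S)"
    by (rule closure_bounded_linear_image_subset[OF LO_bounded[OF A]])
  then have "range A \<subseteq> closure (span (A ` S))" using d linear_span_image[OF LO_linear[OF A], of S] by simp
  then show ?thesis using LO_bij[OF A] by (auto simp: bij_def)
qed

lemma LO_eq_dense:
  assumes A: "A \<in> LO" "A' \<in> LO" and d: "closure (span S) = UNIV" and eq: "\<And>s. s \<in> S \<Longrightarrow> A s = A' s"
  shows "A = A'"
proof
  fix v
  have "v \<in> closure (span S)" using d by simp
  then obtain x where x: "\<And>n. x n \<in> span S" "x \<longlonglongrightarrow> v" unfolding closure_sequential by blast
  have "A (x n) = A' (x n)" for n
    by (rule linear_eq_on[OF LO_linear[OF A(1)] LO_linear[OF A(2)] x(1) eq])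
  then have "(\<lambda>n. A (x n)) \<longlonglongrightarrow> A' v" using tendsto_LO[OF A(2) x(2)] by simp
  then show "A v = A' v" using tendsto_LO[OF A(1) x(2)] LIMSEQ_unique by blast
qed

text \<open>The point \<open>k *\<^sub>R (F i0 + F j0)\<close> and its counterpart are moved to
  \<open>e0\<close>. Being combinations of the given vectors, they have matching products with all
  of them, so \<open>inner_B\<close> turns equal Lorentz Gram matrices into equal Euclidean
  ones.\<close>

lemma lorentz_extension:
  fixes F F' :: "'i \<Rightarrow> 'a"
  assumes gram: "\<And>i j. i \<in> I \<Longrightarrow> j \<in> I \<Longrightarrow> B (F i) (F j) = B (F' i) (F' j)"
    and d: "closure (span (F ` I)) = UNIV" "closure (span (F' ` I)) = UNIV"
    and ij: "i0 \<in> I" "j0 \<in> I" and p: "k *\<^sub>R (F i0 + F j0) \<in> H" "k *\<^sub>R (F' i0 + F' j0) \<in> H"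
  shows "\<exists>A\<in>LO. \<forall>i\<in>I. A (F i) = F' i"
proof -
  let ?p = "k *\<^sub>R (F i0 + F j0)" and ?p' = "k *\<^sub>R (F' i0 + F' j0)"
  obtain G where G: "G \<in> LO" "G ?p = e0" using refl_ex_H[OF p(1) e0_H] by blast
  obtain G' where G': "G' \<in> LO" "G' ?p' = e0" using refl_ex_H[OF p(2) e0_H] by blast
  have gr: "inner (G (F i)) (G (F j)) = inner (G' (F' i)) (G' (F' j))" if ij': "i \<in> I" "j \<in> I" for i j
  proof -
    have "B (G (F i)) e0 = B (G' (F' i)) e0" if "i \<in> I" for i
    proof -
      have "B (G (F i)) e0 = B (F i) ?p" by (simp only: G(2)[symmetric] LO_B[OF G(1)])
      also have "\<dots> = B (F' i) ?p'" using gram that ij by (simp add: lorentz_simps)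
      also have "\<dots> = B (G' (F' i)) e0" by (simp only: G'(2)[symmetric] LO_B[OF G'(1)])
      finally show ?thesis .
    qed
    then show ?thesis using ij' by (simp add: inner_B LO_B[OF G(1)] LO_B[OF G'(1)] gram)
  qed
  let ?F = "\<lambda>i. G (F i)" and ?F' = "\<lambda>i. G' (F' i)"
  have "?F ` I = G ` F ` I" "?F' ` I = G' ` F' ` I" by auto
  then have dG: "closure (span (?F ` I)) = UNIV" "closure (span (?F' ` I)) = UNIV"
    using LO_dense[OF G(1) d(1)] LO_dense[OF G'(1) d(2)] by simp_all
  from unitary_extension[of I ?F ?F', OF gr] obtain U where
    U0: "(\<forall>v\<in>UNIV. \<forall>w\<in>UNIV. U (v + w) = U v + U w \<and> inner (U v) (U w) = inner v w) \<and>
      (\<forall>c. \<forall>v\<in>UNIV. U (c *\<^sub>R v) = c *\<^sub>R U v) \<and> range U = UNIV \<and> (\<forall>i\<in>I. U (?F i) = ?F' i)"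
    unfolding dG ..
  have U: "U (v + w) = U v + U w" "U (c *\<^sub>R v) = c *\<^sub>R U v" "inner (U v) (U w) = inner v w"
    "range U = UNIV" "i \<in> I \<Longrightarrow> U (G (F i)) = G' (F' i)" for v w c i
    using U0 by simp_all
  have lin: "linear U" using U(1,2) by (rule linearI)
  have Ue: "U e0 = e0"
  proof -
    have "U e0 = k *\<^sub>R (U (G (F i0)) + U (G (F j0)))"
      by (simp only: G(2)[symmetric] LO_scale[OF G(1)] LO_add[OF G(1)] U(1,2))
    also have "\<dots> = G' ?p'" using U(5) ij by (simp only: LO_scale[OF G'(1)] LO_add[OF G'(1)])
    finally show ?thesis using G'(2) by simp
  qed
  have "U \<in> LO"
  proof (rule LO_I[OF lin _ _ e0_H])
    show "B (U v) (U w) = B v w" for v w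
      using U(3)[of v e0] U(3)[of w e0] U(3)[of v w] by (simp add: B_inner Ue)
    have "inj U"
    proof (rule linear_injective_0[OF lin, THEN iffD2], intro allI impI)
      fix v assume "U v = 0" then show "v = 0" using U(3)[of v v] by simp
    qed
    then show "bij U" using U(4) by (simp add: bij_def)
    show "U e0 \<in> H" by (simp add: Ue)
  qed
  then have "fun_inv G' \<circ> (U \<circ> G) \<in> LO" using LO_comp LO_inv(1) G G' by blast
  moreover have "(fun_inv G' \<circ> (U \<circ> G)) (F i) = F' i" if "i \<in> I" for i
    using U(5)[OF that] LO_inv(2)[OF G'(1)] by simp
  ultimately show ?thesis by blast
qed

end

text \<open>A fixed point, a fixed isotropic line or an invariant geodesic spans an invariant
  subspace of dimension at most two. It is closed, non-zero and, in infinite dimension,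
  proper.\<close>

lemma irreducible_nonelementary:
  fixes e :: "'h::{real_inner,complete_space}"
  assumes e: "e \<noteq> 0" and inf: "\<not> (\<exists>S::'h set. finite S \<and> span S = UNIV)"
    and \<rho>: "\<And>g. g \<in> carrier G \<Longrightarrow> \<rho> g \<in> carrier (Isom e)" and irr: "irreducible_action G e \<rho>"
  shows "\<not> elementary_action G e \<rho>"
proof
  interpret lorentz_space e by unfold_locales (rule e)
  have fin: False if S: "finite S" "s \<in> span S" "s \<noteq> 0" "\<And>g. g \<in> carrier G \<Longrightarrow> lin_ext e (\<rho> g) ` span S \<subseteq> span S" for S s
  proof -
    have "subspace (span S) \<and> closed (span S) \<and> (\<forall>g\<in>carrier G. lin_ext e (\<rho> g) ` span S \<subseteq> span S)"
      using closed_span_finite[OF S(1)] S(4) by simp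
    then have "span S = {0} \<or> span S = UNIV" using irr unfolding irreducible_action_def by blast
    then show False using S inf by blast
  qed
  note im = linear_span_image[OF lin_ext_props(1)[OF \<rho>]]
  assume "elementary_action G e \<rho>"
  then consider x where "x \<in> H" "\<And>g. g \<in> carrier G \<Longrightarrow> \<rho> g x = x"
    | \<xi> where "\<xi> \<in> hyp_boundary e" "\<And>g. g \<in> carrier G \<Longrightarrow> lin_ext e (\<rho> g) ` \<xi> = \<xi>"
    | X where "geodesic_line e X" "\<And>g. g \<in> carrier G \<Longrightarrow> \<rho> g ` X = X"
    unfolding elementary_action_def by blast
  then show False
  proof cases
    case 1
    show False
    proof (rule fin[of "{x}" x])
      show "x \<noteq> 0" using 1(1) by (auto simp: H_iff)
      show "lin_ext e (\<rho> g) ` span {x} \<subseteq> span {x}" if "g \<in> carrier G" for g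
        using im[OF that, of "{x}"] 1(2)[OF that] lin_ext_props(3)[OF \<rho>[OF that] 1(1)] by simp
    qed (auto intro: span_base)
  next
    case 2
    then obtain v where v: "\<xi> = span {v}" "v \<noteq> 0" unfolding hyp_boundary_def by blast
    show False by (rule fin[of "{v}" v]) (use v 2(2) in \<open>auto intro: span_base\<close>)
  next
    case 3
    obtain x y where xy: "x \<in> X" "y \<in> X" "x \<noteq> y" using geodesic_line_two_points[OF 3(1)] by blast
    have "X \<subseteq> span {x, y}" using geodesic_line_span[OF 3(1) xy] .
    then have sp: "span {x, y} = span X"
      using xy by (metis empty_subsetI insert_subset span_minimal span_mono subset_antisym subspace_span)
    have XH: "X \<subseteq> H" using 3(1) unfolding geodesic_line_def by blast
    show False
    proof (rule fin[of "{x, y}" x])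
      show "x \<noteq> 0" using xy(1) XH by (auto simp: H_iff)
      fix g assume g: "g \<in> carrier G"
      have "lin_ext e (\<rho> g) ` X = \<rho> g ` X" using lin_ext_props(3)[OF \<rho>[OF g]] XH by (intro image_cong) auto
      then show "lin_ext e (\<rho> g) ` span {x, y} \<subseteq> span {x, y}"
        unfolding sp using im[OF g, of X] 3(2)[OF g] by simp
    qed (auto intro: span_base)
  qed
qed

context hyp_action begin

lemma irreducible_dense:
  assumes irr: "irreducible_action (Isom b) e \<rho>"
  shows "closure (span (rep.F ` M.C)) = UNIV"
proof -
  let ?V = "closure (span (rep.F ` M.C))"
  have "lin_ext e (\<rho> h) ` ?V \<subseteq> ?V" if h: "h \<in> carrier (Isom b)" for h
  proof -
    let ?A = "lin_ext b h"
    have A: "?A \<in> M.LO" by (rule M.lin_ext_LO[OF h])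
    have "R ?A ` span (rep.F ` M.C) = span (R ?A ` rep.F ` M.C)"
      by (rule linear_span_image[OF N.LO_linear[OF R_LO[OF A]], symmetric])
    also have "\<dots> \<subseteq> span (rep.F ` M.C)"
    proof (rule span_mono, rule subsetI)
      fix y assume "y \<in> R ?A ` rep.F ` M.C"
      then obtain u where "u \<in> M.C" "y = R ?A (rep.F u)" by blast
      then show "y \<in> rep.F ` M.C" using rep.F_equiv[OF A, symmetric] M.LO_C[OF A] by simp
    qed
    finally have "closure (R ?A ` span (rep.F ` M.C)) \<subseteq> ?V" by (rule closure_mono)
    then show ?thesis
      using closure_bounded_linear_image_subset[OF N.LO_bounded[OF R_LO[OF A]], of "span (rep.F ` M.C)"]
      by (simp add: R_lin_ext[OF h])
  qed
  then have "subspace ?V \<and> closed ?V \<and> (\<forall>h\<in>carrier (Isom b). lin_ext e (\<rho> h) ` ?V \<subseteq> ?V)"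
    using subspace_closure[OF subspace_span] by simp
  then have "?V = {0} \<or> ?V = UNIV"
    using irr unfolding irreducible_action_def by (elim allE[of _ ?V]) (rule mp)
  moreover have "rep.F rep.up \<in> ?V"
    by (rule subsetD[OF closure_subset], rule span_base, rule imageI, rule rep.up_C)
  ultimately show ?thesis using N.C_nz[OF rep.F_C[OF rep.up_C]] by auto
qed

end

text \<open>Divided by the square roots of their constants \<open>\<kappa>\<close>, both boundary
  maps have the same kernel, and irreducibility makes both total. \<open>lorentz_extension\<close>
  gives an isometry between them, which intertwines the actions on a total set and hence
  everywhere.\<close>

lemma irreducible_unique:
  fixes b f g :: "'m::euclidean_space" and e :: "'h::{real_inner,complete_space}"
  assumes "hyp_action b f g e \<rho>" "hyp_action b f g e \<sigma>"
    and irr: "irreducible_action (Isom b) e \<rho>" "irreducible_action (Isom b) e \<sigma>"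
    and len: "\<And>h. h \<in> carrier (Isom b) \<Longrightarrow> transl_length e (\<rho> h) = t * transl_length b h"
      "\<And>h. h \<in> carrier (Isom b) \<Longrightarrow> transl_length e (\<sigma> h) = t * transl_length b h"
  shows "conjugate_actions (Isom b) e \<rho> \<sigma>"
proof -
  interpret r: hyp_action b f g e \<rho> by fact
  interpret s: hyp_action b f g e \<sigma> by fact
  let ?a = "restrict (r.rep.a 1) r.M.H"
  have a: "?a \<in> carrier (Isom b)" by (rule r.M.restrict_Isom[OF r.rep.a_LO])
  \<comment> \<open>The element \<open>a 1\<close> has positive translation length, so equal length
    functions force equal exponents.\<close>
  have "r.rep.\<tau> * transl_length b ?a = s.rep.\<tau> * transl_length b ?a"
    using r.transl_length_\<rho>[OF a] s.transl_length_\<rho>[OF a] len[OF a] by linarith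
  moreover have "transl_length b ?a > 0"
  proof -
    have "r.N.tlen (r.R (r.rep.a 1)) = r.rep.\<tau> * r.M.tlen (r.rep.a 1)" by (rule r.rep.tlen_R[OF r.rep.a_LO])
    then have "r.M.tlen (r.rep.a 1) \<noteq> 0" using r.rep.\<tau>_pos by (auto simp: r.rep.\<tau>_def)
    then have "r.M.tlen (r.rep.a 1) > 0" using r.M.tlen_nonneg[of "r.rep.a 1"] by linarith
    then show ?thesis
      by (simp add: r.M.transl_length_eq[OF a] r.M.lin_ext_restrict[OF r.rep.a_LO])
  qed
  ultimately have \<tau>: "r.rep.\<tau> = s.rep.\<tau>" by simp
  define F where "F u = (1 / sqrt r.rep.\<kappa>) *\<^sub>R r.rep.F u" for u
  define F' where "F' u = (1 / sqrt s.rep.\<kappa>) *\<^sub>R s.rep.F u" for u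
  have B: "r.N.B (F u) (F v) = r.M.B u v powr r.rep.\<tau>" "r.N.B (F' u) (F' v) = r.M.B u v powr r.rep.\<tau>"
    if "u \<in> r.M.C" "v \<in> r.M.C" for u v
    using r.rep.F_kernel[OF that] s.rep.F_kernel[OF that] r.rep.\<kappa>_pos s.rep.\<kappa>_pos
    by (simp_all add: F_def F'_def lorentz_simps \<tau>)
  have sc: "span ((\<lambda>u. c *\<^sub>R k u) ` X) = span (k ` X)" if "c \<noteq> 0" for c and k :: "'m \<Rightarrow> 'h" and X
  proof (rule span_eq[THEN iffD2], intro conjI image_subsetI)
    fix x assume "x \<in> X"
    then show "c *\<^sub>R k x \<in> span (k ` X)" by (intro span_scale span_base) simp
    have "(1 / c) *\<^sub>R (c *\<^sub>R k x) \<in> span ((\<lambda>u. c *\<^sub>R k u) ` X)" using \<open>x \<in> X\<close> by (intro span_scale[OF span_base]) blast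
    then show "k x \<in> span ((\<lambda>u. c *\<^sub>R k u) ` X)" using that by simp
  qed
  have d: "closure (span (F ` r.M.C)) = UNIV" "closure (span (F' ` r.M.C)) = UNIV"
    using r.irreducible_dense[OF irr(1)] s.irreducible_dense[OF irr(2)] r.rep.\<kappa>_pos s.rep.\<kappa>_pos
    unfolding F_def F'_def by (simp_all add: sc)
  note uC = r.rep.up_C r.rep.um_C
  have FC: "F u \<in> r.N.C" "F' u \<in> r.N.C" if "u \<in> r.M.C" for u
    using r.rep.F_C[OF that] s.rep.F_C[OF that] r.rep.\<kappa>_pos s.rep.\<kappa>_pos r.N.C_scale
    by (auto simp: F_def F'_def)
  obtain A where A: "A \<in> r.N.LO" "\<And>u. u \<in> r.M.C \<Longrightarrow> A (F u) = F' u"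
  proof -
    have "\<exists>A\<in>r.N.LO. \<forall>u\<in>r.M.C. A (F u) = F' u"
    proof (rule r.N.lorentz_extension[OF _ d uC, where k = "1 / sqrt 2"])
      show "r.N.B (F i) (F j) = r.N.B (F' i) (F' j)" if "i \<in> r.M.C" "j \<in> r.M.C" for i j
        using B[OF that] by simp
      show "(1 / sqrt 2) *\<^sub>R (F r.rep.up + F r.rep.um) \<in> r.N.H" "(1 / sqrt 2) *\<^sub>R (F' r.rep.up + F' r.rep.um) \<in> r.N.H"
        using r.N.mid_H[OF FC(1)[OF uC(1)] FC(1)[OF uC(2)]] r.N.mid_H[OF FC(2)[OF uC(1)] FC(2)[OF uC(2)]]
          B[OF uC] r.rep.up_um by simp_all
    qed
    then show ?thesis using that by blast
  qed
  have inter: "A \<circ> r.R G = s.R G \<circ> A" if G: "G \<in> r.M.LO" for G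
  proof (rule r.N.LO_eq_dense[OF r.N.LO_comp[OF A(1) r.R_LO[OF G]] r.N.LO_comp[OF s.R_LO[OF G] A(1)] d(1)])
    fix w assume "w \<in> F ` r.M.C"
    then obtain u where u: "u \<in> r.M.C" "w = F u" by blast
    have "r.R G (F u) = F (G u)" by (simp add: F_def r.N.LO_scale[OF r.R_LO[OF G]] r.rep.F_equiv[OF G u(1)])
    moreover have "s.R G (F' u) = F' (G u)" by (simp add: F'_def r.N.LO_scale[OF s.R_LO[OF G]] s.rep.F_equiv[OF G u(1)])
    ultimately show "(A \<circ> r.R G) w = (s.R G \<circ> A) w"
      using A(2)[OF u(1)] A(2)[OF r.M.LO_C[OF G u(1)]] u(2) by simp
  qed
  let ?h = "restrict A r.N.H"
  have h: "?h \<in> carrier (Isom e)" by (rule r.N.restrict_Isom[OF A(1)])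
  interpret I: group "Isom e" by (rule Isom_group)
  have "\<sigma> k = ?h \<otimes>\<^bsub>Isom e\<^esub> \<rho> k \<otimes>\<^bsub>Isom e\<^esub> inv\<^bsub>Isom e\<^esub> ?h" if k: "k \<in> carrier (Isom b)" for k
  proof -
    note G = r.M.lin_ext_LO[OF k]
    note rk = r.\<rho>_carrier[OF k] and sk = s.\<rho>_carrier[OF k]
    have "\<rho> k = restrict (r.R (lin_ext b k)) r.N.H" "\<sigma> k = restrict (s.R (lin_ext b k)) r.N.H"
      by (simp_all add: r.R_lin_ext[OF k] s.R_lin_ext[OF k] r.N.restrict_lin_ext[OF rk] r.N.restrict_lin_ext[OF sk])
    then have "?h \<otimes>\<^bsub>Isom e\<^esub> \<rho> k = \<sigma> k \<otimes>\<^bsub>Isom e\<^esub> ?h"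
      by (simp add: r.N.restrict_mult A(1) r.R_LO[OF G] s.R_LO[OF G] inter[OF G])
    then show ?thesis using I.inv_solve_right'[OF sk I.m_closed[OF h rk] h] by (metis I.m_closed h rk sk I.inv_solve_right)
  qed
  then show ?thesis unfolding conjugate_actions_def using h by blast
qed

section \<open>Existence of irreducible representations\<close>

text \<open>A vector dependent on its predecessors yields zero, because \<open>sgn 0 = 0\<close>,
  and does no harm to the recursion; zeros are removed by \<open>enumerate\<close>
  afterwards.\<close>

fun gram_schmidt :: "(nat \<Rightarrow> 'a::real_inner) \<Rightarrow> nat \<Rightarrow> 'a" where
  "gram_schmidt d k = sgn (d k - (\<Sum>j<k. inner (d k) (gram_schmidt d j) *\<^sub>R gram_schmidt d j))"

declare gram_schmidt.simps [simp del]

lemma gram_schmidt_orthogonal: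
  "i < j \<Longrightarrow> inner (gram_schmidt d i) (gram_schmidt d j) = 0"
proof (induction j arbitrary: i rule: less_induct)
  case (less j)
  let ?q = "gram_schmidt d"
  define r where "r = d j - (\<Sum>k<j. inner (d j) (?q k) *\<^sub>R ?q k)"
  have "inner (?q i) (\<Sum>k<j. inner (d j) (?q k) *\<^sub>R ?q k) = (\<Sum>k<j. if k = i then inner (d j) (?q i) * inner (?q i) (?q i) else 0)"
    unfolding inner_sum_right
  proof (rule sum.cong)
    fix k assume k: "k \<in> {..<j}"
    show "inner (?q i) (inner (d j) (?q k) *\<^sub>R ?q k) = (if k = i then inner (d j) (?q i) * inner (?q i) (?q i) else 0)"
      using less.IH[of k i] less.IH[of i k] less.prems k by (auto simp: inner_commute dest: nat_neq_iff[THEN iffD1])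
  qed simp
  also have "\<dots> = inner (d j) (?q i) * inner (?q i) (?q i)" using less.prems by simp
  also have "\<dots> = inner (d j) (?q i)"
  proof (cases "?q i = 0")
    case False
    then have "norm (?q i) = 1" by (subst gram_schmidt.simps, subst (asm) gram_schmidt.simps) (simp add: norm_sgn sgn_zero_iff)
    then have "inner (?q i) (?q i) = 1" by (simp add: norm_eq_1)
    then show ?thesis by simp
  qed simp
  finally have "inner (?q i) r = 0" by (simp add: r_def inner_diff_right inner_commute)
  moreover have "?q j = sgn r" unfolding r_def by (rule gram_schmidt.simps)
  ultimately show ?case by (simp add: sgn_div_norm)
qed

lemma gram_schmidt_unit: "gram_schmidt d k \<noteq> 0 \<Longrightarrow> inner (gram_schmidt d k) (gram_schmidt d k) = 1"
  by (subst (asm) gram_schmidt.simps, subst (1 2) gram_schmidt.simps) (simp add: norm_eq_1[symmetric] norm_sgn sgn_zero_iff)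

lemma gram_schmidt_span: "span (range (gram_schmidt d)) = span (range d)"
proof -
  let ?q = "gram_schmidt d"
  have 1: "?q k \<in> span (range d)" for k
  proof (induction k rule: less_induct)
    case (less k)
    show ?case
      by (subst gram_schmidt.simps, unfold sgn_div_norm)
        (intro span_scale span_diff span_sum less span_base, auto)
  qed
  have 2: "d k \<in> span (range ?q)" for k
  proof -
    define p where "p = (\<Sum>j<k. inner (d k) (?q j) *\<^sub>R ?q j)"
    have p: "p \<in> span (range ?q)" unfolding p_def by (intro span_sum span_scale span_base) simp
    have "?q k = sgn (d k - p)" unfolding p_def by (rule gram_schmidt.simps)
    then have "d k = norm (d k - p) *\<^sub>R ?q k + p" by (cases "d k = p") (simp_all add: sgn_div_norm)
    also have "\<dots> \<in> span (range ?q)" by (intro span_add span_scale p span_base) simp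
    finally show ?thesis .
  qed
  show ?thesis using 1 2 by (intro span_eq[THEN iffD2]) auto
qed

text \<open>Infinite dimension leaves infinitely many non-zero vectors, which are renumbered by all
  natural numbers. The first one survives unchanged, being a unit vector; this keeps
  \<open>e0\<close> in first position later.\<close>

lemma orthonormal_sequence:
  fixes d :: "nat \<Rightarrow> 'a::real_inner"
  assumes inf: "\<And>S. finite S \<Longrightarrow> \<not> range d \<subseteq> span S" and d0: "norm (d 0) = 1"
  shows "\<exists>q :: nat \<Rightarrow> 'a. (\<forall>i j. inner (q i) (q j) = (if i = j then 1 else 0)) \<and>
    span (range q) = span (range d) \<and> q 0 = d 0"
proof -
  let ?g = "gram_schmidt d"
  define K where "K = {k. ?g k \<noteq> 0}"
  have gK: "span (?g ` K) = span (range ?g)"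
  proof (intro span_eq[THEN iffD2] conjI)
    show "range ?g \<subseteq> span (?g ` K)"
    proof
      fix x assume "x \<in> range ?g"
      then obtain k where "x = ?g k" by blast
      then show "x \<in> span (?g ` K)" by (cases "k \<in> K") (auto simp: K_def span_base span_zero)
    qed
  qed (auto intro: span_base)
  have "infinite K"
  proof
    assume "finite K"
    then have "finite (?g ` K)" by simp
    moreover have "range d \<subseteq> span (?g ` K)" unfolding gK gram_schmidt_span by (rule span_superset)
    ultimately show False using inf by blast
  qed
  define q where "q n = ?g (enumerate K n)" for n
  have eK: "enumerate K n \<in> K" for n using enumerate_in_set[OF \<open>infinite K\<close>] .
  have "inner (q i) (q j) = (if i = j then 1 else 0)" for i j
  proof (cases i j rule: linorder_cases)
    case less
    then show ?thesis using gram_schmidt_orthogonal[OF enumerate_mono[OF less \<open>infinite K\<close>]] by (simp add: q_def)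
  next
    case equal
    then show ?thesis using gram_schmidt_unit[of d] eK[of j] by (simp add: q_def K_def)
  next
    case greater
    then show ?thesis using gram_schmidt_orthogonal[OF enumerate_mono[OF greater \<open>infinite K\<close>]]
      by (simp add: q_def inner_commute)
  qed
  moreover have "range q = ?g ` K"
    using range_enumerate[OF \<open>infinite K\<close>] unfolding q_def by (metis image_image)
  moreover have g0: "?g 0 = d 0" using d0 by (subst gram_schmidt.simps) (simp add: sgn_div_norm)
  then have "0 \<in> K" using d0 by (auto simp: K_def)
  then have "enumerate K 0 = 0" unfolding enumerate_0 by (simp add: Least_eq_0)
  then have "q 0 = d 0" using g0 by (simp add: q_def)
  ultimately show ?thesis using gK gram_schmidt_span[of d] by (intro exI[of _ q]) simp
qed

text \<open>For \<open>0 < t < 1\<close> the recursion of binomial coefficients makes every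
  coefficient of \<open>(1 - s) powr t\<close> after the constant one non-positive. The endpoint
  \<open>s = 1\<close> matters, since it is the product of a unit vector with itself.\<close>

lemma binomial_deficit_series:
  fixes t :: real
  assumes t: "0 < t" "t < 1"
  shows "\<exists>c. (\<forall>k. c k \<ge> 0) \<and> summable c \<and> (\<forall>s. \<bar>s\<bar> \<le> 1 \<longrightarrow> (\<lambda>k. c k * s ^ k) sums (1 - (1 - s) powr t))"
proof -
  define c where "c k = (if k = 0 then 0 else - ((t gchoose k) * (-1) ^ k))" for k :: nat
  have neg: "(t gchoose Suc k) * (-1) ^ Suc k \<le> 0" for k
  proof (induction k)
    case (Suc k)
    have "real (Suc (Suc k)) * (t gchoose Suc (Suc k)) = (t - real (Suc k)) * (t gchoose Suc k)"
      using gbinomial_mult_1[of t "Suc k"] by (simp add: algebra_simps)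
    note rec = this
    have "real (Suc (Suc k)) * ((t gchoose Suc (Suc k)) * (-1) ^ Suc (Suc k)) = (real (Suc (Suc k)) * (t gchoose Suc (Suc k))) * (-1) ^ k"
      by simp
    also have "\<dots> = (real (Suc k) - t) * ((t gchoose Suc k) * (-1) ^ Suc k)"
      unfolding rec by (simp add: algebra_simps)
    also have "\<dots> \<le> 0" by (rule mult_nonneg_nonpos[OF _ Suc]) (use t in simp)
    finally have "real (Suc (Suc k)) * ((t gchoose Suc (Suc k)) * (-1) ^ Suc (Suc k)) \<le> 0" .
    moreover have "real (Suc (Suc k)) > 0" by simp
    ultimately show ?case unfolding mult_le_0_iff by linarith
  qed (use t in simp)
  have c0: "c k \<ge> 0" for k using neg[of "k - 1"] by (cases k) (auto simp: c_def)
  have inner_sums: "(\<lambda>k. c k * s ^ k) sums (1 - (1 - s) powr t)" if s: "\<bar>s\<bar> < 1" for s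
  proof -
    have "(\<lambda>n. (t gchoose n) * (- s) ^ n) sums (1 + (- s)) powr t" using s by (intro gen_binomial_real) simp
    then have "(\<lambda>n. (if n = 0 then 1 else 0) - (t gchoose n) * (- s) ^ n) sums (1 - (1 - s) powr t)"
      using sums_single[of 0 "\<lambda>_. 1 :: real"] by (intro sums_diff) auto
    moreover have "(if n = 0 then 1 else 0) - (t gchoose n) * (- s) ^ n = c n * s ^ n" for n
      using power_minus[of s n] by (simp add: c_def)
    ultimately show ?thesis by simp
  qed
  have sm: "(\<lambda>m. (1 - 1 / real (Suc m)) * s) \<longlonglongrightarrow> s" for s :: real
    using tendsto_mult[OF tendsto_diff[OF tendsto_const LIMSEQ_Suc[OF lim_1_over_n]] tendsto_const, of 1 s] by simp
  have sm1: "\<bar>(1 - 1 / real (Suc m)) * s\<bar> < 1" if "\<bar>s\<bar> \<le> 1" for m and s :: real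
  proof -
    have "\<bar>1 - 1 / real (Suc m)\<bar> < 1" "0 \<le> \<bar>1 - 1 / real (Suc m)\<bar>" by (auto simp: abs_if field_simps)
    then have "\<bar>1 - 1 / real (Suc m)\<bar> * \<bar>s\<bar> \<le> \<bar>1 - 1 / real (Suc m)\<bar> * 1" using that by (intro mult_left_mono)
    then show ?thesis using \<open>\<bar>1 - 1 / real (Suc m)\<bar> < 1\<close> unfolding abs_mult mult_1_right by linarith
  qed
  \<comment> \<open>Positivity bounds the partial sums inside the interval by the value of the
    function, which is at most one; letting \<open>s\<close> tend to one bounds those of
    \<open>c\<close> itself.\<close>
  have "(\<Sum>k<n. c k) \<le> 1" for n
  proof -
    let ?s = "\<lambda>m. (1 - 1 / real (Suc m)) * 1"
    have "(\<lambda>m. \<Sum>k<n. c k * ?s m ^ k) \<longlonglongrightarrow> (\<Sum>k<n. c k * 1 ^ k)"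
      by (intro tendsto_sum tendsto_mult tendsto_const tendsto_power sm)
    moreover have "(\<Sum>k<n. c k * ?s m ^ k) \<le> 1" for m
    proof -
      have s: "0 \<le> ?s m" by (simp add: field_simps)
      have su: "(\<lambda>k. c k * ?s m ^ k) sums (1 - (1 - ?s m) powr t)" by (rule inner_sums[OF sm1]) simp
      have "(\<Sum>k<n. c k * ?s m ^ k) \<le> (\<Sum>k. c k * ?s m ^ k)"
        using c0 s by (intro sum_le_suminf sums_summable[OF su]) (auto intro!: mult_nonneg_nonneg zero_le_power)
      also have "\<dots> \<le> 1" using sums_unique[OF su] powr_ge_zero[of "1 - ?s m" t] by linarith
      finally show ?thesis .
    qed
    ultimately have "(\<Sum>k<n. c k * 1 ^ k) \<le> 1" by (intro LIMSEQ_le_const2) auto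
    then show ?thesis by simp
  qed
  then have sc: "summable c" using c0 by (intro summableI_nonneg_bounded)
  have cs: "norm (c k * s ^ k) \<le> c k" if "\<bar>s\<bar> \<le> 1" for s k
    using that c0 by (simp add: abs_mult power_abs mult_left_le power_le_one)
  have ss: "summable (\<lambda>k. c k * s ^ k)" if "\<bar>s\<bar> \<le> 1" for s
    by (rule summable_comparison_test'[OF sc, where N = 0]) (rule cs[OF that])
  \<comment> \<open>Summability of \<open>c\<close> gives uniform convergence on the closed
    interval, so the identity passes to the endpoints by continuity.\<close>
  have "uniform_limit {-1..1} (\<lambda>n s. \<Sum>k<n. c k * s ^ k) (\<lambda>s. \<Sum>k. c k * s ^ k) sequentially"
    by (rule Weierstrass_m_test[OF _ sc]) (rule cs, auto)
  then have G: "continuous_on {-1..1} (\<lambda>s. \<Sum>k. c k * s ^ k)"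
    by (rule uniform_limit_theorem[rotated]) (auto intro!: always_eventually continuous_intros)
  have "(\<lambda>k. c k * s ^ k) sums (1 - (1 - s) powr t)" if s: "\<bar>s\<bar> \<le> 1" for s
  proof -
    let ?s = "\<lambda>m. (1 - 1 / real (Suc m)) * s"
    have "(\<lambda>m. \<Sum>k. c k * ?s m ^ k) \<longlonglongrightarrow> (\<Sum>k. c k * s ^ k)"
      using s sm1[OF s] by (intro continuous_on_tendsto_compose[OF G sm]) (auto simp: abs_le_iff abs_less_iff less_imp_le)
    moreover have "(\<Sum>k. c k * ?s m ^ k) = 1 - (1 - ?s m) powr t" for m
      using sums_unique[OF inner_sums[OF sm1[OF s]]] by simp
    ultimately have "(\<lambda>m. 1 - (1 - ?s m) powr t) \<longlonglongrightarrow> (\<Sum>k. c k * s ^ k)" by simp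
    moreover have "(\<lambda>m. 1 - (1 - ?s m) powr t) \<longlonglongrightarrow> 1 - (1 - s) powr t"
    proof (intro tendsto_diff tendsto_const tendsto_powr' sm disjI2 conjI)
      show "\<forall>\<^sub>F m in sequentially. 0 \<le> 1 - ?s m" using sm1[OF s] by (intro always_eventually allI) (simp add: abs_less_iff less_imp_le)
    qed (use t in auto)
    ultimately have "(\<Sum>k. c k * s ^ k) = 1 - (1 - s) powr t" using LIMSEQ_unique by blast
    then show ?thesis using summable_sums[OF ss[OF s]] by simp
  qed
  then show ?thesis using c0 sc by blast
qed

text \<open>Riesz-Fischer: by Pythagoras, square-summable coefficients have Cauchy partial
  sums.\<close>

lemma orthonormal_series:
  fixes q :: "nat \<Rightarrow> 'a::{real_inner,complete_space}"
  assumes q: "\<And>i j. inner (q i) (q j) = (if i = j then 1 else 0)"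
    and a: "\<And>x. x \<in> X \<Longrightarrow> summable (\<lambda>n. (a x n)\<^sup>2)"
  shows "\<exists>v. \<forall>x\<in>X. (\<lambda>N. \<Sum>n<N. a x n *\<^sub>R q n) \<longlonglongrightarrow> v x"
proof -
  have "convergent (\<lambda>N. \<Sum>n<N. a x n *\<^sub>R q n)" if x: "x \<in> X" for x
  proof (rule Cauchy_convergent, rule CauchyI')
    fix \<epsilon> :: real assume "\<epsilon> > 0"
    then have "\<epsilon>\<^sup>2 > 0" by simp
    then obtain N where N: "\<And>m n. m \<ge> N \<Longrightarrow> norm (\<Sum>k=m..<n. (a x k)\<^sup>2) < \<epsilon>\<^sup>2"
      using a[OF x] unfolding summable_Cauchy by blast
    have "dist (\<Sum>k<m. a x k *\<^sub>R q k) (\<Sum>k<n. a x k *\<^sub>R q k) < \<epsilon>" if mn: "m \<ge> N" "n > m" for m n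
    proof (rule power2_less_imp_less)
      have "(\<Sum>k<n. a x k *\<^sub>R q k) - (\<Sum>k<m. a x k *\<^sub>R q k) = (\<Sum>k=m..<n. a x k *\<^sub>R q k)"
        using mn(2) sum_diff_nat_ivl[of 0 m n "\<lambda>k. a x k *\<^sub>R q k"] by (simp add: lessThan_atLeast0)
      then have "dist (\<Sum>k<n. a x k *\<^sub>R q k) (\<Sum>k<m. a x k *\<^sub>R q k) = norm (\<Sum>k=m..<n. a x k *\<^sub>R q k)"
        by (simp only: dist_norm)
      then have "(dist (\<Sum>k<m. a x k *\<^sub>R q k) (\<Sum>k<n. a x k *\<^sub>R q k))\<^sup>2 = inner (\<Sum>k=m..<n. a x k *\<^sub>R q k) (\<Sum>k=m..<n. a x k *\<^sub>R q k)"
        by (simp only: dist_commute[of "\<Sum>k<m. a x k *\<^sub>R q k"] power2_norm_eq_inner)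
      also have "\<dots> = (\<Sum>k=m..<n. (a x k)\<^sup>2)"
        by (simp add: inner_sum_left inner_sum_right q if_distrib power2_eq_square cong: if_cong)
      also have "\<dots> < \<epsilon>\<^sup>2" using N[OF mn(1), of n] by (simp add: abs_less_iff)
      finally show "(dist (\<Sum>k<m. a x k *\<^sub>R q k) (\<Sum>k<n. a x k *\<^sub>R q k))\<^sup>2 < \<epsilon>\<^sup>2" .
    qed (use \<open>\<epsilon> > 0\<close> in simp)
    then show "\<exists>M. \<forall>m\<ge>M. \<forall>n>m. dist (\<Sum>k<m. a x k *\<^sub>R q k) (\<Sum>k<n. a x k *\<^sub>R q k) < \<epsilon>" by blast
  qed
  then show ?thesis unfolding convergent_def by (intro bchoice) blast
qed

text \<open>Expansion into non-commuting monomials. Words instead of multi-indices avoid multinomial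
  coefficients, and a power of \<open>inner x y\<close> becomes a sum of products of a function of
  \<open>x\<close> with the same function of \<open>y\<close>.\<close>

lemma sum_words_power:
  fixes h :: "'i \<Rightarrow> real"
  assumes A: "finite A"
  shows "(\<Sum>w | set w \<subseteq> A \<and> length w = k. prod_list (map h w)) = (\<Sum>i\<in>A. h i) ^ k"
proof (induction k)
  case 0
  have "{w. set w \<subseteq> A \<and> length w = 0} = {[]}" by auto
  then show ?case by simp
next
  case (Suc k)
  let ?W = "{w. set w \<subseteq> A \<and> length w = k}"
  have "{w. set w \<subseteq> A \<and> length w = Suc k} = (\<lambda>(i, w). i # w) ` (A \<times> ?W)"
    by (auto simp: length_Suc_conv image_iff)
  moreover have "inj_on (\<lambda>(i, w). i # w) (A \<times> ?W)" by (auto simp: inj_on_def)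
  ultimately have "(\<Sum>w | set w \<subseteq> A \<and> length w = Suc k. prod_list (map h w)) = (\<Sum>(i, w)\<in>A \<times> ?W. h i * prod_list (map h w))"
    by (simp add: sum.reindex case_prod_unfold)
  also have "\<dots> = (\<Sum>i\<in>A. \<Sum>w\<in>?W. h i * prod_list (map h w))" by (rule sum.cartesian_product[symmetric])
  also have "\<dots> = (\<Sum>i\<in>A. h i) * (\<Sum>w\<in>?W. prod_list (map h w))"
    by (simp add: sum_distrib_left[symmetric] sum_distrib_right)
  finally show ?case by (simp add: Suc)
qed

text \<open>The bound on the sum of the \<open>\<bar>h i\<bar>\<close> makes the family absolutely
  summable, so the words may be enumerated in any order; the value is found along the exhaustion by
  length.\<close>

lemma words_has_sum:
  fixes h :: "'i \<Rightarrow> real" and c :: "nat \<Rightarrow> real"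
  assumes A: "finite A" and c: "\<And>k. c k \<ge> 0" "summable c" and h: "(\<Sum>i\<in>A. \<bar>h i\<bar>) \<le> 1"
    and s: "(\<lambda>k. c k * (\<Sum>i\<in>A. h i) ^ k) sums S"
  shows "((\<lambda>w. c (length w) * prod_list (map h w)) has_sum S) {w. set w \<subseteq> A}"
proof -
  let ?W = "{w. set w \<subseteq> A}" and ?f = "\<lambda>h' :: 'i \<Rightarrow> real. \<lambda>w. c (length w) * prod_list (map h' w)"
  define E where "E n = {w. set w \<subseteq> A \<and> length w < n}" for n
  have Eun: "E n = (\<Union>k<n. {w. set w \<subseteq> A \<and> length w = k})" for n by (auto simp: E_def)
  have fin: "finite {w. set w \<subseteq> A \<and> length w = k}" for k using finite_lists_length_eq[OF A] .
  have finE: "finite (E n)" for n unfolding Eun using fin by simp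
  have sumE: "(\<Sum>w\<in>E n. ?f h' w) = (\<Sum>k<n. c k * (\<Sum>i\<in>A. h' i) ^ k)" for h' :: "'i \<Rightarrow> real" and n
  proof -
    have "(\<Sum>w\<in>E n. ?f h' w) = (\<Sum>k<n. \<Sum>w | set w \<subseteq> A \<and> length w = k. ?f h' w)"
      unfolding Eun by (rule sum.UNION_disjoint) (use fin in auto)
    also have "\<dots> = (\<Sum>k<n. c k * (\<Sum>w | set w \<subseteq> A \<and> length w = k. prod_list (map h' w)))"
      by (intro sum.cong refl) (simp add: sum_distrib_left)
    finally show ?thesis by (simp add: sum_words_power[OF A])
  qed
  have abs: "\<bar>prod_list (map h w)\<bar> = prod_list (map (\<lambda>i. \<bar>h i\<bar>) w)" for w
    by (induction w) (auto simp: abs_mult)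
  have h0: "0 \<le> (\<Sum>i\<in>A. \<bar>h i\<bar>)" by (simp add: sum_nonneg)
  have "(\<lambda>w. norm (?f h w)) summable_on ?W"
  proof (rule nonneg_bdd_above_summable_on)
    show "bdd_above (sum (\<lambda>w. norm (?f h w)) ` {F. F \<subseteq> ?W \<and> finite F})"
    proof (rule bdd_aboveI2)
      fix F assume F: "F \<in> {F. F \<subseteq> ?W \<and> finite F}"
      define n where "n = Suc (Max (length ` F))"
      have "F \<subseteq> E n"
      proof
        fix w assume w: "w \<in> F"
        then have "length w \<le> Max (length ` F)" using F by (intro Max_ge) auto
        then have "length w < n" by (simp add: n_def)
        then show "w \<in> E n" using w F by (auto simp: E_def)
      qed
      then have "sum (\<lambda>w. norm (?f h w)) F \<le> sum (\<lambda>w. norm (?f h w)) (E n)" by (intro sum_mono2 finE) auto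
      also have "\<dots> = (\<Sum>w\<in>E n. ?f (\<lambda>i. \<bar>h i\<bar>) w)" using c(1) by (intro sum.cong refl) (simp add: abs_mult abs)
      also have "\<dots> \<le> (\<Sum>k<n. c k * 1)"
        unfolding sumE using c(1) h h0 by (intro sum_mono mult_left_mono power_le_one)
      also have "\<dots> \<le> suminf c" using c by (simp add: sum_le_suminf)
      finally show "sum (\<lambda>w. norm (?f h w)) F \<le> suminf c" .
    qed
  qed auto
  then have "?f h summable_on ?W" by (rule abs_summable_summable)
  then obtain S' where S': "(?f h has_sum S') ?W" unfolding summable_on_def by blast
  have "filterlim E (finite_subsets_at_top ?W) sequentially"
    unfolding filterlim_finite_subsets_at_top
  proof (intro allI impI)
    fix X assume X: "finite X \<and> X \<subseteq> ?W"
    have "X \<subseteq> E n" if "n \<ge> Suc (Max (length ` X))" for n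
    proof
      fix w assume w: "w \<in> X"
      then have "length w \<le> Max (length ` X)" using X by (intro Max_ge) auto
      then have "length w < n" using that by linarith
      then show "w \<in> E n" using w X by (auto simp: E_def)
    qed
    moreover have "E n \<subseteq> ?W" for n by (auto simp: E_def)
    ultimately have "\<forall>n\<ge>Suc (Max (length ` X)). finite (E n) \<and> X \<subseteq> E n \<and> E n \<subseteq> ?W"
      using finE by blast
    then show "\<forall>\<^sub>F n in sequentially. finite (E n) \<and> X \<subseteq> E n \<and> E n \<subseteq> ?W"
      unfolding eventually_sequentially by (rule exI)
  qed
  from filterlim_compose[OF S'[unfolded has_sum_def] this] have "(\<lambda>n. \<Sum>k<n. c k * (\<Sum>i\<in>A. h i) ^ k) \<longlonglongrightarrow> S'"
    by (simp add: sumE)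
  then have "S' = S" using s LIMSEQ_unique unfolding sums_def by blast
  then show ?thesis using S' by simp
qed

text \<open>
  The coordinates of the feature map are indexed by the words over the standard basis: the
  monomials of degree \<open>k\<close> carry the \<open>k\<close>-th Taylor coefficient of \<open>1 - (1 - s) powr t\<close>.
\<close>

lemma feature_map:
  fixes q :: "nat \<Rightarrow> 'h::{real_inner,complete_space}" and t :: real
  assumes q: "\<And>i j. inner (q i) (q j) = (if i = j then 1 else 0)" and t: "0 < t" "t < 1"
  shows "\<exists>\<Phi> :: 'm::euclidean_space \<Rightarrow> 'h. (\<forall>x y. norm x = 1 \<longrightarrow> norm y = 1 \<longrightarrow> inner (\<Phi> x) (\<Phi> y) = 1 - (1 - inner x y) powr t) \<and>
    (\<forall>x z. norm x = 1 \<longrightarrow> (\<forall>n. inner (q n) z = 0) \<longrightarrow> inner (\<Phi> x) z = 0)"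
proof -
  obtain c where c: "\<And>k. c k \<ge> 0" "summable c" "\<And>s. \<bar>s\<bar> \<le> 1 \<Longrightarrow> (\<lambda>k. c k * s ^ k) sums (1 - (1 - s) powr t)"
    using binomial_deficit_series[OF t] by blast
  let ?W = "{w :: 'm list. set w \<subseteq> Basis}"
  obtain i0 :: 'm where i0: "i0 \<in> Basis" using nonempty_Basis by blast
  have "infinite ?W"
  proof
    assume "finite ?W"
    moreover have "range (\<lambda>k. replicate k i0) \<subseteq> ?W" using i0 by auto
    ultimately have "finite (range (\<lambda>k. replicate k i0))" using finite_subset by blast
    moreover have "inj (\<lambda>k. replicate k i0)" by (rule injI) (metis length_replicate)
    ultimately show False using finite_imageD infinite_UNIV_nat by blast
  qed
  moreover have "countable ?W" using countable_lists[of "Basis :: 'm set"] by (simp add: lists_eq_set countable_finite)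
  ultimately obtain ix :: "nat \<Rightarrow> 'm list" where ix: "bij_betw ix UNIV ?W"
    using bij_betw_from_nat_into by blast
  define a where "a x n = sqrt (c (length (ix n))) * prod_list (map (\<lambda>i. inner x i) (ix n))" for x n
  have pl: "prod_list (map (\<lambda>i. inner x i) w) * prod_list (map (\<lambda>i. inner y i) w) = prod_list (map (\<lambda>i. inner x i * inner y i) w)" for x y :: 'm and w
    by (induction w) auto
  have sums: "(\<lambda>n. a x n * a y n) sums (1 - (1 - inner x y) powr t)" if n: "norm x = 1" "norm y = 1" for x y
  proof -
    \<comment> \<open>Arithmetic-geometric mean inequality in each coordinate. Absolute summability
      over words asks for this bound, which is stronger than
      \<open>\<bar>inner x y\<bar> \<le> 1\<close>.\<close>
    have 1: "(\<Sum>i\<in>Basis. \<bar>inner x i * inner y i\<bar>) \<le> 1"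
    proof -
      have "(\<Sum>i\<in>Basis. \<bar>inner x i * inner y i\<bar>) \<le> (\<Sum>i\<in>Basis. ((inner x i)\<^sup>2 + (inner y i)\<^sup>2) / 2)"
      proof (rule sum_mono)
        fix i :: 'm
        have "0 \<le> (\<bar>inner x i\<bar> - \<bar>inner y i\<bar>)\<^sup>2" by simp
        then show "\<bar>inner x i * inner y i\<bar> \<le> ((inner x i)\<^sup>2 + (inner y i)\<^sup>2) / 2"
          unfolding power2_diff by (simp add: abs_mult)
      qed
      also have "\<dots> = (inner x x + inner y y) / 2"
        by (simp add: sum_divide_distrib[symmetric] sum.distrib euclidean_inner[of x x] euclidean_inner[of y y] power2_eq_square)
      also have "\<dots> = 1" using n by (simp add: norm_eq_1)
      finally show ?thesis .
    qed
    have xy: "(\<Sum>i\<in>Basis. inner x i * inner y i) = inner x y" by (rule euclidean_inner[symmetric])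
    have "\<bar>inner x y\<bar> \<le> 1" using Cauchy_Schwarz_ineq2[of x y] n by simp
    then have "((\<lambda>w. c (length w) * prod_list (map (\<lambda>i. inner x i * inner y i) w)) has_sum (1 - (1 - inner x y) powr t)) ?W"
      using c(3) by (intro words_has_sum c(1,2) 1) (simp_all add: xy)
    then have "((\<lambda>n. c (length (ix n)) * prod_list (map (\<lambda>i. inner x i * inner y i) (ix n))) has_sum (1 - (1 - inner x y) powr t)) UNIV"
      using has_sum_reindex_bij_betw[OF ix, of "\<lambda>w. c (length w) * prod_list (map (\<lambda>i. inner x i * inner y i) w)"] by simp
    moreover have "c (length (ix n)) * prod_list (map (\<lambda>i. inner x i * inner y i) (ix n)) = a x n * a y n" for n
      using c(1)[of "length (ix n)"] by (simp add: a_def pl[symmetric] mult_ac)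
    ultimately show ?thesis using has_sum_imp_sums by simp
  qed
  have sq: "summable (\<lambda>n. (a x n)\<^sup>2)" if "x \<in> {x. norm x = 1}" for x
    using sums_summable[OF sums[of x x]] that by (simp add: power2_eq_square)
  obtain \<Phi> where \<Phi>: "\<And>x. norm x = 1 \<Longrightarrow> (\<lambda>N. \<Sum>n<N. a x n *\<^sub>R q n) \<longlonglongrightarrow> \<Phi> x"
    using orthonormal_series[of q "{x. norm x = 1}" a, OF q sq] by auto
  have "inner (\<Phi> x) (\<Phi> y) = 1 - (1 - inner x y) powr t" if n: "norm x = 1" "norm y = 1" for x y
  proof -
    have "(\<lambda>N. inner (\<Sum>n<N. a x n *\<^sub>R q n) (\<Sum>n<N. a y n *\<^sub>R q n)) \<longlonglongrightarrow> inner (\<Phi> x) (\<Phi> y)"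
      by (intro tendsto_inner \<Phi> n)
    moreover have "inner (\<Sum>n<N. a x n *\<^sub>R q n) (\<Sum>n<N. a y n *\<^sub>R q n) = (\<Sum>n<N. a x n * a y n)" for N
      by (simp add: inner_sum_left inner_sum_right q if_distrib cong: if_cong) (simp add: mult.commute)
    ultimately show ?thesis using sums[OF n] LIMSEQ_unique unfolding sums_def by auto
  qed
  moreover have "inner (\<Phi> x) z = 0" if n: "norm x = 1" and z: "\<And>n. inner (q n) z = 0" for x z
  proof -
    have "(\<lambda>N. inner (\<Sum>n<N. a x n *\<^sub>R q n) z) \<longlonglongrightarrow> inner (\<Phi> x) z" by (intro tendsto_inner \<Phi> n tendsto_const)
    then show ?thesis by (simp add: inner_sum_left z LIMSEQ_const_iff)
  qed
  ultimately show ?thesis by blast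
qed

section \<open>A total isotropic cone with the prescribed kernel\<close>

locale frame_pair = M: euclidean_frame b f g + N: complete_lorentz_space e
  for b f g :: "'m::euclidean_space" and e :: "'h::{real_inner,complete_space}"
begin

text \<open>By \<open>norm_sq\<close> the norm of a difference is expressed through
  \<open>B\<close>; since \<open>e0\<close> is a combination of \<open>F up\<close> and
  \<open>F um\<close>, only values of the kernel occur, and these are continuous.\<close>

lemma model_continuous:
  fixes F :: "'m \<Rightarrow> 'h"
  assumes F: "\<And>u v. u \<in> M.C \<Longrightarrow> v \<in> M.C \<Longrightarrow> N.B (F u) (F v) = M.B u v powr t" and t: "t > 0"
    and p: "N.e0 = (1 / sqrt 2) *\<^sub>R (F M.up + F M.um)"
  shows "continuous_on M.C F"
  unfolding continuous_on_sequentially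
proof (intro allI ballI impI)
  fix x u assume xu: "u \<in> M.C" "(\<forall>n. x n \<in> M.C) \<and> x \<longlonglongrightarrow> u"
  then have x: "x n \<in> M.C" "x \<longlonglongrightarrow> u" for n by auto
  have nn: "\<forall>\<^sub>F n in sequentially. 0 \<le> M.B (x n) v" if "v \<in> M.C" for v
    using M.B_null_prod(1)[OF x(1) that] by simp
  have lim: "(\<lambda>n. N.B (F (x n)) (F v)) \<longlonglongrightarrow> N.B (F u) (F v)" if v: "v \<in> M.C" for v
    unfolding F[OF x(1) v] F[OF xu(1) v]
    by (intro tendsto_powr' M.tendsto_B x tendsto_const disjI2 conjI nn v t)
  have e: "N.B w N.e0 = (N.B w (F M.up) + N.B w (F M.um)) / sqrt 2" for w
    by (simp add: p lorentz_simps add_divide_distrib)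
  have z: "N.B (F v) (F v) = 0" if "v \<in> M.C" for v
    using F[OF that that] that by (simp add: M.C_def)
  have d: "(norm (F (x n) - F u))\<^sup>2 = 2 * ((N.B (F (x n)) (F M.up) + N.B (F (x n)) (F M.um)) / sqrt 2 - (N.B (F u) (F M.up) + N.B (F u) (F M.um)) / sqrt 2)\<^sup>2
      + 2 * N.B (F (x n)) (F u)" for n
    unfolding N.norm_sq lorentz_diff_left e[of "F (x n)"] e[of "F u"] lorentz_diff_right
    by (simp add: z[OF x(1)] z[OF xu(1)] lorentz_commute[of e "F u" "F (x n)"])
  have "(\<lambda>n. (norm (F (x n) - F u))\<^sup>2) \<longlonglongrightarrow> 2 * ((N.B (F u) (F M.up) + N.B (F u) (F M.um)) / sqrt 2 - (N.B (F u) (F M.up) + N.B (F u) (F M.um)) / sqrt 2)\<^sup>2 + 2 * N.B (F u) (F u)"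
    unfolding d by (intro tendsto_intros lim M.up_C M.um_C xu(1)) simp_all
  then have "(\<lambda>n. (norm (F (x n) - F u))\<^sup>2) \<longlonglongrightarrow> 0" by (simp add: z[OF xu(1)])
  then have "(\<lambda>n. sqrt ((norm (F (x n) - F u))\<^sup>2)) \<longlonglongrightarrow> sqrt 0" by (rule tendsto_real_sqrt)
  then have "(\<lambda>n. F (x n) - F u) \<longlonglongrightarrow> 0" by (simp add: tendsto_norm_zero_iff)
  then show "(F \<circ> x) \<longlonglongrightarrow> F u" by (simp add: LIM_zero_iff o_def)
qed

lemma infinite_dimensional_sequence:
  fixes d :: "nat \<Rightarrow> 'h"
  assumes d: "d 0 = N.e0" and S: "closure (span (range d)) = UNIV" and inf: "\<not> (\<exists>S::'h set. finite S \<and> span S = UNIV)"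
  shows "\<exists>q :: nat \<Rightarrow> 'h. (\<forall>i j. inner (q i) (q j) = (if i = j then 1 else 0)) \<and> closure (span (range q)) = UNIV \<and> q 0 = N.e0"
proof -
  have "\<not> range d \<subseteq> span S'" if "finite S'" for S'
  proof
    assume "range d \<subseteq> span S'"
    then have "span (range d) \<subseteq> span S'" by (rule span_minimal) simp
    then have "closure (span (range d)) \<subseteq> span S'" using closed_span_finite[OF that] by (rule closure_minimal)
    then show False using S inf that by auto
  qed
  then obtain q :: "nat \<Rightarrow> 'h" where "(\<forall>i j. inner (q i) (q j) = (if i = j then 1 else 0)) \<and>
    span (range q) = span (range d) \<and> q 0 = d 0"
    using orthonormal_sequence[of d] d by auto
  then show ?thesis using d S by (intro exI[of _ q]) simp
qed

text \<open>Writing \<open>u = l u *\<^sub>R (M.e0 + x u)\<close> with a unit vector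
  \<open>x u\<close> orthogonal to \<open>M.e0\<close> gives the product
  \<open>l u * l v * (1 - inner (x u) (x v))\<close>. The feature map realises the power of the last
  factor, the heights are raised separately, and \<open>q 0\<close> is reserved for
  \<open>N.e0\<close>.\<close>

lemma ex_feature_cone:
  fixes q :: "nat \<Rightarrow> 'h"
  assumes t: "0 < t" "t < 1" and q: "\<And>i j. inner (q i) (q j) = (if i = j then 1 else 0)" "q 0 = N.e0"
  shows "\<exists>F :: 'm \<Rightarrow> 'h. (\<forall>u\<in>M.C. F u \<in> N.C) \<and> (\<forall>u\<in>M.C. \<forall>v\<in>M.C. N.B (F u) (F v) = M.B u v powr t)"
proof -
  have "inner (q (Suc i)) (q (Suc j)) = (if i = j then 1 else 0)" for i j by (simp add: q(1))
  from feature_map[of "\<lambda>n. q (Suc n)" t, OF this t] obtain \<Phi> :: "'m \<Rightarrow> 'h"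
    where \<Phi>0: "(\<forall>x y. norm x = 1 \<longrightarrow> norm y = 1 \<longrightarrow> inner (\<Phi> x) (\<Phi> y) = 1 - (1 - inner x y) powr t) \<and>
    (\<forall>x z. norm x = 1 \<longrightarrow> (\<forall>n. inner (q (Suc n)) z = 0) \<longrightarrow> inner (\<Phi> x) z = 0)" ..
  have \<Phi>: "norm x = 1 \<Longrightarrow> norm y = 1 \<Longrightarrow> inner (\<Phi> x) (\<Phi> y) = 1 - (1 - inner x y) powr t"
    "norm x = 1 \<Longrightarrow> (\<And>n. inner (q (Suc n)) z = 0) \<Longrightarrow> inner (\<Phi> x) z = 0" for x y z
    using \<Phi>0 by simp_all
  have \<Phi>e: "inner (\<Phi> x) N.e0 = 0" if "norm x = 1" for x
    by (rule \<Phi>(2)[OF that]) (simp add: q(2)[symmetric] q(1))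
  define l where "l u = M.B u M.e0" for u
  define x where "x u = (1 / l u) *\<^sub>R u - M.e0" for u
  have l: "l u > 0" if "u \<in> M.C" for u using that by (simp add: l_def M.C_def)
  have xe: "M.B (x u) M.e0 = 0" if "u \<in> M.C" for u
    using l[OF that] by (simp add: x_def lorentz_simps) (simp add: l_def)
  have xx: "inner (x u) (x v) = 1 - M.B u v / (l u * l v)" if "u \<in> M.C" "v \<in> M.C" for u v
  proof -
    have "inner (x u) (x v) = - M.B (x u) (x v)" using xe that by (simp add: M.inner_B)
    also have "M.B (x u) (x v) = M.B u v / (l u * l v) - 1"
      using l[OF that(1)] l[OF that(2)]
      by (simp add: x_def lorentz_simps lorentz_commute[of b M.e0 v]) (simp add: l_def field_simps)
    finally show ?thesis by simp
  qed
  have nx: "norm (x u) = 1" if "u \<in> M.C" for u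
    using xx[OF that that] that by (simp add: norm_eq_1 M.C_def)
  define F where "F u = (l u powr t) *\<^sub>R (N.e0 + \<Phi> (x u))" for u
  have FF: "N.B (F u) (F v) = M.B u v powr t" if u: "u \<in> M.C" and v: "v \<in> M.C" for u v
  proof -
    have b: "M.B u v \<ge> 0" by (rule M.B_null_prod(1)[OF u v])
    have "N.B (\<Phi> (x u)) (\<Phi> (x v)) = - inner (\<Phi> (x u)) (\<Phi> (x v))"
      by (simp add: N.B_inner \<Phi>e nx u v)
    then have "N.B (N.e0 + \<Phi> (x u)) (N.e0 + \<Phi> (x v)) = 1 - inner (\<Phi> (x u)) (\<Phi> (x v))"
      by (simp add: lorentz_simps N.B_e0 N.B_e0' \<Phi>e nx u v)
    also have "\<dots> = (M.B u v / (l u * l v)) powr t" using \<Phi>(1)[OF nx[OF u] nx[OF v]] by (simp add: xx u v)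
    finally have "N.B (F u) (F v) = l u powr t * l v powr t * (M.B u v / (l u * l v)) powr t"
      by (simp add: F_def lorentz_scale_left lorentz_scale_right)
    also have "\<dots> = (l u * l v * (M.B u v / (l u * l v))) powr t"
      using l[OF u] l[OF v] b by (simp only: powr_mult mult_nonneg_nonneg less_imp_le zero_le_divide_iff)
    also have "l u * l v * (M.B u v / (l u * l v)) = M.B u v" using l[OF u] l[OF v] by simp
    finally show ?thesis .
  qed
  moreover have "F u \<in> N.C" if u: "u \<in> M.C" for u
  proof -
    have "N.B (F u) N.e0 > 0" using l[OF u] by (simp add: F_def lorentz_simps N.B_e0 \<Phi>e nx u)
    moreover have "N.B (F u) (F u) = 0" using FF[OF u u] u by (simp add: M.C_def)
    ultimately show ?thesis by (simp add: N.C_def)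
  qed
  ultimately show ?thesis by blast
qed

text \<open>The cone of \<open>ex_feature_cone\<close> need not be total. Its closed span is
  separable and infinite-dimensional, so it has an orthonormal basis to be matched with one of the
  whole space; as the matching fixes \<open>e0\<close>, it preserves the form.\<close>

lemma ex_model:
  assumes t: "0 < t" "t < 1" and sep: "separable_space (euclidean :: 'h topology)"
    and inf: "\<not> (\<exists>S::'h set. finite S \<and> span S = UNIV)"
  shows "\<exists>F :: 'm \<Rightarrow> 'h. (\<forall>u\<in>M.C. F u \<in> N.C) \<and> (\<forall>u\<in>M.C. \<forall>v\<in>M.C. N.B (F u) (F v) = M.B u v powr t) \<and>
    closure (span (F ` M.C)) = UNIV \<and> N.e0 = (1 / sqrt 2) *\<^sub>R (F M.up + F M.um)"
proof -
  obtain Z :: "'h set" where Z: "countable Z" "closure Z = UNIV" using sep by (auto simp: separable_space_def)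
  have Zne: "Z \<noteq> {}" using Z(2) by auto
  \<comment> \<open>With \<open>e0\<close> in first position Gram-Schmidt keeps it as the first
    basis vector, and the unitary map below fixes it.\<close>
  define d where "d = case_nat N.e0 (from_nat_into Z)"
  have "Z \<subseteq> span (range d)"
  proof
    fix z assume "z \<in> Z"
    then obtain n where "z = from_nat_into Z n" using range_from_nat_into[OF Zne Z(1)] by blast
    then have "z = d (Suc n)" by (simp add: d_def)
    then show "z \<in> span (range d)" by (simp add: span_base)
  qed
  then have "closure (span (range d)) = UNIV" using Z(2) closure_mono by blast
  then obtain qh :: "nat \<Rightarrow> 'h" where qh: "\<And>i j. inner (qh i) (qh j) = (if i = j then 1 else 0)"
    "closure (span (range qh)) = UNIV" "qh 0 = N.e0"
    using infinite_dimensional_sequence[of d, OF _ _ inf] by (auto simp: d_def)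
  obtain F0 :: "'m \<Rightarrow> 'h" where F0: "\<And>u. u \<in> M.C \<Longrightarrow> F0 u \<in> N.C" "\<And>u v. u \<in> M.C \<Longrightarrow> v \<in> M.C \<Longrightarrow> N.B (F0 u) (F0 v) = M.B u v powr t"
    using ex_feature_cone[OF t, of qh] qh(1,3) by blast
  let ?p = "(1 / sqrt 2) *\<^sub>R (F0 M.up + F0 M.um)"
  have p: "?p \<in> N.H"
    using N.mid_H[OF F0(1)[OF M.up_C] F0(1)[OF M.um_C]] F0(2)[OF M.up_C M.um_C] M.up_um by simp
  \<comment> \<open>Puts \<open>e0\<close> into the span of the image, where the continuity argument
    and the orthonormal basis need it.\<close>
  obtain G where G: "G \<in> N.LO" "G ?p = N.e0" using N.refl_ex_H[OF p N.e0_H] by blast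
  define F1 where "F1 u = G (F0 u)" for u
  have F1: "\<And>u. u \<in> M.C \<Longrightarrow> F1 u \<in> N.C" "\<And>u v. u \<in> M.C \<Longrightarrow> v \<in> M.C \<Longrightarrow> N.B (F1 u) (F1 v) = M.B u v powr t"
    using F0 by (simp_all add: F1_def N.LO_C[OF G(1)] N.LO_B[OF G(1)])
  have F1e: "N.e0 = (1 / sqrt 2) *\<^sub>R (F1 M.up + F1 M.um)"
    unfolding G(2)[symmetric] by (simp only: F1_def N.LO_scale[OF G(1)] N.LO_add[OF G(1)])
  have cF1: "continuous_on M.C F1" by (rule model_continuous[OF F1(2) t(1) F1e])
  obtain T where T: "countable T" "T \<subseteq> M.C" "M.C \<subseteq> closure T" using separable[of M.C] by blast
  have Tne: "T \<noteq> {}" using T(3) M.up_C by auto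
  define d1 where "d1 = case_nat N.e0 (\<lambda>n. F1 (from_nat_into T n))"
  let ?S = "closure (span (range d1))"
  have d1T: "F1 ` T \<subseteq> span (range d1)"
  proof
    fix z assume "z \<in> F1 ` T"
    then obtain v where v: "v \<in> T" "z = F1 v" by blast
    from v(1) have "v \<in> range (from_nat_into T)" unfolding range_from_nat_into[OF Tne T(1)] .
    then obtain n where "v = from_nat_into T n" by blast
    then have "z = F1 (from_nat_into T n)" by (simp add: v(2))
    then have "z = d1 (Suc n)" by (simp add: d1_def)
    then show "z \<in> span (range d1)" by (simp add: span_base)
  qed
  have F1cl: "F1 u \<in> closure (span (range d1))" if u: "u \<in> M.C" for u
  proof -
    have "u \<in> closure T" using T(3) u by blast
    then obtain x where x: "\<And>n. x n \<in> T" "x \<longlonglongrightarrow> u" unfolding closure_sequential by blast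
    have "(\<lambda>n. F1 (x n)) \<longlonglongrightarrow> F1 u"
      using continuous_on_tendsto_compose[OF cF1 x(2) u] x(1) T(2) by (auto simp: eventually_sequentially)
    moreover have "\<forall>n. F1 (x n) \<in> span (range d1)" using x(1) d1T by blast
    ultimately show ?thesis unfolding closure_sequential by (intro exI[of _ "\<lambda>n. F1 (x n)"] conjI)
  qed
  have d1F: "range d1 \<subseteq> span (F1 ` M.C)"
  proof
    fix z assume "z \<in> range d1"
    then obtain n where n: "z = d1 n" by blast
    show "z \<in> span (F1 ` M.C)"
    proof (cases n)
      case 0
      then show ?thesis using F1e M.up_C M.um_C
        by (simp only: n d1_def nat.case) (intro span_scale span_add span_base imageI)
    next
      case (Suc k)
      then have "z = F1 (from_nat_into T k)" by (simp add: n d1_def)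
      then show ?thesis using from_nat_into[OF Tne, of k] T(2) by (intro span_base) blast
    qed
  qed
  have Seq: "?S = closure (span (F1 ` M.C))"
  proof
    show "?S \<subseteq> closure (span (F1 ` M.C))" using span_minimal[OF d1F subspace_span] by (rule closure_mono)
    have "span (F1 ` M.C) \<subseteq> ?S" using F1cl by (intro span_minimal subspace_closure subspace_span) blast
    then show "closure (span (F1 ` M.C)) \<subseteq> ?S" by (rule closure_minimal) simp
  qed
  \<comment> \<open>A finite-dimensional span would contain the snowflake curve along the
    horocycle.\<close>
  have "\<not> range d1 \<subseteq> span S'" if S': "finite S'" for S'
  proof
    assume "range d1 \<subseteq> span S'"
    then have "span (range d1) \<subseteq> span S'" by (rule span_minimal) simp
    then have "?S \<subseteq> span S'" using closed_span_finite[OF S'] by (rule closure_minimal)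
    then have "range (\<lambda>x. F1 (M.ux x)) \<subseteq> span S'" using F1cl M.ux_C by blast
    then show False
      by (intro N.snowflake_infinite_span[of "\<lambda>x. F1 (M.ux x)" 1 t, OF _ _ t S']) (simp_all add: F1 M.ux_C M.ux_ux)
  qed
  then obtain q1 :: "nat \<Rightarrow> 'h" where q1: "\<And>i j. inner (q1 i) (q1 j) = (if i = j then 1 else 0)"
    "span (range q1) = span (range d1)" "q1 0 = N.e0"
    using orthonormal_sequence[of d1] by (auto simp: d1_def)
  have "inner (q1 i) (q1 j) = inner (qh i) (qh j)" for i j by (simp add: q1(1) qh(1))
  from unitary_extension[of UNIV q1 qh, OF this] obtain U where
    U0: "(\<forall>v\<in>?S. \<forall>w\<in>?S. U (v + w) = U v + U w \<and> inner (U v) (U w) = inner v w) \<and>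
      (\<forall>c. \<forall>v\<in>?S. U (c *\<^sub>R v) = c *\<^sub>R U v) \<and> U ` ?S = closure (span (range qh)) \<and> (\<forall>i\<in>UNIV. U (q1 i) = qh i)"
    unfolding q1(2) ..
  have U: "v \<in> ?S \<Longrightarrow> w \<in> ?S \<Longrightarrow> U (v + w) = U v + U w" "v \<in> ?S \<Longrightarrow> w \<in> ?S \<Longrightarrow> inner (U v) (U w) = inner v w"
    "v \<in> ?S \<Longrightarrow> U (c *\<^sub>R v) = c *\<^sub>R U v" "U ` ?S = UNIV" for v w c
    using U0 qh(2) by simp_all
  have Ue: "U N.e0 = N.e0" using U0 q1(3) qh(3) by (metis UNIV_I)
  have "d1 0 \<in> ?S" by (rule subsetD[OF closure_subset], rule span_base) simp
  then have e0S: "N.e0 \<in> ?S" unfolding d1_def nat.case .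
  have UB: "N.B (U v) (U w) = N.B v w" if "v \<in> ?S" "w \<in> ?S" for v w
    using U(2)[OF that] U(2)[OF that(1) e0S] U(2)[OF that(2) e0S] by (simp add: N.B_inner Ue)
  define F where "F u = U (F1 u)" for u
  have FB: "N.B (F u) (F v) = M.B u v powr t" if "u \<in> M.C" "v \<in> M.C" for u v
    using UB F1cl F1(2) that by (simp add: F_def)
  have FC: "F u \<in> N.C" if u: "u \<in> M.C" for u
  proof -
    have "N.B (F u) N.e0 = N.B (F1 u) N.e0" using UB[OF F1cl[OF u] e0S] by (simp add: F_def Ue)
    moreover have "N.B (F u) (F u) = 0" using FB[OF u u] u t by (simp add: M.C_def)
    ultimately show ?thesis using F1(1)[OF u] by (simp add: N.C_def)
  qed
  have span_sub: "w \<in> ?S \<and> U w \<in> span (F ` M.C)" if "w \<in> span (F1 ` M.C)" for w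
    using that
  proof (induction rule: span_induct_alt)
    case base
    have "0 \<in> ?S" using closure_subset span_zero by blast
    moreover have "U 0 = 0" using U(3)[OF \<open>0 \<in> ?S\<close>, of 0] by simp
    ultimately show ?case by (simp add: span_zero)
  next
    case (step c x y)
    then obtain u where u: "u \<in> M.C" "x = F1 u" by blast
    have S: "c *\<^sub>R x \<in> ?S" using F1cl[OF u(1)] u(2) subspace_scale[OF subspace_closure[OF subspace_span]] by blast
    then have "c *\<^sub>R x + y \<in> ?S" using step subspace_add[OF subspace_closure[OF subspace_span]] by blast
    moreover have "U (c *\<^sub>R x + y) = c *\<^sub>R F u + U y" using U(1)[OF S] U(3)[OF F1cl[OF u(1)]] step u by (simp add: F_def)
    moreover have "c *\<^sub>R F u + U y \<in> span (F ` M.C)" using step u by (intro span_add[OF span_scale[OF span_base]]) auto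
    ultimately show ?case by simp
  qed
  have "v \<in> closure (span (F ` M.C))" for v
  proof -
    obtain w where w: "w \<in> ?S" "v = U w" using U(4) by (metis UNIV_I imageE)
    then obtain x where x: "\<And>n. x n \<in> span (F1 ` M.C)" "x \<longlonglongrightarrow> w" unfolding Seq closure_sequential by blast
    have "norm (U (x n) - U w) = norm (x n - w)" for n
    proof -
      have "x n \<in> ?S" using span_sub x by blast
      then show ?thesis using U(2)[of "x n" "x n"] U(2)[of "x n" w] U(2)[of w "x n"] U(2)[of w w] w(1)
        by (simp add: norm_eq_sqrt_inner inner_diff)
    qed
    then have "(\<lambda>n. U (x n)) \<longlonglongrightarrow> v" using x(2) w(2) by (simp add: LIMSEQ_iff)
    moreover have "\<forall>n. U (x n) \<in> span (F ` M.C)" using span_sub x(1) by blast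
    ultimately show ?thesis unfolding closure_sequential by (intro exI[of _ "\<lambda>n. U (x n)"] conjI)
  qed
  then have "closure (span (F ` M.C)) = UNIV" by blast
  moreover have "N.e0 = (1 / sqrt 2) *\<^sub>R (F M.up + F M.um)"
  proof -
    have "F1 M.up + F1 M.um \<in> ?S" using F1cl M.up_C M.um_C subspace_add[OF subspace_closure[OF subspace_span]] by blast
    then have "U ((1 / sqrt 2) *\<^sub>R (F1 M.up + F1 M.um)) = (1 / sqrt 2) *\<^sub>R (F M.up + F M.um)"
      using U(1)[OF F1cl[OF M.up_C] F1cl[OF M.um_C]] U(3) by (simp only: F_def)
    then show ?thesis using Ue F1e by simp
  qed
  ultimately show ?thesis using FB FC by (intro exI[of _ F]) simp
qed

end

lemma continuous_map_scaleR_left: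
  fixes h :: "'x \<Rightarrow> 'a::real_normed_vector"
  assumes "continuous_map X euclidean h"
  shows "continuous_map X euclidean (\<lambda>x. c *\<^sub>R h x)"
proof -
  have "continuous_map euclidean euclidean (\<lambda>v :: 'a. c *\<^sub>R v)"
    unfolding continuous_map_iff_continuous2 by (intro continuous_intros)
  from continuous_map_compose[OF assms this] show ?thesis by (simp only: o_def)
qed

lemma continuous_map_ball:
  fixes h :: "'x \<Rightarrow> 'a::metric_space"
  assumes h: "continuous_map X euclidean h" and x: "x \<in> topspace X" and r: "r > 0"
  shows "\<exists>U. openin X U \<and> x \<in> U \<and> (\<forall>y\<in>U. dist (h x) (h y) < r)"
proof (intro exI conjI)
  show "openin X {y \<in> topspace X. h y \<in> ball (h x) r}"
    by (rule openin_continuous_map_preimage[OF h]) simp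
qed (use x r in auto)

section \<open>The representation carried by a total isotropic cone\<close>

locale null_model = frame_pair b f g e
  for b f g :: "'m::euclidean_space" and e :: "'h::{real_inner,complete_space}" +
  fixes F :: "'m \<Rightarrow> 'h" and t :: real
  assumes t: "0 < t" "t < 1"
    and F_C: "u \<in> M.C \<Longrightarrow> F u \<in> N.C"
    and F_B: "u \<in> M.C \<Longrightarrow> v \<in> M.C \<Longrightarrow> N.B (F u) (F v) = M.B u v powr t"
    and F_dense: "closure (span (F ` M.C)) = UNIV"
    and F_e0: "N.e0 = (1 / sqrt 2) *\<^sub>R (F M.up + F M.um)"
begin

lemma F_up_um: "N.B (F M.up) (F M.um) = 1" "N.B (F M.um) (F M.up) = 1"
  using F_B[OF M.up_C M.um_C] F_B[OF M.um_C M.up_C] M.up_um M.um_up by simp_all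

lemma F_null: "u \<in> M.C \<Longrightarrow> N.B (F u) (F u) = 0"
  using F_C by (simp add: N.C_def)

text \<open>Isotropic vectors with product zero are proportional; the factor is read off by pairing
  with an isotropic \<open>w\<close> that is not orthogonal to \<open>u\<close>.\<close>

lemma F_scale: assumes u: "u \<in> M.C" and c: "c > 0" shows "F (c *\<^sub>R u) = (c powr t) *\<^sub>R F u"
proof -
  have cu: "c *\<^sub>R u \<in> M.C" by (rule M.C_scale[OF u c])
  have "N.B (F u) (F (c *\<^sub>R u)) = 0"
    using u by (simp add: F_B[OF u cu] lorentz_simps M.C_def)
  from N.B_null_prod(2)[OF F_C[OF u] F_C[OF cu] this] obtain k where k: "F (c *\<^sub>R u) = k *\<^sub>R F u" by blast
  have e: "M.B v M.up + M.B v M.um > 0" if "v \<in> M.C" for v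
  proof -
    have "(M.B v M.up + M.B v M.um) / sqrt 2 = M.B v M.e0"
      by (simp add: M.e0_up_um lorentz_simps add_divide_distrib)
    also have "\<dots> > 0" using that by (simp add: M.C_def)
    finally show ?thesis by (simp add: zero_less_divide_iff)
  qed
  obtain w where w: "w \<in> M.C" "M.B u w > 0"
    using e[OF u] M.B_null_prod(1)[OF u M.up_C] M.B_null_prod(1)[OF u M.um_C] M.up_C M.um_C
    by (metis add_cancel_right_left less_eq_real_def order_less_irrefl)
  have "k * M.B u w powr t = (c * M.B u w) powr t"
    using F_B[OF cu w(1)] F_B[OF u w(1)] by (simp add: k lorentz_simps)
  also have "\<dots> = c powr t * M.B u w powr t" using c w(2) by (simp add: powr_mult)
  finally show ?thesis using w(2) k by simp
qed

text \<open>\<open>A\<close> permutes the cone and preserves the kernel, and two total families with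
  the same Gram matrix differ by a linear isometry.\<close>

lemma ex_R: assumes A: "A \<in> M.LO" shows "\<exists>A'\<in>N.LO. \<forall>u\<in>M.C. A' (F u) = F (A u)"
proof (rule N.lorentz_extension[OF _ F_dense _ M.up_C M.um_C])
  have AC: "A u \<in> M.C" if "u \<in> M.C" for u using M.LO_C[OF A that] .
  show "N.B (F u) (F v) = N.B (F (A u)) (F (A v))" if "u \<in> M.C" "v \<in> M.C" for u v
    using F_B[OF that] F_B[OF AC[OF that(1)] AC[OF that(2)]] M.LO_B[OF A] by simp
  have "A ` M.C = M.C"
    using AC M.LO_C[OF M.LO_inv(1)[OF A]] M.LO_inv(3)[OF A] by (metis image_subsetI rev_image_eqI subsetI subset_antisym)
  then have "(\<lambda>u. F (A u)) ` M.C = F ` M.C" by (metis image_image)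
  then show "closure (span ((\<lambda>u. F (A u)) ` M.C)) = UNIV" by (simp add: F_dense)
  show "(1 / sqrt 2) *\<^sub>R (F M.up + F M.um) \<in> N.H" using F_e0 N.e0_H by simp
  show "(1 / sqrt 2) *\<^sub>R (F (A M.up) + F (A M.um)) \<in> N.H"
    using N.mid_H[OF F_C[OF AC[OF M.up_C]] F_C[OF AC[OF M.um_C]]] F_B[OF AC[OF M.up_C] AC[OF M.um_C]]
    by (simp add: M.LO_B[OF A] M.up_um)
qed

definition R where "R A = (SOME A'. A' \<in> N.LO \<and> (\<forall>u\<in>M.C. A' (F u) = F (A u)))"

lemma R: assumes A: "A \<in> M.LO" shows "R A \<in> N.LO" "u \<in> M.C \<Longrightarrow> R A (F u) = F (A u)"
proof -
  have "\<exists>A'. A' \<in> N.LO \<and> (\<forall>u\<in>M.C. A' (F u) = F (A u))" using ex_R[OF A] by blast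
  from someI_ex[OF this] show "R A \<in> N.LO" "u \<in> M.C \<Longrightarrow> R A (F u) = F (A u)" unfolding R_def by auto
qed

lemma R_comp: assumes A: "A \<in> M.LO" "A' \<in> M.LO" shows "R (A \<circ> A') = R A \<circ> R A'"
proof (rule N.LO_eq_dense[OF R(1)[OF M.LO_comp[OF A]] N.LO_comp[OF R(1)[OF A(1)] R(1)[OF A(2)]] F_dense])
  fix x assume "x \<in> F ` M.C"
  then obtain u where u: "u \<in> M.C" "x = F u" by blast
  then show "R (A \<circ> A') x = (R A \<circ> R A') x"
    using R(2)[OF M.LO_comp[OF A] u(1)] R(2)[OF A(2) u(1)] R(2)[OF A(1) M.LO_C[OF A(2) u(1)]] by simp
qed

definition \<rho> where "\<rho> h = restrict (R (lin_ext b h)) N.H"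

lemma \<rho>_carrier: "h \<in> carrier (Isom b) \<Longrightarrow> \<rho> h \<in> carrier (Isom e)"
  unfolding \<rho>_def by (intro N.restrict_Isom R M.lin_ext_LO)

lemma lin_ext_\<rho>: "h \<in> carrier (Isom b) \<Longrightarrow> lin_ext e (\<rho> h) = R (lin_ext b h)"
  unfolding \<rho>_def by (intro N.lin_ext_restrict R M.lin_ext_LO)

lemma \<rho>_hom: "\<rho> \<in> hom (Isom b) (Isom e)"
proof (rule homI)
  fix h k assume hk: "h \<in> carrier (Isom b)" "k \<in> carrier (Isom b)"
  note L = M.lin_ext_LO[OF hk(1)] M.lin_ext_LO[OF hk(2)]
  show "\<rho> (h \<otimes>\<^bsub>Isom b\<^esub> k) = \<rho> h \<otimes>\<^bsub>Isom e\<^esub> \<rho> k"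
    unfolding \<rho>_def M.lin_ext_mult[OF hk] R_comp[OF L] by (rule N.restrict_mult[OF R(1)[OF L(1)] R(1)[OF L(2)], symmetric])
qed (rule \<rho>_carrier)

text \<open>Pointwise continuity is given on the hyperboloid and spreads to all vectors, because the
  hyperboloid spans.\<close>

lemma lin_ext_continuous: "continuous_map (Isom_topology b) euclidean (\<lambda>h. lin_ext b h v)"
proof -
  have top: "topspace (Isom_topology b) \<subseteq> carrier (Isom b)"
    unfolding Isom_topology_def by auto
  have H: "continuous_map (Isom_topology b) euclidean (\<lambda>h. lin_ext b h x)" if x: "x \<in> M.H" for x
  proof (rule continuous_map_eq)
    have "continuous_map (Isom_topology b) (top_of_set M.H) (\<lambda>h. h x)"
      unfolding Isom_topology_def M.hyp_topology_eq
      using continuous_map_product_projection[OF x, of "\<lambda>_. top_of_set M.H"]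
      by (rule continuous_map_from_subtopology)
    then show "continuous_map (Isom_topology b) euclidean (\<lambda>h. h x)"
      by (rule continuous_map_into_fulltopology)
    show "h x = lin_ext b h x" if "h \<in> topspace (Isom_topology b)" for h
      using M.lin_ext_props(3)[OF _ x] top that by (metis subsetD)
  qed
  have "v \<in> span M.H" using span_hyp_space[OF M.e_nz] by simp
  then show ?thesis
  proof (induction rule: span_induct_alt)
    case base
    show ?case
    proof (rule continuous_map_eq[of _ _ "\<lambda>_. 0"])
      show "0 = lin_ext b h 0" if "h \<in> topspace (Isom_topology b)" for h
        using linear_0[OF M.lin_ext_props(1)] top that by (metis subsetD)
    qed simp
  next
    case (step c x y)
    show ?case
    proof (rule continuous_map_eq)
      show "continuous_map (Isom_topology b) euclidean (\<lambda>h. c *\<^sub>R lin_ext b h x + lin_ext b h y)"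
        by (intro continuous_map_add continuous_map_scaleR_left step(2) H step(1))
      show "c *\<^sub>R lin_ext b h x + lin_ext b h y = lin_ext b h (c *\<^sub>R x + y)" if "h \<in> topspace (Isom_topology b)" for h
        using M.lin_ext_props(1)[of h] top that by (metis linear_add linear_scale subsetD)
    qed
  qed
qed

lemma R_continuous_span:
  assumes v: "v \<in> span (F ` M.C)"
  shows "continuous_map (Isom_topology b) euclidean (\<lambda>h. R (lin_ext b h) v)"
  using v
proof (induction rule: span_induct_alt)
  have top: "h \<in> carrier (Isom b)" if "h \<in> topspace (Isom_topology b)" for h
    using that unfolding Isom_topology_def by auto
  case base
  show ?case
    by (rule continuous_map_eq[of _ _ "\<lambda>_. 0"])
      (use linear_0[OF N.LO_linear[OF R(1)[OF M.lin_ext_LO[OF top]]]] in auto)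
next
  have top: "h \<in> carrier (Isom b)" if "h \<in> topspace (Isom_topology b)" for h
    using that unfolding Isom_topology_def by auto
  case (step c x y)
  then obtain u where u: "u \<in> M.C" "x = F u" by blast
  have cF: "continuous_on M.C F" by (rule model_continuous[OF F_B t(1) F_e0])
  have "continuous_map (Isom_topology b) (top_of_set M.C) (\<lambda>h. lin_ext b h u)"
    by (intro continuous_map_into_subtopology lin_ext_continuous) (use M.LO_C[OF M.lin_ext_LO[OF top] u(1)] in auto)
  then have "continuous_map (Isom_topology b) euclidean (F \<circ> (\<lambda>h. lin_ext b h u))"
    by (rule continuous_map_compose) (simp add: cF)
  then have cx: "continuous_map (Isom_topology b) euclidean (\<lambda>h. F (lin_ext b h u))" by (simp add: o_def)
  show ?case
  proof (rule continuous_map_eq)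
    show "continuous_map (Isom_topology b) euclidean (\<lambda>h. c *\<^sub>R F (lin_ext b h u) + R (lin_ext b h) y)"
      by (intro continuous_map_add continuous_map_scaleR_left step(2) cx)
    show "c *\<^sub>R F (lin_ext b h u) + R (lin_ext b h) y = R (lin_ext b h) (c *\<^sub>R x + y)" if "h \<in> topspace (Isom_topology b)" for h
      using R[OF M.lin_ext_LO[OF top[OF that]]] u by (simp add: N.LO_add N.LO_scale)
  qed
qed

text \<open>A three-epsilon argument from a dense subspace. The locally uniform bound on operator
  norms comes from \<open>LO_norm\<close>: near \<open>k\<close> the displacement of
  \<open>e0\<close> is bounded, because \<open>e0\<close> lies in that subspace.\<close>

lemma R_continuous: "continuous_map (Isom_topology b) euclidean (\<lambda>h. R (lin_ext b h) x)"
proof -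
  have top: "R (lin_ext b h) \<in> N.LO" if "h \<in> topspace (Isom_topology b)" for h
    using that R(1)[OF M.lin_ext_LO] unfolding Isom_topology_def by auto
  have "continuous_map (Isom_topology b) Met_TC.mtopology (\<lambda>h. R (lin_ext b h) x)"
    unfolding Met_TC.continuous_map_to_metric
  proof (intro ballI allI impI)
    fix k \<epsilon> assume k: "k \<in> topspace (Isom_topology b)" and \<epsilon>: "(\<epsilon>::real) > 0"
    let ?R = "\<lambda>h. R (lin_ext b h)"
    have e0: "N.e0 \<in> span (F ` M.C)"
      unfolding F_e0 using M.up_C M.um_C by (intro span_scale span_add span_base) auto
    define K where "K = sqrt (4 * (N.\<phi> (?R k) + 1)\<^sup>2 + 1)"
    have K: "K \<ge> 1" by (simp add: K_def)
    have nb: "norm (?R h v) \<le> K * norm v" if h: "h \<in> topspace (Isom_topology b)" and d: "dist (?R h N.e0) (?R k N.e0) < 1" for h v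
    proof (rule power2_le_imp_le)
      have "\<bar>N.B (?R h N.e0 - ?R k N.e0) N.e0\<bar> \<le> norm (?R h N.e0 - ?R k N.e0)"
        unfolding N.B_e0 using Cauchy_Schwarz_ineq2[of "?R h N.e0 - ?R k N.e0" N.e0] by simp
      then have "N.\<phi> (?R h) \<le> N.\<phi> (?R k) + 1" using d by (simp add: N.\<phi>_def lorentz_simps dist_norm abs_le_iff)
      moreover have "N.\<phi> (?R h) \<ge> 1" by (rule N.\<phi>_ge1[OF top[OF h]])
      ultimately have "(N.\<phi> (?R h))\<^sup>2 \<le> (N.\<phi> (?R k) + 1)\<^sup>2" by (intro power_mono) auto
      then have "(4 * (N.\<phi> (?R h))\<^sup>2 + 1) * (norm v)\<^sup>2 \<le> (4 * (N.\<phi> (?R k) + 1)\<^sup>2 + 1) * (norm v)\<^sup>2"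
        by (intro mult_right_mono) auto
      then have "(norm (?R h v))\<^sup>2 \<le> (4 * (N.\<phi> (?R k) + 1)\<^sup>2 + 1) * (norm v)\<^sup>2"
        using N.LO_norm[OF top[OF h], of v] unfolding N.\<phi>_def by linarith
      also have "\<dots> = (K * norm v)\<^sup>2" by (simp add: K_def power_mult_distrib add_nonneg_nonneg)
      finally show "(norm (?R h v))\<^sup>2 \<le> (K * norm v)\<^sup>2" .
      show "0 \<le> K * norm v" using K by simp
    qed
    have "x \<in> closure (span (F ` M.C))" using F_dense by simp
    moreover have "\<epsilon> / (3 * K) > 0" using \<epsilon> K by simp
    ultimately obtain v where v: "v \<in> span (F ` M.C)" "dist v x < \<epsilon> / (3 * K)"
      unfolding closure_approachable by blast
    have Kv: "K * norm (x - v) < \<epsilon> / 3" using v(2) K by (simp add: dist_norm norm_minus_commute field_simps)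
    obtain U1 where U1: "openin (Isom_topology b) U1" "k \<in> U1" "\<And>h. h \<in> U1 \<Longrightarrow> dist (?R k N.e0) (?R h N.e0) < 1"
      using continuous_map_ball[OF R_continuous_span[OF e0] k zero_less_one] by auto
    have "\<epsilon> / 3 > 0" using \<epsilon> by simp
    then obtain U2 where U2: "openin (Isom_topology b) U2" "k \<in> U2" "\<And>h. h \<in> U2 \<Longrightarrow> dist (?R k v) (?R h v) < \<epsilon> / 3"
      using continuous_map_ball[OF R_continuous_span[OF v(1)] k] by meson
    show "\<exists>U. openin (Isom_topology b) U \<and> k \<in> U \<and> (\<forall>y\<in>U. ?R y x \<in> Met_TC.mball (?R k x) \<epsilon>)"
    proof (intro exI[of _ "U1 \<inter> U2"] conjI ballI)
      fix h assume h: "h \<in> U1 \<inter> U2"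
      have ht: "h \<in> topspace (Isom_topology b)" using h openin_subset[OF U1(1)] by blast
      note Rd = N.LO_diff[OF top[OF ht], of x v] N.LO_diff[OF top[OF k], of x v]
      have "?R k x - ?R h x = ?R k (x - v) + (?R k v - ?R h v) - ?R h (x - v)" unfolding Rd by simp
      then have "norm (?R k x - ?R h x) = norm (?R k (x - v) + (?R k v - ?R h v) - ?R h (x - v))" by simp
      moreover have "norm (?R k (x - v)) \<le> K * norm (x - v)" by (rule nb[OF k]) simp
      moreover have "norm (?R h (x - v)) \<le> K * norm (x - v)"
        by (rule nb[OF ht]) (use U1(3)[of h] h in \<open>simp add: dist_commute\<close>)
      moreover have "norm (?R k v - ?R h v) < \<epsilon> / 3" using U2(3)[of h] h by (simp add: dist_norm)
      ultimately have "norm (?R k x - ?R h x) < \<epsilon>"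
        using Kv norm_triangle_ineq4[of "?R k (x - v) + (?R k v - ?R h v)" "?R h (x - v)"]
          norm_triangle_ineq[of "?R k (x - v)" "?R k v - ?R h v"] by linarith
      then show "?R h x \<in> Met_TC.mball (?R k x) \<epsilon>" by (simp add: dist_norm)
    qed (use U1 U2 in auto)
  qed
  then show ?thesis by (simp add: mtopology_is_euclidean)
qed

lemma \<rho>_continuous: "continuous_action (Isom_topology b) e \<rho>"
  unfolding continuous_action_def N.hyp_topology_eq
proof
  fix x assume x: "x \<in> N.H"
  have "continuous_map (Isom_topology b) (top_of_set N.H) (\<lambda>h. R (lin_ext b h) x)"
    by (intro continuous_map_into_subtopology R_continuous)
      (use N.LO_H[OF R(1)[OF M.lin_ext_LO] x] in \<open>auto simp: Isom_topology_def\<close>)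
  then show "continuous_map (Isom_topology b) (top_of_set N.H) (\<lambda>h. \<rho> h x)"
    by (rule continuous_map_eq) (simp add: \<rho>_def x)
qed

lemma R_a: "R (M.a s) (F M.up) = exp (t * s) *\<^sub>R F M.up" "R (M.a s) (F M.um) = exp (- (t * s)) *\<^sub>R F M.um"
  using R(2)[OF M.a_LO M.up_C] R(2)[OF M.a_LO M.um_C]
  by (simp_all add: M.a_up M.a_um F_scale M.up_C M.um_C powr_def)

text \<open>The rescaled translations
  \<open>exp (- (t * real n)) *\<^sub>R R (M.a (real n)) v\<close> converge to
  \<open>B v (F um) *\<^sub>R F up\<close>, so a closed invariant subspace contains the
  limit.\<close>

lemma invariant_contains_F:
  assumes V: "subspace V" "closed V" "\<And>A. A \<in> M.LO \<Longrightarrow> R A ` V \<subseteq> V"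
    and v: "v \<in> V" "N.B v (F M.um) \<noteq> 0"
  shows "F M.up \<in> V"
proof -
  let ?p = "F M.up" and ?m = "F M.um"
  define \<alpha> \<beta> where "\<alpha> = N.B v ?m" and "\<beta> = N.B v ?p"
  define w where "w = v - \<alpha> *\<^sub>R ?p - \<beta> *\<^sub>R ?m"
  have w: "N.B w ?p = 0" "N.B w ?m = 0"
    by (simp_all add: w_def lorentz_simps F_up_um F_null M.up_C M.um_C \<alpha>_def \<beta>_def)
  let ?s = "\<lambda>n. exp (- (t * real n)) *\<^sub>R R (M.a (real n)) v"
  have ex: "(\<lambda>n. exp (- (t * real n))) \<longlonglongrightarrow> 0"
  proof -
    have "filterlim (\<lambda>n. t * real n) at_top sequentially"
      by (rule filterlim_tendsto_pos_mult_at_top[OF tendsto_const t(1) filterlim_real_sequentially])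
    then show ?thesis
      by (intro filterlim_compose[OF exp_at_bot]) (simp add: filterlim_uminus_at_top[symmetric])
  qed
  have eq: "?s n = \<alpha> *\<^sub>R ?p + (exp (- (t * real n)) * exp (- (t * real n)) * \<beta>) *\<^sub>R ?m + exp (- (t * real n)) *\<^sub>R R (M.a (real n)) w" for n
  proof -
    have "v = \<alpha> *\<^sub>R ?p + \<beta> *\<^sub>R ?m + w" by (simp add: w_def)
    then have "R (M.a (real n)) v = \<alpha> *\<^sub>R R (M.a (real n)) ?p + \<beta> *\<^sub>R R (M.a (real n)) ?m + R (M.a (real n)) w"
      using N.LO_add[OF R(1)[OF M.a_LO]] N.LO_scale[OF R(1)[OF M.a_LO]] by metis
    then show ?thesis
      by (simp add: R_a scaleR_add_right mult_ac exp_minus)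
  qed
  \<comment> \<open>Vectors orthogonal to both ends remain so, hence stay orthogonal to
    \<open>e0\<close>, where the form determines the norm.\<close>
  have nw: "norm (R (M.a s) w) = norm w" for s
  proof -
    have L: "R (M.a s) \<in> N.LO" by (rule R(1)[OF M.a_LO])
    have "N.B (R (M.a s) w) (R (M.a s) ?p) = 0" "N.B (R (M.a s) w) (R (M.a s) ?m) = 0" by (simp_all add: N.LO_B[OF L] w)
    then have "N.B (R (M.a s) w) ?p = 0" "N.B (R (M.a s) w) ?m = 0" by (simp_all add: R_a lorentz_simps)
    then have "N.B (R (M.a s) w) N.e0 = 0" "N.B w N.e0 = 0" by (simp_all add: F_e0 lorentz_simps w)
    then have "(norm (R (M.a s) w))\<^sup>2 = (norm w)\<^sup>2" by (simp add: N.norm_sq0 N.LO_B[OF L])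
    then show ?thesis by simp
  qed
  have "(\<lambda>n. exp (- (t * real n)) *\<^sub>R R (M.a (real n)) w) \<longlonglongrightarrow> 0"
  proof (rule tendsto_norm_zero_cancel)
    have "norm (exp (- (t * real n)) *\<^sub>R R (M.a (real n)) w) = exp (- (t * real n)) * norm w" for n
      by (simp add: nw)
    then show "(\<lambda>n. norm (exp (- (t * real n)) *\<^sub>R R (M.a (real n)) w)) \<longlonglongrightarrow> 0"
      using tendsto_mult_left_zero[OF ex, of "norm w"] by (simp only:)
  qed
  then have "?s \<longlonglongrightarrow> \<alpha> *\<^sub>R ?p + (0 * 0 * \<beta>) *\<^sub>R ?m + 0"
    unfolding eq by (intro tendsto_add tendsto_scaleR tendsto_mult tendsto_const ex)
  then have lim: "?s \<longlonglongrightarrow> \<alpha> *\<^sub>R ?p" by simp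
  have mem: "?s n \<in> V" for n
    using V(3)[OF M.a_LO] v(1) by (intro subspace_scale[OF V(1)]) blast
  have "\<alpha> *\<^sub>R ?p \<in> V" by (rule closed_sequentially[OF V(2) mem lim])
  then have "(1 / \<alpha>) *\<^sub>R (\<alpha> *\<^sub>R ?p) \<in> V" by (rule subspace_scale[OF V(1)])
  then show ?thesis using v(2) by (simp add: \<alpha>_def)
qed

text \<open>If some vector of \<open>V\<close> has a non-zero product with \<open>F um\<close>, then
  \<open>V\<close> contains \<open>F up\<close> and by transitivity the whole cone. Otherwise
  transitivity makes \<open>V\<close> orthogonal to the whole cone, and non-degeneracy leaves only
  zero.\<close>

lemma invariant_trivial:
  assumes V: "subspace V" "closed V" "\<And>A. A \<in> M.LO \<Longrightarrow> R A ` V \<subseteq> V"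
  shows "V = {0} \<or> V = UNIV"
proof (cases "\<exists>v\<in>V. N.B v (F M.um) \<noteq> 0")
  case True
  then have up: "F M.up \<in> V" using invariant_contains_F[OF V] by blast
  have "F u \<in> V" if u: "u \<in> M.C" for u
  proof -
    obtain A where A: "A \<in> M.LO" "A M.up = u" using M.up_trans[OF u] by blast
    have "F u = R A (F M.up)" using R(2)[OF A(1) M.up_C] A(2) by simp
    then show ?thesis using V(3)[OF A(1)] up by blast
  qed
  then have "span (F ` M.C) \<subseteq> V" by (intro span_minimal V) auto
  then have "closure (span (F ` M.C)) \<subseteq> V" using V(2) by (rule closure_minimal)
  then show ?thesis using F_dense by auto
next
  case False
  then have um: "N.B v (F M.um) = 0" if "v \<in> V" for v using that by blast
  obtain A0 where A0: "A0 \<in> M.LO" "A0 M.up = M.um" using M.up_trans[OF M.um_C] by blast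
  have "v = 0" if v: "v \<in> V" for v
  proof -
    have F0: "N.B v (F u) = 0" if u: "u \<in> M.C" for u
    proof -
      obtain A where A: "A \<in> M.LO" "A M.up = u" using M.up_trans[OF u] by blast
      let ?A = "A0 \<circ> fun_inv A"
      have L: "?A \<in> M.LO" by (rule M.LO_comp[OF A0(1) M.LO_inv(1)[OF A(1)]])
      have "?A u = M.um" using A0(2) A(2) M.LO_inv(2)[OF A(1)] by (metis o_apply)
      then have "R ?A (F u) = F M.um" using R(2)[OF L u] by simp
      then have "N.B v (F u) = N.B (R ?A v) (F M.um)" using N.LO_B[OF R(1)[OF L], of v "F u"] by simp
      also have "\<dots> = 0" using um V(3)[OF L] v by blast
      finally show ?thesis .
    qed
    have lin: "linear (\<lambda>w. N.B v w)"
      using lorentz_linear_left[of e v] by (simp only: lorentz_commute[of e v])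
    have "linear (\<lambda>w :: 'h. 0 :: real)" by (rule linearI) simp_all
    then have sp: "N.B v w = 0" if "w \<in> span (F ` M.C)" for w
      using linear_eq_on[OF lin _ that, of "\<lambda>_. 0"] F0 by auto
    have "N.B v w = 0" for w
    proof -
      have "w \<in> closure (span (F ` M.C))" using F_dense by simp
      then obtain x where x: "\<And>n. x n \<in> span (F ` M.C)" "x \<longlonglongrightarrow> w" unfolding closure_sequential by blast
      have "(\<lambda>n. N.B v (x n)) \<longlonglongrightarrow> N.B v w" by (intro N.tendsto_B tendsto_const x)
      then show ?thesis using sp[OF x(1)] by (simp add: LIMSEQ_const_iff)
    qed
    then show ?thesis using lorentz_nondegenerate[OF N.e_nz] by blast
  qed
  then show ?thesis using subspace_0[OF V(1)] by blast
qed

lemma \<rho>_irreducible: "irreducible_action (Isom b) e \<rho>"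
  unfolding irreducible_action_def
proof (intro allI impI)
  fix V assume V: "subspace V \<and> closed V \<and> (\<forall>h\<in>carrier (Isom b). lin_ext e (\<rho> h) ` V \<subseteq> V)"
  have "R A ` V \<subseteq> V" if A: "A \<in> M.LO" for A
  proof -
    have "lin_ext e (\<rho> (restrict A M.H)) ` V \<subseteq> V" using V M.restrict_Isom[OF A] by blast
    then show ?thesis by (simp only: lin_ext_\<rho>[OF M.restrict_Isom[OF A]] M.lin_ext_restrict[OF A])
  qed
  then show "V = {0} \<or> V = UNIV" using invariant_trivial V by blast
qed

text \<open>The eigenvalue \<open>exp t\<close> at \<open>F up\<close> bounds the length from below;
  the displacement of \<open>e0\<close>, which lies on the axis, bounds it from above.\<close>

lemma tlen_R_a: "N.tlen (R (M.a 1)) = t"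
proof (rule antisym)
  note L = R(1)[OF M.a_LO, of 1]
  have "\<bar>ln (exp (t * 1))\<bar> \<le> N.tlen (R (M.a 1))"
    by (rule N.eigen_le_tlen(2)[OF L F_C[OF M.up_C] R_a(1)])
  then show "t \<le> N.tlen (R (M.a 1))" using t by simp
  have "N.tlen (R (M.a 1)) \<le> N.D (R (M.a 1) N.e0) N.e0" by (rule N.tlen_le[OF N.e0_H])
  also have "N.B (R (M.a 1) N.e0) N.e0 = cosh t"
  proof -
    have "R (M.a 1) N.e0 = (1 / sqrt 2) *\<^sub>R (exp t *\<^sub>R F M.up + exp (- t) *\<^sub>R F M.um)"
      by (subst F_e0) (simp add: N.LO_scale[OF L] N.LO_add[OF L] R_a)
    then show ?thesis
      by (simp add: F_e0 lorentz_simps F_up_um F_null M.up_C M.um_C cosh_def field_simps)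
  qed
  then have "N.D (R (M.a 1) N.e0) N.e0 = t"
    using t by (simp add: N.D_arcosh[OF N.LO_H[OF L N.e0_H] N.e0_H] arcosh_cosh_real)
  finally show "N.tlen (R (M.a 1)) \<le> t" .
qed

text \<open>The results on non-elementary actions apply to the constructed one, so the single
  element \<open>a 1\<close> determines the factor for all.\<close>

lemma transl_length_\<rho>:
  assumes inf: "\<not> (\<exists>S::'h set. finite S \<and> span S = UNIV)" and h: "h \<in> carrier (Isom b)"
  shows "transl_length e (\<rho> h) = t * transl_length b h"
proof -
  have "\<not> elementary_action (Isom b) e \<rho>"
    by (rule irreducible_nonelementary[OF N.e_nz inf \<rho>_carrier \<rho>_irreducible])
  then interpret act: hyp_action b f g e \<rho>
    by unfold_locales (use \<rho>_hom \<rho>_continuous in auto)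
  have "act.R (M.a 1) = R (M.a 1)"
    unfolding act.R_def using lin_ext_\<rho>[OF M.restrict_Isom[OF M.a_LO]] M.lin_ext_restrict[OF M.a_LO] by simp
  then have "act.rep.\<tau> = t" using tlen_R_a by (simp add: act.rep.\<tau>_def)
  then show ?thesis using act.transl_length_\<rho>[OF h] by simp
qed

end

theorem theorem2:
  fixes n :: nat
    and b :: "'m::euclidean_space"
    and e :: "'h::{real_inner, complete_space}"
  assumes "n \<ge> 2"
    and "DIM('m) = n + 1" and "b \<noteq> 0"
    and "\<not> (\<exists>S::'h set. finite S \<and> span S = UNIV)" and "e \<noteq> 0"
  shows "(\<forall>\<rho>. \<rho> \<in> hom (Isom b) (Isom e) \<and> continuous_action (Isom_topology b) e \<rho> \<and>
              \<not> elementary_action (Isom b) e \<rho> \<longrightarrow>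
            (\<exists>t::real. 0 < t \<and> t \<le> 1 \<and>
               (\<forall>g\<in>carrier (Isom b). transl_length e (\<rho> g) = t * transl_length b g) \<and>
               (t = 1 \<longleftrightarrow>
                  (\<exists>X. totally_geodesic_dim e n X \<and> (\<forall>g\<in>carrier (Isom b). \<rho> g ` X = X))))) \<and>
         (separable_space (euclidean :: 'h topology) \<longrightarrow>
            (\<forall>t::real. 0 < t \<and> t < 1 \<longrightarrow>
               (\<exists>\<rho>. (\<rho> \<in> hom (Isom b) (Isom e) \<and> continuous_action (Isom_topology b) e \<rho> \<and>
                      irreducible_action (Isom b) e \<rho> \<and>
                      (\<forall>g\<in>carrier (Isom b). transl_length e (\<rho> g) = t * transl_length b g)) \<and>
                    (\<forall>\<sigma>. \<sigma> \<in> hom (Isom b) (Isom e) \<and> continuous_action (Isom_topology b) e \<sigma> \<and>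
                         irreducible_action (Isom b) e \<sigma> \<and>
                         (\<forall>g\<in>carrier (Isom b). transl_length e (\<sigma> g) = t * transl_length b g) \<longrightarrow>
                       conjugate_actions (Isom b) e \<rho> \<sigma>))))"
proof -
  interpret M: euclidean_lorentz b by unfold_locales (rule assms(3))
  interpret N: complete_lorentz_space e by unfold_locales (rule assms(5))
  \<comment> \<open>Dimension \<open>n + 1 \<ge> 3\<close> leaves room for an axis and a
    horospherical direction next to \<open>e0\<close>.\<close>
  obtain f g where fg: "inner f f = 1" "inner f M.e0 = 0" "inner g g = 1" "inner g M.e0 = 0" "inner g f = 0"
    using ex_orthonormal_triple[of M.e0] assms(1,2) by auto
  interpret P: frame_pair b f g e by unfold_locales (rule fg)+
  have act: "hyp_action b f g e \<rho>"
    if "\<rho> \<in> hom (Isom b) (Isom e)" "continuous_action (Isom_topology b) e \<rho>" "\<not> elementary_action (Isom b) e \<rho>" for \<rho>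
    by unfold_locales (rule that)+
  have nonel: "\<not> elementary_action (Isom b) e \<sigma>"
    if "\<sigma> \<in> hom (Isom b) (Isom e)" "irreducible_action (Isom b) e \<sigma>" for \<sigma>
    by (rule irreducible_nonelementary[OF assms(5,4) _ that(2)]) (use that(1) in \<open>auto simp: hom_def\<close>)
  show ?thesis
  proof (intro conjI allI impI)
    fix \<rho> assume \<rho>: "\<rho> \<in> hom (Isom b) (Isom e) \<and> continuous_action (Isom_topology b) e \<rho> \<and> \<not> elementary_action (Isom b) e \<rho>"
    interpret r: hyp_action b f g e \<rho> by (rule act) (use \<rho> in auto)
    show "\<exists>t::real. 0 < t \<and> t \<le> 1 \<and>
               (\<forall>g\<in>carrier (Isom b). transl_length e (\<rho> g) = t * transl_length b g) \<and>
               (t = 1 \<longleftrightarrow>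
                  (\<exists>X. totally_geodesic_dim e n X \<and> (\<forall>g\<in>carrier (Isom b). \<rho> g ` X = X)))"
      using r.rep.\<tau>_pos r.rep.\<tau>_le1 r.transl_length_\<rho> r.\<tau>_eq_1_iff[OF assms(2)] by (intro exI[of _ r.rep.\<tau>]) simp
  next
    fix t :: real assume sep: "separable_space (euclidean :: 'h topology)" and t: "0 < t \<and> t < 1"
    obtain F :: "'m \<Rightarrow> 'h" where F: "(\<forall>u\<in>M.C. F u \<in> N.C) \<and> (\<forall>u\<in>M.C. \<forall>v\<in>M.C. N.B (F u) (F v) = M.B u v powr t) \<and>
      closure (span (F ` M.C)) = UNIV \<and> N.e0 = (1 / sqrt 2) *\<^sub>R (F P.M.up + F P.M.um)"
      using P.ex_model[OF _ _ sep assms(4)] t by blast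
    interpret m: null_model b f g e F t by unfold_locales (use F t in auto)
    let ?\<rho> = m.\<rho>
    have len: "transl_length e (?\<rho> h) = t * transl_length b h" if "h \<in> carrier (Isom b)" for h
      by (rule m.transl_length_\<rho>[OF assms(4) that])
    have "conjugate_actions (Isom b) e ?\<rho> \<sigma>"
      if \<sigma>: "\<sigma> \<in> hom (Isom b) (Isom e) \<and> continuous_action (Isom_topology b) e \<sigma> \<and>
             irreducible_action (Isom b) e \<sigma> \<and> (\<forall>g\<in>carrier (Isom b). transl_length e (\<sigma> g) = t * transl_length b g)" for \<sigma>
    proof (rule irreducible_unique[of b f g e ?\<rho> \<sigma> t])
      show "hyp_action b f g e ?\<rho>"
        by (rule act[OF m.\<rho>_hom m.\<rho>_continuous nonel[OF m.\<rho>_hom m.\<rho>_irreducible]])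
      show "hyp_action b f g e \<sigma>" using \<sigma> by (intro act nonel) auto
    qed (use \<sigma> len m.\<rho>_irreducible in auto)
    then show "\<exists>\<rho>. (\<rho> \<in> hom (Isom b) (Isom e) \<and> continuous_action (Isom_topology b) e \<rho> \<and>
                      irreducible_action (Isom b) e \<rho> \<and>
                      (\<forall>g\<in>carrier (Isom b). transl_length e (\<rho> g) = t * transl_length b g)) \<and>
                    (\<forall>\<sigma>. \<sigma> \<in> hom (Isom b) (Isom e) \<and> continuous_action (Isom_topology b) e \<sigma> \<and>
                         irreducible_action (Isom b) e \<sigma> \<and>
                         (\<forall>g\<in>carrier (Isom b). transl_length e (\<sigma> g) = t * transl_length b g) \<longrightarrow>
                       conjugate_actions (Isom b) e \<rho> \<sigma>)"
      using m.\<rho>_hom m.\<rho>_continuous m.\<rho>_irreducible len by (intro exI[of _ ?\<rho>]) simp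
  qed
qed

end
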